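(* Let $X$ and $Y$ be connected topological manifolds of equal dimensions, with $X$ compact. Let $f\colon X\to Y$ be a continuous mapping such that $f(\partial X)\subseteq \partial Y$ and such that $f|_{\partial X}$ and $f|_{X\setminus\partial X}$ are immersions. Suppose that $X$ and $Y$ have nonempty boundaries with the same number $k$ of connected components, $\partial X=\coprod_{i=1}^k A_i$ and $\partial Y=\coprod_{i=1}^k B_i$, where $A_1,\dots,A_k$ and $B_1,\dots,B_k$ are the connected components. Suppose that there exists $j\in\{1,\dots,k\}$ such that $f(A_j)\subseteq B_j$ and there is no proper subgroup of finite index in $\pi_1(B_j)$ that is isomorphic to $\pi_1(A_j)$. Then $f$ is a homeomorphism of $X$ onto $Y$.
   Context: An $n$-dimensional topological manifold is a Hausdorff topological space having a countable cover by open sets each of which is homeomorphic either to $\mathbb{R}^n$ or to the half-space $\mathbb{R}^n_+=\{(x_1,\ldots,x_n) : x_i\in\mathbb{R},\ x_1\ge 0\}$. Points having a neighborhood homeomorphic to $\mathbb{R}^n$ are interior points; the boundary $\partial X$ is the subspace of points that are not interior. A continuous mapping $g\colon A\to B$ of topological spaces is called an immersion if every point $a\in A$ has a neighborhood $U$ in $A$ such that $g|_U$ is a homeomorphism of $U$ onto $g(U)$. In particular, "$f|_{\partial X}$ is an immersion" refers to neighborhoods in $\partial X$, not in $X$. A proper subgroup is a subgroup that does not coincide with the whole group. *)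

theory Defs
  imports "HOL-Analysis.Analysis" "HOL-Algebra.Coset"
begin

section \<open>Topological manifolds with boundary\<close>

text \<open>
  The model spaces live in \<^typ>\<open>nat \<Rightarrow> real\<close>: the coordinates \<open>x\<^sub>1, \<dots>, x\<^sub>n\<close> are \<open>x 0, \<dots>, x (n - 1)\<close>,
  and the remaining ones vanish. For \<open>n = 0\<close> the half-space is the point \<open>\<real>\<^sup>0\<close> itself, so that
  a 0-dimensional manifold has empty boundary.
\<close>

definition half_space :: "nat \<Rightarrow> (nat \<Rightarrow> real) topology" where
  "half_space n = subtopology (Euclidean_space n) {x. x 0 \<ge> 0}"

definition topological_manifold :: "nat \<Rightarrow> 'a topology \<Rightarrow> bool" where
  "topological_manifold n X \<longleftrightarrow>
     Hausdorff_space X \<and>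
     (\<exists>\<U>. countable \<U> \<and> \<Union>\<U> = topspace X \<and>
          (\<forall>U\<in>\<U>. openin X U \<and>
             (subtopology X U homeomorphic_space Euclidean_space n \<or>
              subtopology X U homeomorphic_space half_space n)))"

definition manifold_interior :: "nat \<Rightarrow> 'a topology \<Rightarrow> 'a set" where
  "manifold_interior n X =
     {x. \<exists>U. openin X U \<and> x \<in> U \<and> subtopology X U homeomorphic_space Euclidean_space n}"

definition manifold_boundary :: "nat \<Rightarrow> 'a topology \<Rightarrow> 'a set" where
  "manifold_boundary n X = topspace X - manifold_interior n X"

section \<open>Topological immersions\<close>

definition top_immersion :: "'a topology \<Rightarrow> 'b topology \<Rightarrow> ('a \<Rightarrow> 'b) \<Rightarrow> bool" where
  "top_immersion A B g \<longleftrightarrow>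
     continuous_map A B g \<and>
     (\<forall>a\<in>topspace A. \<exists>U. openin A U \<and> a \<in> U \<and>
        homeomorphic_map (subtopology A U) (subtopology B (g ` U)) g)"

section \<open>The fundamental group\<close>

text \<open>
  Loops are functions on \<open>real\<close> of which only the values on \<open>{0..1}\<close> matter: any two that agree
  there are homotopic in the sense below. The library's \<open>+++\<close> and \<open>homotopic_paths\<close> need a
  topological type class on the points, hence the versions for abstract topologies.
\<close>

definition loops_at :: "'a topology \<Rightarrow> 'a \<Rightarrow> (real \<Rightarrow> 'a) set" where
  "loops_at X x = {p. pathin X p \<and> p 0 = x \<and> p 1 = x}"

definition loop_homotopy :: "'a topology \<Rightarrow> 'a \<Rightarrow> ((real \<Rightarrow> 'a) \<times> (real \<Rightarrow> 'a)) set" where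
  "loop_homotopy X x =
     {(p, q). homotopic_with (\<lambda>h. h 0 = x \<and> h 1 = x) (top_of_set {0..1}) X p q}"

definition path_concat :: "(real \<Rightarrow> 'a) \<Rightarrow> (real \<Rightarrow> 'a) \<Rightarrow> real \<Rightarrow> 'a" where
  "path_concat p q = (\<lambda>t. if t \<le> 1/2 then p (2 * t) else q (2 * t - 1))"

definition fundamental_group :: "'a topology \<Rightarrow> 'a \<Rightarrow> (real \<Rightarrow> 'a) set monoid" where
  "fundamental_group X x =
     \<lparr>carrier = loops_at X x // loop_homotopy X x,
      mult = (\<lambda>P Q. \<Union>p\<in>P. \<Union>q\<in>Q. loop_homotopy X x `` {path_concat p q}),
      one = loop_homotopy X x `` {\<lambda>t. x}\<rparr>"

lemma equiv_loop_homotopy: "equiv (loops_at X x) (loop_homotopy X x)"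
proof (rule equivI)
  show "loop_homotopy X x \<subseteq> loops_at X x \<times> loops_at X x"
  proof clarify
    fix p q assume "(p, q) \<in> loop_homotopy X x"
    then have "homotopic_with (\<lambda>h. h 0 = x \<and> h 1 = x) (top_of_set {0..1}) X p q"
      by (simp add: loop_homotopy_def)
    from homotopic_with_imp_continuous_maps[OF this] homotopic_with_imp_property[OF this]
    show "p \<in> loops_at X x \<and> q \<in> loops_at X x"
      by (simp add: loops_at_def pathin_def)
  qed
  show "refl_on (loops_at X x) (loop_homotopy X x)"
    by (simp add: refl_on_def loop_homotopy_def loops_at_def pathin_def)
  show "sym (loop_homotopy X x)"
    unfolding sym_def loop_homotopy_def mem_Collect_eq case_prod_conv
    by (intro allI impI) (erule homotopic_with_symD)
  show "trans (loop_homotopy X x)"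
    unfolding trans_def loop_homotopy_def mem_Collect_eq case_prod_conv
    by (intro allI impI) (erule (1) homotopic_with_trans)
qed

lemma loop_homotopy_reparam:
  assumes p: "p \<in> loops_at X x"
    and cont: "continuous_on {0..1} \<phi>" "continuous_on {0..1} \<psi>"
    and range: "\<And>t. t \<in> {0..1} \<Longrightarrow> \<phi> t \<in> {0..1}" "\<And>t. t \<in> {0..1} \<Longrightarrow> \<psi> t \<in> {0..1}"
    and ends: "\<phi> 0 = \<psi> 0" "\<phi> 1 = \<psi> 1" "\<phi> 0 \<in> {0,1}" "\<phi> 1 \<in> {0,1}"
  shows "(p \<circ> \<phi>, p \<circ> \<psi>) \<in> loop_homotopy X x"
proof -
  have "continuous_on ({0..1} \<times> {0..1}) (\<lambda>z. (1 - fst z) * \<phi> (snd z) + fst z * \<psi> (snd z))"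
    by (intro continuous_intros continuous_on_compose2[OF cont(1)]
        continuous_on_compose2[OF cont(2)]) auto
  moreover have "(1 - s) * \<phi> t + s * \<psi> t \<in> {0..1}" if "s \<in> {0..1}" "t \<in> {0..1}" for s t
  proof -
    have "(1 - s) *\<^sub>R \<phi> t + s *\<^sub>R \<psi> t \<in> {0..1}"
      using that range by (intro convexD[OF convex_real_interval(5)]) auto
    then show ?thesis by simp
  qed
  ultimately have "continuous_map (prod_topology (top_of_set {0..1}) (top_of_set {0..1}))
      (top_of_set {0..1}) (\<lambda>z. (1 - fst z) * \<phi> (snd z) + fst z * \<psi> (snd z))"
    by (auto simp: prod_topology_subtopology subtopology_subtopology Times_Int_Times continuous_map_in_subtopology
        simp flip: subtopology_Times)
  moreover have "continuous_map (top_of_set {0..1}) X p"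
    using p by (simp add: loops_at_def pathin_def)
  ultimately have 1: "continuous_map (prod_topology (top_of_set {0..1}) (top_of_set {0..1})) X
      (p \<circ> (\<lambda>z. (1 - fst z) * \<phi> (snd z) + fst z * \<psi> (snd z)))"
      (is "continuous_map _ _ ?H")
    by (rule continuous_map_compose)
  have eq: "(1 - s) * c + s * c = c" for s c :: real
    by (simp add: algebra_simps)
  have "p (\<psi> 0) = x" "p (\<psi> 1) = x"
    using p ends by (auto simp: loops_at_def)
  then have "?H (s, 0) = x \<and> ?H (s, 1) = x" for s
    by (simp add: ends(1,2) eq)
  moreover have "?H (0, t) = (p \<circ> \<phi>) t" "?H (1, t) = (p \<circ> \<psi>) t" for t
    by simp_all
  ultimately show ?thesis
    unfolding loop_homotopy_def homotopic_with_def mem_Collect_eq case_prod_conv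
    using 1 by (intro exI[of _ ?H]) simp
qed

lemma loop_homotopy_path_concat:
  assumes "(p, p') \<in> loop_homotopy X x" "(q, q') \<in> loop_homotopy X x"
  shows "(path_concat p q, path_concat p' q') \<in> loop_homotopy X x"
proof -
  let ?I = "top_of_set {0..1::real}"
  obtain h where h: "continuous_map (prod_topology ?I ?I) X h" "\<And>t. h (0, t) = p t"
      "\<And>t. h (1, t) = p' t" "\<And>s. s \<in> {0..1} \<Longrightarrow> h (s, 0) = x \<and> h (s, 1) = x"
    using assms(1) by (auto simp: loop_homotopy_def homotopic_with_def)
  obtain k where k: "continuous_map (prod_topology ?I ?I) X k" "\<And>t. k (0, t) = q t"
      "\<And>t. k (1, t) = q' t" "\<And>s. s \<in> {0..1} \<Longrightarrow> k (s, 0) = x \<and> k (s, 1) = x"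
    using assms(2) by (auto simp: loop_homotopy_def homotopic_with_def)
  define H where "H z = (if snd z \<le> 1/2 then (h \<circ> (\<lambda>z. (fst z, 2 * snd z))) z
    else (k \<circ> (\<lambda>z. (fst z, 2 * snd z - 1))) z)" for z
  have "continuous_map (prod_topology ?I ?I) X H"
    unfolding H_def
  proof (rule continuous_map_cases_le)
    show "continuous_map (prod_topology ?I ?I) euclideanreal snd"
      "continuous_map (prod_topology ?I ?I) euclideanreal (\<lambda>z. 1/2)"
      by (auto simp: prod_topology_subtopology subtopology_subtopology Times_Int_Times continuous_on_snd simp flip: subtopology_Times)
    show "continuous_map (subtopology (prod_topology ?I ?I)
        {z \<in> topspace (prod_topology ?I ?I). snd z \<le> 1/2}) X (h \<circ> (\<lambda>z. (fst z, 2 * snd z)))"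
      by (rule continuous_map_compose[OF _ h(1)])
        (auto simp: prod_topology_subtopology subtopology_subtopology continuous_map_in_subtopology Times_Int_Times
          simp flip: subtopology_Times intro!: continuous_intros)
    show "continuous_map (subtopology (prod_topology ?I ?I)
        {z \<in> topspace (prod_topology ?I ?I). 1/2 \<le> snd z}) X (k \<circ> (\<lambda>z. (fst z, 2 * snd z - 1)))"
      by (rule continuous_map_compose[OF _ k(1)])
        (auto simp: prod_topology_subtopology subtopology_subtopology continuous_map_in_subtopology Times_Int_Times
          simp flip: subtopology_Times intro!: continuous_intros)
  next
    fix z assume "z \<in> topspace (prod_topology ?I ?I)" "snd z = 1/2"
    then obtain s where "z = (s, 1/2)" "s \<in> {0..1}" by (cases z) auto
    then show "(h \<circ> (\<lambda>z. (fst z, 2 * snd z))) z = (k \<circ> (\<lambda>z. (fst z, 2 * snd z - 1))) z"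
      using h(4) k(4) by simp
  qed
  moreover have "H (0, t) = path_concat p q t" "H (1, t) = path_concat p' q' t" for t
    by (simp_all add: H_def path_concat_def h(2,3) k(2,3))
  moreover have "H (s, 0) = x \<and> H (s, 1) = x" if "s \<in> {0..1}" for s
    using h(4)[OF that] k(4)[OF that] by (simp add: H_def)
  ultimately show ?thesis
    unfolding loop_homotopy_def homotopic_with_def mem_Collect_eq case_prod_conv by blast
qed

lemma group_fundamental_group:
  assumes x: "x \<in> topspace X"
  shows "group (fundamental_group X x)"
proof -
  let ?L = "loops_at X x" and ?R = "loop_homotopy X x"
  let ?cls = "\<lambda>p. ?R `` {p}"
  note eq = equiv_loop_homotopy[of X x]
  have R_refl: "(p, p) \<in> ?R" if "p \<in> ?L" for p
    using eq that by (simp add: equiv_def refl_on_def)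
  have R_loops: "p \<in> ?L" "q \<in> ?L" if "(p, q) \<in> ?R" for p q
    using eq that by (auto simp: equiv_def)
  have cls_eq: "?cls p = ?cls q" if "(p, q) \<in> ?R" for p q
    using equiv_class_eq[OF eq that] .
  have concat: "path_concat p q \<in> ?L" if "p \<in> ?L" "q \<in> ?L" for p q
    using loop_homotopy_path_concat R_refl R_loops that by metis
  have const: "(\<lambda>t. x) \<in> ?L"
    using x by (simp add: loops_at_def pathin_def)
  have resp: "(\<lambda>p q. ?cls (path_concat p q)) respects2 ?R"
    by (auto simp: congruent2_def intro!: cls_eq loop_homotopy_path_concat)
  have mult: "?cls p \<otimes>\<^bsub>fundamental_group X x\<^esub> ?cls q = ?cls (path_concat p q)"
    if "p \<in> ?L" "q \<in> ?L" for p q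
    using UN_equiv_class2[OF eq eq resp that] by (simp add: fundamental_group_def)
  have car: "carrier (fundamental_group X x) = ?L // ?R"
    by (simp add: fundamental_group_def)
  have one: "\<one>\<^bsub>fundamental_group X x\<^esub> = ?cls (\<lambda>t. x)"
    by (simp add: fundamental_group_def)
  show ?thesis
  proof (rule groupI; unfold car one)
    fix P Q assume "P \<in> ?L // ?R" "Q \<in> ?L // ?R"
    then show "P \<otimes>\<^bsub>fundamental_group X x\<^esub> Q \<in> ?L // ?R"
      by (auto elim!: quotientE simp: mult intro!: quotientI concat)
  next
    show "?cls (\<lambda>t. x) \<in> ?L // ?R"
      using const by (rule quotientI)
  next
    fix P Q S assume "P \<in> ?L // ?R" "Q \<in> ?L // ?R" "S \<in> ?L // ?R"
    then obtain p q s where L: "p \<in> ?L" "q \<in> ?L" "s \<in> ?L"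
      and PQS: "P = ?cls p" "Q = ?cls q" "S = ?cls s"
      by (auto elim!: quotientE)
    define \<phi> :: "real \<Rightarrow> real" where "\<phi> t = min (2 * t) (min (t + 1/4) (t / 2 + 1/2))" for t
    have 1: "path_concat (path_concat p q) s = path_concat p (path_concat q s) \<circ> \<phi>"
    proof
      fix t :: real
      consider "t \<le> 1/4" | "1/4 < t" "t \<le> 1/2" | "1/2 < t" by linarith
      then show "path_concat (path_concat p q) s t = (path_concat p (path_concat q s) \<circ> \<phi>) t"
      proof cases
        case 1
        then have "\<phi> t = 2 * t" by (simp add: \<phi>_def)
        with 1 show ?thesis by (simp add: path_concat_def)
      next
        case 2
        then have "\<phi> t = t + 1/4" by (simp add: \<phi>_def)
        with 2 show ?thesis by (simp add: path_concat_def algebra_simps)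
      next
        case 3
        then have "\<phi> t = t / 2 + 1/2" by (simp add: \<phi>_def)
        with 3 show ?thesis by (simp add: path_concat_def algebra_simps)
      qed
    qed
    have "(path_concat p (path_concat q s) \<circ> \<phi>, path_concat p (path_concat q s) \<circ> (\<lambda>t. t)) \<in> ?R"
      by (rule loop_homotopy_reparam) (auto simp: \<phi>_def concat L intro!: continuous_intros)
    then have 2: "(path_concat (path_concat p q) s, path_concat p (path_concat q s)) \<in> ?R"
      using 1 by (simp add: o_def)
    show "P \<otimes>\<^bsub>fundamental_group X x\<^esub> Q \<otimes>\<^bsub>fundamental_group X x\<^esub> S =
        P \<otimes>\<^bsub>fundamental_group X x\<^esub> (Q \<otimes>\<^bsub>fundamental_group X x\<^esub> S)"
      using cls_eq[OF 2] by (simp add: PQS L mult concat)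
  next
    fix P assume "P \<in> ?L // ?R"
    then obtain p where L: "p \<in> ?L" and P: "P = ?cls p"
      by (auto elim!: quotientE)
    have "path_concat (\<lambda>t. x) p = p \<circ> (\<lambda>t. max 0 (2 * t - 1))"
    proof
      fix t
      have "p 0 = x" using L by (simp add: loops_at_def)
      then show "path_concat (\<lambda>t. x) p t = (p \<circ> (\<lambda>t. max 0 (2 * t - 1))) t"
      proof (cases "t \<le> 1/2")
        case True
        then have "max 0 (2 * t - 1) = 0" by simp
        with True \<open>p 0 = x\<close> show ?thesis by (simp only: path_concat_def o_def if_True)
      next
        case False
        then have "max 0 (2 * t - 1) = 2 * t - 1" by simp
        with False show ?thesis by (simp only: path_concat_def o_def if_False)
      qed
    qed
    moreover have "(p \<circ> (\<lambda>t. max 0 (2 * t - 1)), p \<circ> (\<lambda>t. t)) \<in> ?R"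
    proof (rule loop_homotopy_reparam[OF L])
      show "continuous_on {0..1} (\<lambda>t::real. max 0 (2 * t - 1))"
        by (intro continuous_intros)
    qed (simp_all add: continuous_on_id)
    ultimately have "(path_concat (\<lambda>t. x) p, p) \<in> ?R"
      by (simp add: o_def)
    then show "?cls (\<lambda>t. x) \<otimes>\<^bsub>fundamental_group X x\<^esub> P = P"
      unfolding P mult[OF const L] by (rule cls_eq)
  next
    fix P assume "P \<in> ?L // ?R"
    then obtain p where L: "p \<in> ?L" and P: "P = ?cls p"
      by (auto elim!: quotientE)
    have "(p \<circ> (\<lambda>t. 1 - t), p \<circ> (\<lambda>t. 1 - t)) \<in> ?R"
      by (rule loop_homotopy_reparam[OF L]) (auto intro!: continuous_intros)
    then have rev: "p \<circ> (\<lambda>t. 1 - t) \<in> ?L"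
      by (rule R_loops)
    have "path_concat (p \<circ> (\<lambda>t. 1 - t)) p = p \<circ> (\<lambda>t. \<bar>1 - 2 * t\<bar>)"
      by (rule ext) (simp add: path_concat_def abs_if)
    moreover have "(p \<circ> (\<lambda>t. \<bar>1 - 2 * t\<bar>), p \<circ> (\<lambda>t. 1)) \<in> ?R"
      by (rule loop_homotopy_reparam[OF L]) (auto intro!: continuous_intros)
    ultimately have "(path_concat (p \<circ> (\<lambda>t. 1 - t)) p, \<lambda>t. x) \<in> ?R"
      using L by (simp add: o_def loops_at_def)
    then have "?cls (p \<circ> (\<lambda>t. 1 - t)) \<otimes>\<^bsub>fundamental_group X x\<^esub> P = ?cls (\<lambda>t. x)"
      unfolding P mult[OF rev L] by (rule cls_eq)
    then show "\<exists>Q\<in>?L // ?R. Q \<otimes>\<^bsub>fundamental_group X x\<^esub> P = ?cls (\<lambda>t. x)"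
      using rev by (blast intro: quotientI)
  qed
qed

end

theory Submission
  imports Defs "HOL-Homology.Homology"
begin

text \<open>
  Why the theorem holds. By invariance of domain the interior of \<open>X\<close> is mapped into the interior of
  \<open>Y\<close>, so \<open>f\<close> respects the decompositions into interior and boundary on both sides. It restricts to
  a proper local homeomorphism, that is, to a finite covering, between the interiors and also between
  the boundaries, which are manifolds one dimension lower. The interior of \<open>Y\<close> is connected and dense, so \<open>f\<close> is
  onto, and it remains to prove that \<open>f\<close> is injective.

  On boundaries, \<open>f\<close> maps components onto components. There are \<open>k\<close> of them on both sides, so \<open>A j\<close>
  is the full preimage of \<open>B j\<close> in the boundary. The covering of \<open>B j\<close> by \<open>A j\<close> embeds the
  fundamental group of \<open>A j\<close> as a subgroup of finite index, proper unless the covering has a single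
  sheet (\<open>covering_fibre_trivial\<close>). By the hypothesis on subgroups there is one sheet, and a point of
  \<open>B j\<close> has only one preimage in all of \<open>X\<close>.

  That single fibre determines everything (\<open>homeomorphic_from_one_fibre\<close>). A small half-ball \<open>V\<close> at a
  boundary point \<open>y\<close> has a contractible interior, over which the covering of interiors falls into
  sheets. Each sheet accumulates at a point of the fibre over \<open>y\<close>, but the interior of a half-ball at
  a point of that fibre is connected and belongs to only one sheet. So one point over \<open>y\<close> means one sheet:
  the covering of interiors has degree one (\<open>interior_inj\<close>). Conversely, once the degree
  is one, every boundary point has only one preimage (\<open>boundary_inj\<close>). The behaviour of \<open>f\<close> across
  the boundary is thus controlled by the connectedness of the interiors of half-balls.

  The lifting theory is developed for abstract topologies, where \<open>covering_lift_homotopy\<close> is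
  the basic tool: it gives the injection of fundamental groups as well as the sections over
  Euclidean pieces that play the part of the sheets above.
\<close>

section \<open>Covering maps between abstract topological spaces\<close>

abbreviation I01 :: "real topology" where "I01 \<equiv> top_of_set {0..1}"

text \<open>
  The sheets over \<open>V\<close> are given pointwise: every point over \<open>V\<close> lies in an open set that maps
  homeomorphically onto \<open>V\<close>. Existence of lifts uses a sheet through a given point, and uniqueness
  of lifts follows from local injectivity when \<open>E\<close> is Hausdorff.
\<close>

definition covering_map :: "'a topology \<Rightarrow> 'b topology \<Rightarrow> ('a \<Rightarrow> 'b) \<Rightarrow> bool" where
  "covering_map E B p \<longleftrightarrow>
     continuous_map E B p \<and>
     (\<forall>y\<in>topspace B. \<exists>V. openin B V \<and> y \<in> V \<and>
        (\<forall>e\<in>topspace E. p e \<in> V \<longrightarrow>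
           (\<exists>U q. openin E U \<and> e \<in> U \<and> homeomorphic_maps (subtopology E U) (subtopology B V) p q)))"

definition local_homeomorphism :: "'a topology \<Rightarrow> 'b topology \<Rightarrow> ('a \<Rightarrow> 'b) \<Rightarrow> bool" where
  "local_homeomorphism E B p \<longleftrightarrow>
     (\<forall>e\<in>topspace E. \<exists>U. openin E U \<and> e \<in> U \<and> openin B (p ` U) \<and>
        homeomorphic_map (subtopology E U) (subtopology B (p ` U)) p)"

text \<open>
  The working form of the definition: the inverse of \<open>p\<close> on a sheet, as a map into all of \<open>E\<close>.
\<close>

lemma covering_map_sheets:
  assumes "covering_map E B p" "y \<in> topspace B"
  shows "\<exists>V. openin B V \<and> y \<in> V \<and> (\<forall>e\<in>topspace E. p e \<in> V \<longrightarrow>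
    (\<exists>U q. openin E U \<and> e \<in> U \<and> continuous_map (subtopology B V) E q \<and>
       (\<forall>u\<in>U. p u \<in> V \<and> q (p u) = u) \<and> (\<forall>v\<in>V. q v \<in> U \<and> p (q v) = v)))"
proof -
  obtain V where V: "openin B V" "y \<in> V"
    and sheet: "\<And>e. \<lbrakk>e \<in> topspace E; p e \<in> V\<rbrakk> \<Longrightarrow>
      \<exists>U q. openin E U \<and> e \<in> U \<and> homeomorphic_maps (subtopology E U) (subtopology B V) p q"
    using assms unfolding covering_map_def by metis
  have "topspace (subtopology B V) = V"
    using V(1) by (simp add: openin_subset inf.absorb2)
  moreover have "topspace (subtopology E U) = U" if "openin E U" for U
    using that by (simp add: openin_subset inf.absorb2)
  ultimately have "\<exists>U q. openin E U \<and> e \<in> U \<and> continuous_map (subtopology B V) E q \<and>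
       (\<forall>u\<in>U. p u \<in> V \<and> q (p u) = u) \<and> (\<forall>v\<in>V. q v \<in> U \<and> p (q v) = v)"
    if "e \<in> topspace E" "p e \<in> V" for e
    using sheet[OF that] unfolding homeomorphic_maps_def continuous_map_in_subtopology
    by (smt (verit, best) Pi_iff)
  with V show ?thesis by blast
qed

lemma local_homeomorphism_continuous_map:
  assumes "local_homeomorphism E B p"
  shows "continuous_map E B p"
proof -
  obtain U where U: "\<And>e. e \<in> topspace E \<Longrightarrow> openin E (U e) \<and> e \<in> U e \<and>
      homeomorphic_map (subtopology E (U e)) (subtopology B (p ` U e)) p"
    using assms unfolding local_homeomorphism_def by metis
  show ?thesis
  proof (rule pasting_lemma[where I="topspace E" and T=U and f="\<lambda>_. p"])
    fix e assume "e \<in> topspace E"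
    then show "continuous_map (subtopology E (U e)) B p"
      using U homeomorphic_imp_continuous_map continuous_map_in_subtopology by blast
  qed (use U in auto)
qed

lemma local_homeomorphism_small:
  assumes "local_homeomorphism E B p" "openin E N" "e \<in> N"
  obtains U where "openin E U" "e \<in> U" "U \<subseteq> N" "openin B (p ` U)"
    "homeomorphic_map (subtopology E U) (subtopology B (p ` U)) p"
proof -
  have "e \<in> topspace E" using assms openin_subset by blast
  then obtain U where U: "openin E U" "e \<in> U" "openin B (p ` U)"
    "homeomorphic_map (subtopology E U) (subtopology B (p ` U)) p"
    using assms(1) unfolding local_homeomorphism_def by blast
  have sub: "U \<inter> N \<subseteq> topspace (subtopology E U)"
    using U(1) openin_subset by fastforce
  have "openin (subtopology E U) (U \<inter> N)"
    using assms(2) by (simp add: openin_subtopology_Int2)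
  then have "openin (subtopology B (p ` U)) (p ` (U \<inter> N))"
    using homeomorphic_map_openness[OF U(4) sub] by blast
  then have o: "openin B (p ` (U \<inter> N))"
    using U(3) openin_trans_full by blast
  have "homeomorphic_map (subtopology (subtopology E U) (U \<inter> N))
      (subtopology (subtopology B (p ` U)) (p ` (U \<inter> N))) p"
    using sub homeomorphic_imp_injective_map[OF U(4)] openin_subset[OF U(3)]
    by (intro homeomorphic_map_subtopologies[OF U(4)]) (auto simp: inj_on_def)
  then have "homeomorphic_map (subtopology E (U \<inter> N)) (subtopology B (p ` (U \<inter> N))) p"
    by (simp add: subtopology_subtopology inf.absorb2 image_mono Int_assoc[symmetric])
  with U o assms that[of "U \<inter> N"] show thesis by blast
qed

lemma local_homeomorphism_imp_open_map:
  assumes "local_homeomorphism E B p"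
  shows "open_map E B p"
  unfolding open_map_def
proof (intro allI impI)
  fix N assume N: "openin E N"
  show "openin B (p ` N)"
  proof (subst openin_subopen, intro ballI)
    fix y assume "y \<in> p ` N"
    then obtain e where e: "e \<in> N" "y = p e" by blast
    obtain U where "e \<in> U" "U \<subseteq> N" "openin B (p ` U)"
      using local_homeomorphism_small[OF assms N e(1)] by metis
    with e show "\<exists>T. openin B T \<and> y \<in> T \<and> T \<subseteq> p ` N" by blast
  qed
qed

text \<open>
  A fibre is compact, and each of the open sets on which \<open>p\<close> is injective meets it in one point.
\<close>

lemma proper_local_homeomorphism_finite_fibre:
  assumes "local_homeomorphism E B p" "proper_map E B p" "y \<in> topspace B"
  shows "finite {e \<in> topspace E. p e = y}"
proof -
  let ?F = "{e \<in> topspace E. p e = y}"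
  obtain U where U: "\<And>e. e \<in> topspace E \<Longrightarrow> openin E (U e) \<and> e \<in> U e \<and>
      homeomorphic_map (subtopology E (U e)) (subtopology B (p ` U e)) p"
    using assms(1) unfolding local_homeomorphism_def by metis
  have "compactin E ?F"
    using assms(2,3) by (simp add: proper_map_def)
  then obtain \<F> where \<F>: "finite \<F>" "\<F> \<subseteq> U ` ?F" "?F \<subseteq> \<Union>\<F>"
    using compactinD[of E ?F "U ` ?F"] U by (smt (verit) UN_iff imageE mem_Collect_eq subsetI)
  have "?F \<inter> U e = {e}" if "e \<in> ?F" for e
  proof -
    have "inj_on p (topspace E \<inter> U e)"
      using U that homeomorphic_imp_injective_map by fastforce
    with that U show ?thesis by (auto simp: inj_on_def)
  qed
  then have "finite (?F \<inter> W)" if "W \<in> \<F>" for W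
    using \<F>(2) that by auto
  then have "finite (\<Union>W\<in>\<F>. ?F \<inter> W)"
    using \<F>(1) by blast
  then show ?thesis
    by (rule finite_subset[rotated]) (use \<F>(3) in blast)
qed

text \<open>
  Over \<open>y\<close> choose for each of the finitely many points \<open>e\<close> of the fibre an open \<open>U e\<close> that \<open>p\<close> maps
  homeomorphically onto an open set. As \<open>p\<close> is closed, the image of the complement of all \<open>U e\<close> is
  closed, and it misses \<open>y\<close>. Remove it from the intersection of the sets \<open>p ` U e\<close>: each point over
  the remaining neighbourhood lies in some \<open>U e\<close>, and \<open>U e\<close> maps onto all of that neighbourhood.
\<close>

lemma proper_local_homeomorphism_imp_covering_map:
  assumes lh: "local_homeomorphism E B p" and pr: "proper_map E B p"
  shows "covering_map E B p"
  unfolding covering_map_def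
proof (intro conjI ballI)
  show cont: "continuous_map E B p" by (rule local_homeomorphism_continuous_map[OF lh])
  fix y assume y: "y \<in> topspace B"
  let ?F = "{e \<in> topspace E. p e = y}"
  obtain U where U: "\<And>e. e \<in> topspace E \<Longrightarrow> openin E (U e) \<and> e \<in> U e \<and> openin B (p ` U e) \<and>
      homeomorphic_map (subtopology E (U e)) (subtopology B (p ` U e)) p"
    using lh unfolding local_homeomorphism_def by metis
  have fin: "finite ?F"
    using proper_local_homeomorphism_finite_fibre[OF lh pr y] .
  have "closedin E (topspace E - (\<Union>e\<in>?F. U e))"
    using U by blast
  then have cl: "closedin B (p ` (topspace E - (\<Union>e\<in>?F. U e)))"
    using pr by (simp add: proper_map_def closed_map_def)
  \<comment> \<open>The whole space is included because the fibre, hence the intersection, may be empty.\<close>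
  define V where "V = (topspace B \<inter> (\<Inter>e\<in>?F. p ` U e)) - p ` (topspace E - (\<Union>e\<in>?F. U e))"
  have "openin B (topspace B \<inter> (\<Inter>e\<in>?F. p ` U e))"
    using fin U by (cases "?F = {}") (auto intro!: openin_Int openin_INT simp del: Collect_empty_eq)
  then have oV: "openin B V"
    unfolding V_def using cl by (rule openin_diff)
  have yV: "y \<in> V"
    unfolding V_def using y U by blast
  have "\<exists>U q. openin E U \<and> e \<in> U \<and> homeomorphic_maps (subtopology E U) (subtopology B V) p q"
    if e: "e \<in> topspace E" "p e \<in> V" for e
  proof -
    obtain c where c: "c \<in> ?F" "e \<in> U c"
      using e unfolding V_def by blast
    let ?W = "{x \<in> topspace E. p x \<in> V} \<inter> U c"
    have oW: "openin E ?W"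
      using U c oV cont openin_continuous_map_preimage by blast
    have VU: "V \<subseteq> p ` U c"
      using c unfolding V_def by blast
    have sub: "U c \<subseteq> topspace E" using U c openin_subset by blast
    have "p ` ?W = V" using VU sub by auto
    have "homeomorphic_map (subtopology (subtopology E (U c)) ?W)
      (subtopology (subtopology B (p ` U c)) V) p"
    proof (rule homeomorphic_map_subtopologies)
      show "homeomorphic_map (subtopology E (U c)) (subtopology B (p ` U c)) p"
        using U c by blast
      show "p ` (topspace (subtopology E (U c)) \<inter> ?W) = topspace (subtopology B (p ` U c)) \<inter> V"
        using VU sub openin_subset[OF oV] by auto
    qed
    then have "homeomorphic_map (subtopology E ?W) (subtopology B V) p"
      using VU by (simp add: subtopology_subtopology inf.absorb1 inf.absorb2 Int_commute inf.left_commute Int_absorb)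
    then show ?thesis
      using oW c e unfolding homeomorphic_map_maps by blast
  qed
  with oV yV show "\<exists>V. openin B V \<and> y \<in> V \<and> (\<forall>e\<in>topspace E. p e \<in> V \<longrightarrow>
      (\<exists>U q. openin E U \<and> e \<in> U \<and> homeomorphic_maps (subtopology E U) (subtopology B V) p q))"
    by blast
qed

text \<open>
  Two lifts agree on a closed set since \<open>E\<close> is Hausdorff, and on an open set since \<open>p\<close> is injective on
  a sheet.
\<close>

lemma covering_lift_unique:
  assumes cov: "covering_map E B p" and H: "Hausdorff_space E" and C: "connected_space C"
    and g: "continuous_map C E g" and h: "continuous_map C E h"
    and eq: "\<And>c. c \<in> topspace C \<Longrightarrow> p (g c) = p (h c)"
    and b: "b \<in> topspace C" "g b = h b" and c: "c \<in> topspace C"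
  shows "g c = h c"
proof -
  let ?A = "{c \<in> topspace C. g c = h c}"
  have "closedin C ?A" by (rule closedin_continuous_maps_eq[OF H g h])
  moreover have "openin C ?A"
  proof (subst openin_subopen, intro ballI)
    fix c assume c: "c \<in> ?A"
    have gc: "g c \<in> topspace E"
      using c g by (auto simp: continuous_map_def Pi_iff)
    then have yB: "p (g c) \<in> topspace B"
      using cov by (auto simp: covering_map_def continuous_map_def Pi_iff)
    obtain V where "openin B V" "p (g c) \<in> V"
      and sh: "\<forall>e\<in>topspace E. p e \<in> V \<longrightarrow> (\<exists>U q. openin E U \<and> e \<in> U \<and> continuous_map (subtopology B V) E q \<and>
       (\<forall>u\<in>U. p u \<in> V \<and> q (p u) = u) \<and> (\<forall>v\<in>V. q v \<in> U \<and> p (q v) = v))"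
      using covering_map_sheets[OF cov yB] by (elim exE conjE) (rule that)
    then obtain U q where U: "openin E U" "g c \<in> U" "\<forall>u\<in>U. p u \<in> V \<and> q (p u) = u"
      using bspec[OF sh gc] \<open>p (g c) \<in> V\<close> by blast
    let ?T = "{c \<in> topspace C. g c \<in> U} \<inter> {c \<in> topspace C. h c \<in> U}"
    have "openin C ?T"
      using g h U(1) by (intro openin_Int openin_continuous_map_preimage)
    moreover have "?T \<subseteq> ?A"
    proof
      fix d assume d: "d \<in> ?T"
      then have "g d = q (p (g d))" "h d = q (p (h d))" using U by auto
      with d eq show "d \<in> ?A" by simp
    qed
    moreover have "c \<in> ?T" using c U by auto
    ultimately show "\<exists>T. openin C T \<and> c \<in> T \<and> T \<subseteq> ?A" by blast
  qed
  ultimately have "?A = {} \<or> ?A = topspace C"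
    using C connected_space_clopen_in by blast
  with b c show ?thesis by blast
qed

text \<open>
  Near a point \<open>z0\<close> of the parameter space a lift is built along the time axis. The predicate \<open>P a b\<close>
  says that a lift prescribed at time \<open>a\<close> near \<open>z0\<close> extends over \<open>{a..b}\<close>, possibly after shrinking the
  neighbourhood of \<open>z0\<close>. It is transitive by gluing, and it holds on every short interval because
  there the homotopy stays over one evenly covered set. The bisection principle for real intervals
  then gives \<open>P 0 1\<close> without an explicit subdivision of the unit interval.
\<close>

lemma covering_lift_homotopy_local:
  fixes Z :: "'z topology" and h :: "'z \<times> real \<Rightarrow> 'b"
  assumes cov: "covering_map E B p"
    and h: "continuous_map (prod_topology Z I01) B h"
    and g: "continuous_map Z E g" "\<And>z. z \<in> topspace Z \<Longrightarrow> p (g z) = h (z, 0)"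
    and z0: "z0 \<in> topspace Z"
  obtains N F where "openin Z N" "z0 \<in> N" "continuous_map (prod_topology (subtopology Z N) I01) E F"
    "\<And>z t. \<lbrakk>z \<in> N; t \<in> {0..1}\<rbrakk> \<Longrightarrow> p (F (z, t)) = h (z, t)"
    "\<And>z. z \<in> N \<Longrightarrow> F (z, 0) = g z"
proof -
  define P where "P a b \<longleftrightarrow> (0 \<le> a \<longrightarrow> b \<le> 1 \<longrightarrow> (\<forall>N g. openin Z N \<longrightarrow> z0 \<in> N \<longrightarrow>
      continuous_map (subtopology Z N) E g \<longrightarrow> (\<forall>z\<in>N. p (g z) = h (z, a)) \<longrightarrow>
      (\<exists>N' F. openin Z N' \<and> z0 \<in> N' \<and> N' \<subseteq> N \<and>
         continuous_map (prod_topology (subtopology Z N') (top_of_set {a..b})) E F \<and>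
         (\<forall>z\<in>N'. \<forall>t\<in>{a..b}. p (F (z, t)) = h (z, t)) \<and> (\<forall>z\<in>N'. F (z, a) = g z))))"
    for a b :: real
  have PD: "\<exists>N' F. openin Z N' \<and> z0 \<in> N' \<and> N' \<subseteq> N \<and>
         continuous_map (prod_topology (subtopology Z N') (top_of_set {a..b})) E F \<and>
         (\<forall>z\<in>N'. \<forall>t\<in>{a..b}. p (F (z, t)) = h (z, t)) \<and> (\<forall>z\<in>N'. F (z, a) = g z)"
    if "P a b" "0 \<le> a" "b \<le> 1" "openin Z N" "z0 \<in> N" "continuous_map (subtopology Z N) E g"
      "\<forall>z\<in>N. p (g z) = h (z, a)" for a b N g
    using that unfolding P_def by simp
  have "P 0 1"
  proof (rule Bolzano)
    fix a b c assume Pab: "P a b" and Pbc: "P b c" and le: "a \<le> b" "b \<le> c"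
    show "P a c"
      unfolding P_def
    proof (intro impI allI)
      fix N g assume a: "0 \<le> a" "c \<le> 1" and N: "openin Z N" "z0 \<in> N"
        "continuous_map (subtopology Z N) E g" "\<forall>z\<in>N. p (g z) = h (z, a)"
      obtain N1 F1 where 1: "openin Z N1" "z0 \<in> N1" "N1 \<subseteq> N"
         "continuous_map (prod_topology (subtopology Z N1) (top_of_set {a..b})) E F1"
         "\<forall>z\<in>N1. \<forall>t\<in>{a..b}. p (F1 (z, t)) = h (z, t)" "\<forall>z\<in>N1. F1 (z, a) = g z"
        using PD[OF Pab a(1) _ N] a le by auto
      have "continuous_map (subtopology Z N1) E (F1 \<circ> (\<lambda>z. (z, b)))"
        by (rule continuous_map_compose[OF _ 1(4)])
          (use le in \<open>auto intro!: continuous_map_pairedI\<close>)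
      moreover have "\<forall>z\<in>N1. p ((F1 \<circ> (\<lambda>z. (z, b))) z) = h (z, b)"
        using 1 le by simp
      ultimately obtain N2 F2 where 2: "openin Z N2" "z0 \<in> N2" "N2 \<subseteq> N1"
         "continuous_map (prod_topology (subtopology Z N2) (top_of_set {b..c})) E F2"
         "\<forall>z\<in>N2. \<forall>t\<in>{b..c}. p (F2 (z, t)) = h (z, t)" "\<forall>z\<in>N2. F2 (z, b) = F1 (z, b)"
        using PD[OF Pbc _ a(2) 1(1,2), of "F1 \<circ> (\<lambda>z. (z, b))"] a le by auto
      define F where "F w = (if snd w \<le> b then F1 w else F2 w)" for w
      let ?T = "prod_topology (subtopology Z N2) (top_of_set {a..c})"
      have "continuous_map ?T E F"
        unfolding F_def
      proof (rule continuous_map_cases_le)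
        show "continuous_map ?T euclideanreal snd" "continuous_map ?T euclideanreal (\<lambda>w. b)"
          using continuous_map_snd[of "subtopology Z N2" "top_of_set {a..c}"]
          by (auto simp: continuous_map_in_subtopology)
        have "prod_topology (subtopology Z (N1 \<inter> N2)) (top_of_set ({a..b} \<inter> {a..c})) =
            subtopology (prod_topology (subtopology Z N1) (top_of_set {a..b})) (N2 \<times> {a..c})"
          by (simp add: subtopology_Times subtopology_subtopology)
        moreover have "subtopology ?T {w \<in> topspace ?T. snd w \<le> b} =
            prod_topology (subtopology Z (N1 \<inter> N2)) (top_of_set ({a..b} \<inter> {a..c}))"
        proof -
          have "{w \<in> topspace ?T. snd w \<le> b} = (topspace Z \<inter> N2) \<times> ({a..b} \<inter> {a..c})"
            using le by auto
          then show ?thesis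
            using 2(3) openin_subset[OF 2(1)]
            by (simp add: subtopology_Times subtopology_subtopology inf.absorb2 Int_commute inf.absorb1 inf_left_commute)
        qed
        ultimately show "continuous_map (subtopology ?T {w \<in> topspace ?T. snd w \<le> b}) E F1"
          using 1(4) by (simp add: continuous_map_from_subtopology)
        have "{w \<in> topspace ?T. b \<le> snd w} = (topspace Z \<inter> N2) \<times> ({b..c} \<inter> {a..c})"
          using le by auto
        then have "subtopology ?T {w \<in> topspace ?T. b \<le> snd w} =
            subtopology (prod_topology (subtopology Z N2) (top_of_set {b..c})) (N2 \<times> {a..c})"
          using openin_subset[OF 2(1)]
          by (simp add: subtopology_Times subtopology_subtopology inf.absorb1 inf.absorb2 Int_commute)
        then show "continuous_map (subtopology ?T {w \<in> topspace ?T. b \<le> snd w}) E F2"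
          using 2(4) by (simp add: continuous_map_from_subtopology)
      next
        fix w assume "w \<in> topspace ?T" "snd w = b"
        then show "F1 w = F2 w" using 2(6) by (cases w) auto
      qed
      moreover have "\<forall>z\<in>N2. \<forall>t\<in>{a..c}. p (F (z, t)) = h (z, t)"
        using 1 2 le by (auto simp: F_def)
      moreover have "\<forall>z\<in>N2. F (z, a) = g z"
        using 1 2 le by (auto simp: F_def)
      ultimately show "\<exists>N' F. openin Z N' \<and> z0 \<in> N' \<and> N' \<subseteq> N \<and>
         continuous_map (prod_topology (subtopology Z N') (top_of_set {a..c})) E F \<and>
         (\<forall>z\<in>N'. \<forall>t\<in>{a..c}. p (F (z, t)) = h (z, t)) \<and> (\<forall>z\<in>N'. F (z, a) = g z)"
        using 1(3) 2(1-3) by (intro exI[of _ N2] exI[of _ F] conjI) auto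
    qed
  next
    fix x :: real assume x: "0 \<le> x" "x \<le> 1"
    then have zx: "(z0, x) \<in> topspace (prod_topology Z I01)" using z0 by simp
    then have yB: "h (z0, x) \<in> topspace B" using h by (auto simp: continuous_map_def Pi_iff)
    obtain V where V: "openin B V" "h (z0, x) \<in> V"
      and sh: "\<forall>e\<in>topspace E. p e \<in> V \<longrightarrow> (\<exists>U q. openin E U \<and> e \<in> U \<and> continuous_map (subtopology B V) E q \<and>
       (\<forall>u\<in>U. p u \<in> V \<and> q (p u) = u) \<and> (\<forall>v\<in>V. q v \<in> U \<and> p (q v) = v))"
      using covering_map_sheets[OF cov yB] by (elim exE conjE) (rule that)
    have "openin (prod_topology Z I01) {w \<in> topspace (prod_topology Z I01). h w \<in> V}"
      by (rule openin_continuous_map_preimage[OF h V(1)])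
    moreover have "(z0, x) \<in> {w \<in> topspace (prod_topology Z I01). h w \<in> V}"
      using zx V by blast
    ultimately obtain N1 J where N1: "openin Z N1" "z0 \<in> N1" and J: "openin I01 J" "x \<in> J"
      and NJ: "N1 \<times> J \<subseteq> {w \<in> topspace (prod_topology Z I01). h w \<in> V}"
      unfolding openin_prod_topology_alt by meson
    obtain d where d: "d > 0" "ball x d \<inter> {0..1} \<subseteq> J"
      using J unfolding openin_contains_ball by blast
    have "P a b" if ab: "a \<le> x" "x \<le> b" "b - a < d" for a b
      unfolding P_def
    proof (intro impI allI)
      fix N g assume a: "0 \<le> a" "b \<le> 1" and N: "openin Z N" "z0 \<in> N"
        "continuous_map (subtopology Z N) E g" "\<forall>z\<in>N. p (g z) = h (z, a)"
      have abJ: "{a..b} \<subseteq> J"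
        using ab a d(2) by (force simp: dist_real_def)
      then have hV: "h (z, t) \<in> V" if "z \<in> N1" "t \<in> {a..b}" for z t
        using that NJ by blast
      have "g z0 \<in> topspace E"
        using N z0 by (auto simp: continuous_map_def Pi_iff)
      moreover have "p (g z0) \<in> V"
        using N hV N1 ab by auto
      ultimately obtain U q where U: "openin E U" "g z0 \<in> U" "continuous_map (subtopology B V) E q"
        "\<forall>u\<in>U. p u \<in> V \<and> q (p u) = u" "\<forall>v\<in>V. q v \<in> U \<and> p (q v) = v"
        using bspec[OF sh] by blast
      define N' where "N' = N1 \<inter> {z \<in> topspace (subtopology Z N). g z \<in> U}"
      have "openin (subtopology Z N) {z \<in> topspace (subtopology Z N). g z \<in> U}"
        by (rule openin_continuous_map_preimage[OF N(3) U(1)])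
      then have oN': "openin Z N'"
        using N(1) N1 openin_trans_full by (metis N'_def openin_Int)
      have zN': "z0 \<in> N'" using N1 N U z0 by (simp add: N'_def)
      have "continuous_map (prod_topology (subtopology Z N') (top_of_set {a..b})) B h"
      proof -
        have "prod_topology (subtopology Z N') (top_of_set {a..b}) =
            subtopology (prod_topology Z I01) (N' \<times> {a..b})"
          using a by (simp add: subtopology_Times subtopology_subtopology inf.absorb2)
        with h show ?thesis by (simp add: continuous_map_from_subtopology)
      qed
      then have "continuous_map (prod_topology (subtopology Z N') (top_of_set {a..b})) (subtopology B V) h"
        using hV by (auto simp: continuous_map_in_subtopology N'_def)
      then have "continuous_map (prod_topology (subtopology Z N') (top_of_set {a..b})) E (q \<circ> h)"
        using U(3) continuous_map_compose by blast
      moreover have "\<forall>z\<in>N'. \<forall>t\<in>{a..b}. p ((q \<circ> h) (z, t)) = h (z, t)"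
        using hV U by (auto simp: N'_def)
      moreover have "\<forall>z\<in>N'. (q \<circ> h) (z, a) = g z"
        using N U by (auto simp: N'_def) 
      ultimately show "\<exists>N' F. openin Z N' \<and> z0 \<in> N' \<and> N' \<subseteq> N \<and>
         continuous_map (prod_topology (subtopology Z N') (top_of_set {a..b})) E F \<and>
         (\<forall>z\<in>N'. \<forall>t\<in>{a..b}. p (F (z, t)) = h (z, t)) \<and> (\<forall>z\<in>N'. F (z, a) = g z)"
        using oN' zN' N'_def by (intro exI[of _ N'] exI[of _ "q \<circ> h"]) auto
    qed
    with d(1) show "\<exists>d>0. \<forall>a b. a \<le> x \<and> x \<le> b \<and> b - a < d \<longrightarrow> P a b" by blast
  qed simp
  moreover have "continuous_map (subtopology Z (topspace Z)) E g" using g by simp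
  ultimately show thesis
    using PD[of 0 1 "topspace Z" g] that z0 g(2) by auto
qed

text \<open>
  The local lifts agree where they overlap, since on each line \<open>{w} \<times> {0..1}\<close> they lift the same path from
  the same point. They therefore glue to one continuous lift.
\<close>

lemma covering_lift_homotopy:
  fixes Z :: "'z topology" and h :: "'z \<times> real \<Rightarrow> 'b"
  assumes cov: "covering_map E B p" and E: "Hausdorff_space E"
    and h: "continuous_map (prod_topology Z I01) B h"
    and g: "continuous_map Z E g" "\<And>z. z \<in> topspace Z \<Longrightarrow> p (g z) = h (z, 0)"
  obtains F where "continuous_map (prod_topology Z I01) E F"
    "\<And>z t. \<lbrakk>z \<in> topspace Z; t \<in> {0..1}\<rbrakk> \<Longrightarrow> p (F (z, t)) = h (z, t)"
    "\<And>z. z \<in> topspace Z \<Longrightarrow> F (z, 0) = g z"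
proof -
  have "\<forall>z\<in>topspace Z. \<exists>N F. openin Z N \<and> z \<in> N \<and> continuous_map (prod_topology (subtopology Z N) I01) E F \<and>
    (\<forall>w\<in>N. \<forall>t\<in>{0..1}. p (F (w, t)) = h (w, t)) \<and> (\<forall>w\<in>N. F (w, 0) = g w)"
    by (rule ballI, rule covering_lift_homotopy_local[OF cov h g], assumption+) blast
  then obtain N F where NF: "\<And>z. z \<in> topspace Z \<Longrightarrow> openin Z (N z) \<and> z \<in> N z \<and>
    continuous_map (prod_topology (subtopology Z (N z)) I01) E (F z) \<and>
    (\<forall>w\<in>N z. \<forall>t\<in>{0..1}. p (F z (w, t)) = h (w, t)) \<and> (\<forall>w\<in>N z. F z (w, 0) = g w)"
    by metis
  have path: "continuous_map I01 E (\<lambda>t. F z (w, t))" if "z \<in> topspace Z" "w \<in> N z" for z w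
  proof -
    have "continuous_map I01 E (F z \<circ> (\<lambda>t. (w, t)))"
      by (rule continuous_map_compose[of _ "prod_topology (subtopology Z (N z)) I01"])
        (use that NF[of z] openin_subset[of Z "N z"] in \<open>auto intro!: continuous_map_pairedI\<close>)
    then show ?thesis by (simp add: o_def)
  qed
  have agree: "F y (w, t) = F z (w, t)"
    if "y \<in> topspace Z" "z \<in> topspace Z" "w \<in> N y" "w \<in> N z" "t \<in> {0..1}" for y z w t
  proof (rule covering_lift_unique[OF cov E, where C=I01 and b=0 and c=t
        and g="\<lambda>t. F y (w, t)" and h="\<lambda>t. F z (w, t)"])
    show "connected_space I01"
      by (metis connectedin_iff_connected connectedin_def connected_Icc)
    show "continuous_map I01 E (\<lambda>t. F y (w, t))" "continuous_map I01 E (\<lambda>t. F z (w, t))"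
      using path that by auto
    show "p (F y (w, c)) = p (F z (w, c))" if "c \<in> topspace I01" for c
      using that \<open>y \<in> topspace Z\<close> \<open>z \<in> topspace Z\<close> \<open>w \<in> N y\<close> \<open>w \<in> N z\<close> NF by (metis topspace_euclidean_subtopology)
    show "F y (w, 0) = F z (w, 0)"
      using that NF by metis
  qed (use that in auto)
  \<comment> \<open>At \<open>(z, t)\<close> the lift that belongs to \<open>z\<close> itself is a legitimate choice.\<close>
  let ?G = "\<lambda>w. F (fst w) w"
  have "continuous_map (prod_topology Z I01) E ?G"
  proof (rule pasting_lemma[where I="topspace Z" and T="\<lambda>z. N z \<times> {0..1}" and f=F])
    fix z assume z: "z \<in> topspace Z"
    show "openin (prod_topology Z I01) (N z \<times> {0..1})"
      using NF[OF z] unfolding openin_prod_Times_iff by simp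
    have "prod_topology (subtopology Z (N z)) I01 = subtopology (prod_topology Z I01) (N z \<times> {0..1})"
      by (simp add: subtopology_Times subtopology_subtopology)
    moreover have "continuous_map (prod_topology (subtopology Z (N z)) I01) E (F z)"
      using NF[OF z] by blast
    ultimately show "continuous_map (subtopology (prod_topology Z I01) (N z \<times> {0..1})) E (F z)"
      by (simp only:)
  next
    fix y z w assume "y \<in> topspace Z" "z \<in> topspace Z"
      "w \<in> topspace (prod_topology Z I01) \<inter> N y \<times> {0..1} \<inter> N z \<times> {0..1}"
    then show "F y w = F z w" using agree[of y z "fst w" "snd w"] by (simp add: mem_Times_iff)
  next
    fix w assume "w \<in> topspace (prod_topology Z I01)"
    then show "\<exists>z. z \<in> topspace Z \<and> w \<in> N z \<times> {0..1} \<and> F (fst w) w = F z w"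
      using NF[of "fst w"] by (intro exI[of _ "fst w"]) (simp add: mem_Times_iff)
  qed
  moreover have "p (?G (z, t)) = h (z, t)" if "z \<in> topspace Z" "t \<in> {0..1}" for z t
    using NF[OF that(1)] that(2) by simp
  moreover have "?G (z, 0) = g z" if "z \<in> topspace Z" for z
    using NF[OF that(1)] by simp
  ultimately show thesis by (rule that)
qed

text \<open>
  A path is a homotopy parametrised by a one-point space.
\<close>

lemma covering_lift_path:
  assumes cov: "covering_map E B p" and E: "Hausdorff_space E"
    and \<gamma>: "pathin B \<gamma>" and e: "e \<in> topspace E" "p e = \<gamma> 0"
  obtains \<delta> where "pathin E \<delta>" "\<delta> 0 = e" "\<And>t. t \<in> {0..1} \<Longrightarrow> p (\<delta> t) = \<gamma> t"
proof -
  let ?Z = "discrete_topology {()}"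
  have "continuous_map (prod_topology ?Z I01) B (\<gamma> \<circ> snd)"
    using \<gamma> continuous_map_compose[OF continuous_map_snd] by (auto simp: pathin_def)
  moreover have "continuous_map ?Z E (\<lambda>_. e)" using e by simp
  ultimately obtain F where F: "continuous_map (prod_topology ?Z I01) E F"
    "\<And>t. t \<in> {0..1} \<Longrightarrow> p (F ((), t)) = (\<gamma> \<circ> snd) ((), t)" "F ((), 0) = e"
    using covering_lift_homotopy[OF cov E, of ?Z "\<gamma> \<circ> snd" "\<lambda>_. e"] e by (auto simp: o_def)
  have "continuous_map I01 E (F \<circ> (\<lambda>t. ((), t)))"
    by (rule continuous_map_compose[OF _ F(1)]) (auto intro!: continuous_map_pairedI)
  then show thesis
    using F by (intro that[of "\<lambda>t. F ((), t)"]) (auto simp: pathin_def o_def)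
qed

section \<open>Homotopy of paths with fixed end points\<close>

text \<open>
  The end points are those of the first path. A change of base point of the fundamental group
  needs paths that are not closed, whereas \<open>loop_homotopy\<close> relates loops only.
\<close>

definition path_homotopic :: "'a topology \<Rightarrow> (real \<Rightarrow> 'a) \<Rightarrow> (real \<Rightarrow> 'a) \<Rightarrow> bool" where
  "path_homotopic X p q \<longleftrightarrow> homotopic_with (\<lambda>h. h 0 = p 0 \<and> h 1 = p 1) I01 X p q"

definition path_rev :: "(real \<Rightarrow> 'a) \<Rightarrow> real \<Rightarrow> 'a" where
  "path_rev p = (\<lambda>t. p (1 - t))"

lemma path_rev_simps [simp]:
  "path_rev p 0 = p 1" "path_rev p 1 = p 0" "path_rev (path_rev p) = p"
  by (simp_all add: path_rev_def)

lemma path_concat_simps [simp]: "path_concat p q 0 = p 0" "path_concat p q 1 = q 1"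
  by (simp_all add: path_concat_def)

lemma loop_homotopy_iff:
  "(p, q) \<in> loop_homotopy X x \<longleftrightarrow> path_homotopic X p q \<and> p 0 = x \<and> p 1 = x"
proof
  assume "(p, q) \<in> loop_homotopy X x"
  then have *: "homotopic_with (\<lambda>h. h 0 = x \<and> h 1 = x) I01 X p q"
    by (simp add: loop_homotopy_def)
  then have "p 0 = x" "p 1 = x"
    using homotopic_with_imp_property[OF *] by simp_all
  with * show "path_homotopic X p q \<and> p 0 = x \<and> p 1 = x"
    by (simp add: path_homotopic_def)
next
  assume "path_homotopic X p q \<and> p 0 = x \<and> p 1 = x"
  then show "(p, q) \<in> loop_homotopy X x"
    by (auto simp: path_homotopic_def loop_homotopy_def)
qed

lemma path_homotopic_imp:
  assumes "path_homotopic X p q"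
  shows "pathin X p" "pathin X q" "q 0 = p 0" "q 1 = p 1"
  using homotopic_with_imp_continuous_maps[OF assms[unfolded path_homotopic_def]]
    homotopic_with_imp_property[OF assms[unfolded path_homotopic_def]]
  by (simp_all add: pathin_def)

lemma path_homotopic_sym: "path_homotopic X p q \<Longrightarrow> path_homotopic X q p"
  using path_homotopic_imp(3,4)[of X p q] homotopic_with_symD[of _ I01 X p q]
  unfolding path_homotopic_def by simp

lemma path_homotopic_trans [trans]:
  assumes "path_homotopic X p q" "path_homotopic X q r"
  shows "path_homotopic X p r"
  using assms(2) homotopic_with_trans[OF assms(1)[unfolded path_homotopic_def], of r]
    path_homotopic_imp(3,4)[OF assms(1)]
  unfolding path_homotopic_def by simp

lemma path_homotopic_eq:
  assumes "pathin X p" "\<And>t. t \<in> {0..1} \<Longrightarrow> q t = p t"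
  shows "path_homotopic X p q"
  unfolding path_homotopic_def
  by (rule homotopic_with_equal) (use assms in \<open>auto simp: pathin_def\<close>)

lemma path_homotopic_refl: "pathin X p \<Longrightarrow> path_homotopic X p p"
  by (rule path_homotopic_eq) auto

lemma path_homotopic_image:
  assumes "path_homotopic X p q" "continuous_map X Y f"
  shows "path_homotopic Y (f \<circ> p) (f \<circ> q)"
  unfolding path_homotopic_def
  by (rule homotopic_with_compose_continuous_map_left[OF assms(1)[unfolded path_homotopic_def] assms(2)]) auto

text \<open>
  The two reparametrisations are joined by straight segments inside the interval. Associativity, the
  unit laws and the law of inverses reduce to this: both sides are reparametrisations of one path.
\<close>

lemma path_homotopic_reparam:
  fixes \<phi> \<psi> :: "real \<Rightarrow> real"
  assumes p: "pathin X p"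
    and \<phi>: "continuous_on {0..1} \<phi>" "\<And>t. t \<in> {0..1} \<Longrightarrow> \<phi> t \<in> {0..1}"
    and \<psi>: "continuous_on {0..1} \<psi>" "\<And>t. t \<in> {0..1} \<Longrightarrow> \<psi> t \<in> {0..1}"
    and ends: "\<phi> 0 = \<psi> 0" "\<phi> 1 = \<psi> 1"
  shows "path_homotopic X (\<lambda>t. p (\<phi> t)) (\<lambda>t. p (\<psi> t))"
proof -
  have "homotopic_paths {0..1} \<phi> \<psi>"
  proof (rule homotopic_paths_linear)
    fix t :: real assume "t \<in> {0..1}"
    then show "closed_segment (\<phi> t) (\<psi> t) \<subseteq> {0..1}"
      using \<phi>(2) \<psi>(2) by (intro closed_segment_subset) auto
  qed (use assms in \<open>auto simp: path_def pathstart_def pathfinish_def\<close>)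
  then have "homotopic_with (\<lambda>h. h 0 = \<phi> 0 \<and> h 1 = \<phi> 1) I01 (top_of_set {0..1}) \<phi> \<psi>"
    by (simp add: homotopic_paths_def pathstart_def pathfinish_def)
  then have "path_homotopic (top_of_set {0..1}) \<phi> \<psi>"
    by (simp add: path_homotopic_def)
  then have "path_homotopic X (p \<circ> \<phi>) (p \<circ> \<psi>)"
    by (rule path_homotopic_image) (use p in \<open>simp add: pathin_def\<close>)
  then show ?thesis by (simp add: o_def)
qed

lemma path_homotopic_concat:
  assumes pp: "path_homotopic X p p'" and qq: "path_homotopic X q q'" and ends: "p 1 = q 0"
  shows "path_homotopic X (path_concat p q) (path_concat p' q')"
proof -
  let ?II = "prod_topology I01 I01"
  obtain h where h: "continuous_map ?II X h" "\<And>t. h (0, t) = p t" "\<And>t. h (1, t) = p' t"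
      "\<And>s. s \<in> {0..1} \<Longrightarrow> h (s, 0) = p 0 \<and> h (s, 1) = p 1"
    using pp by (auto simp: path_homotopic_def homotopic_with_def)
  obtain k where k: "continuous_map ?II X k" "\<And>t. k (0, t) = q t" "\<And>t. k (1, t) = q' t"
      "\<And>s. s \<in> {0..1} \<Longrightarrow> k (s, 0) = q 0 \<and> k (s, 1) = q 1"
    using qq by (auto simp: path_homotopic_def homotopic_with_def)
  define H where "H = (\<lambda>z. if snd z \<le> 1/2 then h (fst z, 2 * snd z) else k (fst z, 2 * snd z - 1))"
  have lin: "continuous_map (subtopology ?II S) ?II (\<lambda>z. (fst z, a * snd z + b))"
    if "\<And>s t. (s, t) \<in> S \<Longrightarrow> t \<in> {0..1} \<Longrightarrow> a * t + b \<in> {0..1}" for S and a b :: real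
    using that
    by (auto simp: subtopology_subtopology continuous_map_in_subtopology intro!: continuous_intros)
  have "continuous_map ?II X H"
    unfolding H_def
  proof (rule continuous_map_cases_le)
    show "continuous_map ?II euclideanreal snd" "continuous_map ?II euclideanreal (\<lambda>z. 1/2)"
      by (auto intro!: continuous_intros)
    have "continuous_map (subtopology ?II {z \<in> topspace ?II. snd z \<le> 1/2}) X (h \<circ> (\<lambda>z. (fst z, 2 * snd z + 0)))"
      by (rule continuous_map_compose[OF lin h(1)]) auto
    then show "continuous_map (subtopology ?II {z \<in> topspace ?II. snd z \<le> 1/2}) X (\<lambda>z. h (fst z, 2 * snd z))"
      by (simp add: o_def)
    have "continuous_map (subtopology ?II {z \<in> topspace ?II. 1/2 \<le> snd z}) X (k \<circ> (\<lambda>z. (fst z, 2 * snd z + (-1))))"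
      by (rule continuous_map_compose[OF lin k(1)]) auto
    then show "continuous_map (subtopology ?II {z \<in> topspace ?II. 1/2 \<le> snd z}) X (\<lambda>z. k (fst z, 2 * snd z - 1))"
      by (simp add: o_def)
  next
    fix z assume "z \<in> topspace ?II" "snd z = 1/2"
    then obtain s where "z = (s, 1/2)" "s \<in> {0..1}" by (cases z) auto
    then show "h (fst z, 2 * snd z) = k (fst z, 2 * snd z - 1)"
      using h(4)[of s] k(4)[of s] ends by simp
  qed
  moreover have "H (0, t) = path_concat p q t" "H (1, t) = path_concat p' q' t" for t
    by (simp_all add: H_def path_concat_def h k)
  moreover have "H (s, 0) = p 0 \<and> H (s, 1) = q 1" if "s \<in> {0..1}" for s
    using h(4)[OF that] k(4)[OF that] by (simp add: H_def)
  ultimately show ?thesis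
    unfolding path_homotopic_def homotopic_with_def by (intro exI[of _ H]) simp
qed

lemma pathin_concat:
  "\<lbrakk>pathin X p; pathin X q; p 1 = q 0\<rbrakk> \<Longrightarrow> pathin X (path_concat p q)"
  using path_homotopic_concat path_homotopic_imp(1) path_homotopic_refl by metis

lemma pathin_rev:
  assumes "pathin X p"
  shows "pathin X (path_rev p)"
proof -
  have "path_homotopic X (\<lambda>t. p (1 - t)) (\<lambda>t. p (1 - t))"
    by (intro path_homotopic_reparam assms) (auto intro!: continuous_intros)
  then show ?thesis unfolding path_rev_def by (rule path_homotopic_imp)
qed

lemma path_homotopic_assoc:
  assumes "pathin X p" "pathin X q" "pathin X r" "p 1 = q 0" "q 1 = r 0"
  shows "path_homotopic X (path_concat (path_concat p q) r) (path_concat p (path_concat q r))"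
proof -
  \<comment> \<open>The piecewise linear map taking \<open>0, 1/4, 1/2, 1\<close> to \<open>0, 1/2, 3/4, 1\<close>; it is concave, hence a minimum of its three pieces.\<close>
  define \<phi> :: "real \<Rightarrow> real" where "\<phi> t = min (2 * t) (min (t + 1/4) (t / 2 + 1/2))" for t
  let ?c = "path_concat p (path_concat q r)"
  have "path_concat (path_concat p q) r = (\<lambda>t. ?c (\<phi> t))"
  proof
    fix t :: real
    consider "t \<le> 1/4" | "1/4 < t" "t \<le> 1/2" | "1/2 < t" by linarith
    then show "path_concat (path_concat p q) r t = ?c (\<phi> t)"
    proof cases
      case 1
      then have "\<phi> t = 2 * t" by (simp add: \<phi>_def)
      with 1 show ?thesis by (simp add: path_concat_def)
    next
      case 2
      then have "\<phi> t = t + 1/4" by (simp add: \<phi>_def)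
      with 2 show ?thesis by (simp add: path_concat_def algebra_simps)
    next
      case 3
      then have "\<phi> t = t / 2 + 1/2" by (simp add: \<phi>_def)
      with 3 show ?thesis by (simp add: path_concat_def algebra_simps)
    qed
  qed
  moreover have "path_homotopic X (\<lambda>t. ?c (\<phi> t)) (\<lambda>t. ?c t)"
    using assms by (intro path_homotopic_reparam pathin_concat)
      (auto simp: \<phi>_def intro!: continuous_intros)
  ultimately show ?thesis by simp
qed

lemma path_homotopic_const_right:
  assumes "pathin X p"
  shows "path_homotopic X (path_concat p (\<lambda>t. p 1)) p"
proof -
  have "path_concat p (\<lambda>t. p 1) = (\<lambda>t. p (min 1 (2 * t)))"
  proof
    fix t :: real
    have "min 1 (2 * t) = (if t \<le> 1/2 then 2 * t else 1)" by auto
    then show "path_concat p (\<lambda>t. p 1) t = p (min 1 (2 * t))"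
      by (simp add: path_concat_def)
  qed
  moreover have "path_homotopic X (\<lambda>t. p (min 1 (2 * t))) (\<lambda>t. p t)"
    by (intro path_homotopic_reparam assms) (auto intro!: continuous_intros)
  ultimately show ?thesis by simp
qed

lemma path_homotopic_const_left:
  assumes "pathin X p"
  shows "path_homotopic X (path_concat (\<lambda>t. p 0) p) p"
proof -
  have "path_concat (\<lambda>t. p 0) p = (\<lambda>t. p (max 0 (2 * t - 1)))"
  proof
    fix t :: real
    have "max 0 (2 * t - 1) = (if t \<le> 1/2 then 0 else 2 * t - 1)" by auto
    then show "path_concat (\<lambda>t. p 0) p t = p (max 0 (2 * t - 1))"
      by (simp add: path_concat_def)
  qed
  moreover have "path_homotopic X (\<lambda>t. p (max 0 (2 * t - 1))) (\<lambda>t. p t)"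
    by (intro path_homotopic_reparam assms) (auto intro!: continuous_intros)
  ultimately show ?thesis by simp
qed

lemma path_homotopic_rev_left:
  assumes "pathin X p"
  shows "path_homotopic X (path_concat (path_rev p) p) (\<lambda>t. p 1)"
proof -
  have "path_concat (path_rev p) p = (\<lambda>t. p \<bar>1 - 2 * t\<bar>)"
    by (auto simp: path_concat_def path_rev_def fun_eq_iff abs_if)
  moreover have "path_homotopic X (\<lambda>t. p \<bar>1 - 2 * t\<bar>) (\<lambda>t. p 1)"
    by (intro path_homotopic_reparam assms) (auto intro!: continuous_intros)
  ultimately show ?thesis by simp
qed

lemma path_homotopic_rev_right:
  assumes "pathin X p"
  shows "path_homotopic X (path_concat p (path_rev p)) (\<lambda>t. p 0)"
  using path_homotopic_rev_left[OF pathin_rev[OF assms]] by simp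

lemma path_homotopic_concat_left:
  "\<lbrakk>pathin X p; path_homotopic X q q'; p 1 = q 0\<rbrakk>
    \<Longrightarrow> path_homotopic X (path_concat p q) (path_concat p q')"
  by (intro path_homotopic_concat path_homotopic_refl)

lemma path_homotopic_concat_right:
  "\<lbrakk>path_homotopic X p p'; pathin X q; p 1 = q 0\<rbrakk>
    \<Longrightarrow> path_homotopic X (path_concat p q) (path_concat p' q)"
  by (intro path_homotopic_concat path_homotopic_refl)

lemma path_homotopic_cancel_left:
  assumes "pathin X d" "pathin X p" "d 0 = p 0"
  shows "path_homotopic X (path_concat d (path_concat (path_rev d) p)) p"
proof -
  have "path_homotopic X (path_concat d (path_concat (path_rev d) p)) (path_concat (path_concat d (path_rev d)) p)"
    using assms by (intro path_homotopic_sym[OF path_homotopic_assoc] pathin_rev) auto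
  also have "path_homotopic X \<dots> (path_concat (\<lambda>t. d 0) p)"
    using assms by (intro path_homotopic_concat_right path_homotopic_rev_right) auto
  also have "path_homotopic X \<dots> p"
    using path_homotopic_const_left[OF assms(2)] assms(3) by simp
  finally show ?thesis .
qed

lemma path_homotopic_cancel_right:
  assumes "pathin X d" "pathin X p" "p 1 = d 0"
  shows "path_homotopic X (path_concat (path_concat p d) (path_rev d)) p"
proof -
  have "path_homotopic X (path_concat (path_concat p d) (path_rev d)) (path_concat p (path_concat d (path_rev d)))"
    using assms by (intro path_homotopic_assoc pathin_rev) auto
  also have "path_homotopic X \<dots> (path_concat p (\<lambda>t. p 1))"
    using assms path_homotopic_rev_right[OF assms(1)] by (intro path_homotopic_concat_left) auto
  also have "path_homotopic X \<dots> p"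
    by (rule path_homotopic_const_right[OF assms(2)])
  finally show ?thesis .
qed

section \<open>The fundamental group and its change of base point\<close>

lemma loops_at_iff: "p \<in> loops_at X x \<longleftrightarrow> pathin X p \<and> p 0 = x \<and> p 1 = x"
  by (simp add: loops_at_def)

abbreviation loop_class :: "'a topology \<Rightarrow> 'a \<Rightarrow> (real \<Rightarrow> 'a) \<Rightarrow> (real \<Rightarrow> 'a) set" where
  "loop_class X x p \<equiv> loop_homotopy X x `` {p}"

lemma loop_class_eq_iff:
  assumes "p \<in> loops_at X x" "q \<in> loops_at X x"
  shows "loop_class X x p = loop_class X x q \<longleftrightarrow> path_homotopic X p q"
  using eq_equiv_class_iff[OF equiv_loop_homotopy assms] assms
  by (simp add: loop_homotopy_iff loops_at_iff)

lemma fundamental_group_carrierE: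
  assumes "P \<in> carrier (fundamental_group X x)"
  obtains p where "p \<in> loops_at X x" "P = loop_class X x p"
  using assms by (auto simp: fundamental_group_def elim: quotientE)

lemma loop_class_in_carrier [intro]:
  "p \<in> loops_at X x \<Longrightarrow> loop_class X x p \<in> carrier (fundamental_group X x)"
  by (auto simp: fundamental_group_def intro: quotientI)

lemma loop_class_mult:
  assumes "p \<in> loops_at X x" "q \<in> loops_at X x"
  shows "loop_class X x p \<otimes>\<^bsub>fundamental_group X x\<^esub> loop_class X x q = loop_class X x (path_concat p q)"
proof -
  have "(\<lambda>p q. loop_class X x (path_concat p q)) respects2 loop_homotopy X x"
    by (auto simp: congruent2_def intro!: equiv_class_eq[OF equiv_loop_homotopy] loop_homotopy_path_concat)
  from UN_equiv_class2[OF equiv_loop_homotopy equiv_loop_homotopy this assms]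
  show ?thesis by (simp add: fundamental_group_def)
qed

lemma loops_at_concat:
  "p \<in> loops_at X x \<Longrightarrow> q \<in> loops_at X x \<Longrightarrow> path_concat p q \<in> loops_at X x"
  by (simp add: loops_at_iff pathin_concat)

text \<open>
  This serves both the homomorphism induced by a continuous map and the conjugation by a path. The
  union over all representatives avoids the choice of one.
\<close>

definition induced_class_map ::
    "'b topology \<Rightarrow> 'b \<Rightarrow> ((real \<Rightarrow> 'a) \<Rightarrow> (real \<Rightarrow> 'b)) \<Rightarrow> (real \<Rightarrow> 'a) set \<Rightarrow> (real \<Rightarrow> 'b) set" where
  "induced_class_map Y y T P = (\<Union>p\<in>P. loop_class Y y (T p))"

lemma induced_class_map_apply:
  assumes T: "\<And>p q. \<lbrakk>p \<in> loops_at X x; path_homotopic X p q\<rbrakk> \<Longrightarrow> path_homotopic Y (T p) (T q)"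
    and T_loop: "\<And>p. p \<in> loops_at X x \<Longrightarrow> T p \<in> loops_at Y y"
    and p: "p \<in> loops_at X x"
  shows "induced_class_map Y y T (loop_class X x p) = loop_class Y y (T p)"
proof -
  have "(\<lambda>p. loop_class Y y (T p)) respects loop_homotopy X x"
  proof (rule congruentI)
    fix p q assume "(p, q) \<in> loop_homotopy X x"
    then have pq: "path_homotopic X p q" "p 0 = x" "p 1 = x" by (auto simp: loop_homotopy_iff)
    then have l: "p \<in> loops_at X x" "q \<in> loops_at X x"
      using path_homotopic_imp[OF pq(1)] by (auto simp: loops_at_iff)
    show "loop_class Y y (T p) = loop_class Y y (T q)"
      using loop_class_eq_iff[OF T_loop[OF l(1)] T_loop[OF l(2)]] T[OF l(1) pq(1)] by simp
  qed
  from UN_equiv_class[OF equiv_loop_homotopy this p] show ?thesis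
    by (simp add: induced_class_map_def)
qed

lemma induced_class_map_hom:
  assumes T: "\<And>p q. \<lbrakk>p \<in> loops_at X x; path_homotopic X p q\<rbrakk> \<Longrightarrow> path_homotopic Y (T p) (T q)"
    and T_loop: "\<And>p. p \<in> loops_at X x \<Longrightarrow> T p \<in> loops_at Y y"
    and T_concat: "\<And>p q. \<lbrakk>p \<in> loops_at X x; q \<in> loops_at X x\<rbrakk> \<Longrightarrow>
      path_homotopic Y (T (path_concat p q)) (path_concat (T p) (T q))"
  shows "induced_class_map Y y T \<in> hom (fundamental_group X x) (fundamental_group Y y)"
proof (rule homI)
  note app = induced_class_map_apply[of X x Y T y, OF T T_loop]
  fix P assume "P \<in> carrier (fundamental_group X x)"
  then obtain p where p: "p \<in> loops_at X x" "P = loop_class X x p"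
    by (rule fundamental_group_carrierE)
  then show "induced_class_map Y y T P \<in> carrier (fundamental_group Y y)"
    by (simp add: app T_loop loop_class_in_carrier)
  fix Q assume "Q \<in> carrier (fundamental_group X x)"
  then obtain q where q: "q \<in> loops_at X x" "Q = loop_class X x q"
    by (rule fundamental_group_carrierE)
  have "loop_class Y y (T (path_concat p q)) = loop_class Y y (path_concat (T p) (T q))"
    using p q by (simp add: loop_class_eq_iff T_concat T_loop loops_at_concat)
  then show "induced_class_map Y y T (P \<otimes>\<^bsub>fundamental_group X x\<^esub> Q) =
      induced_class_map Y y T P \<otimes>\<^bsub>fundamental_group Y y\<^esub> induced_class_map Y y T Q"
    using p q by (simp add: loop_class_mult app T_loop loops_at_concat)
qed

text \<open>
  A loop \<open>p\<close> at \<open>x\<close> is conjugated by the path \<open>d\<close> to a loop at \<open>y\<close>, and conjugation by the reversed path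
  is inverse to this up to homotopy.
\<close>

lemma fundamental_group_base_change:
  assumes d: "pathin X d" "d 0 = x" "d 1 = y"
  shows "fundamental_group X x \<cong> fundamental_group X y"
proof -
  define T where "T d p = path_concat (path_rev d) (path_concat p d)" for d p :: "real \<Rightarrow> 'a"
  have T_hom: "path_homotopic X (T d p) (T d q)"
    if "pathin X d" "p \<in> loops_at X (d 0)" "path_homotopic X p q" for d p q
    unfolding T_def using that path_homotopic_imp[OF that(3)]
    by (intro path_homotopic_concat_left path_homotopic_concat_right pathin_rev) (auto simp: loops_at_iff)
  have T_loop: "T d p \<in> loops_at X (d 1)" if "pathin X d" "p \<in> loops_at X (d 0)" for d p
    using that by (auto simp: T_def loops_at_iff pathin_concat pathin_rev)
  \<comment> \<open>The piece \<open>d\<close> followed by its reverse cancels in the middle of the product.\<close>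
  have T_concat: "path_homotopic X (T d (path_concat p q)) (path_concat (T d p) (T d q))"
    if d: "pathin X d" and p: "p \<in> loops_at X (d 0)" and q: "q \<in> loops_at X (d 0)" for d p q
  proof -
    note simps = loops_at_iff pathin_concat pathin_rev
    have "path_homotopic X (path_concat (T d p) (T d q))
        (path_concat (path_rev d) (path_concat (path_concat p d) (T d q)))"
      unfolding T_def using d p q by (intro path_homotopic_assoc) (auto simp: simps)
    also have "path_homotopic X \<dots>
        (path_concat (path_rev d) (path_concat p (path_concat d (T d q))))"
      unfolding T_def using d p q
      by (intro path_homotopic_concat_left path_homotopic_assoc) (auto simp: simps)
    also have "path_homotopic X \<dots> (path_concat (path_rev d) (path_concat p (path_concat q d)))"
      unfolding T_def using d p q
      by (intro path_homotopic_concat_left path_homotopic_cancel_left) (auto simp: simps)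
    also have "path_homotopic X \<dots> (T d (path_concat p q))"
      unfolding T_def using d p q
      by (intro path_homotopic_concat_left path_homotopic_sym[OF path_homotopic_assoc]) (auto simp: simps)
    finally show ?thesis by (rule path_homotopic_sym)
  qed
  have T_inv: "path_homotopic X (T (path_rev d) (T d p)) p"
    if d: "pathin X d" and p: "p \<in> loops_at X (d 0)" for d p
  proof -
    note simps = loops_at_iff pathin_concat pathin_rev
    have "path_homotopic X (T (path_rev d) (T d p))
        (path_concat d (path_concat (path_rev d) (path_concat (path_concat p d) (path_rev d))))"
      unfolding T_def path_rev_simps using d p
      by (intro path_homotopic_concat_left path_homotopic_assoc) (auto simp: simps)
    also have "path_homotopic X \<dots> (path_concat (path_concat p d) (path_rev d))"
      using d p by (intro path_homotopic_cancel_left) (auto simp: simps)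
    also have "path_homotopic X \<dots> p"
      using d p by (intro path_homotopic_cancel_right) (auto simp: simps)
    finally show ?thesis .
  qed
  let ?\<Phi> = "induced_class_map X y (T d)" and ?\<Psi> = "induced_class_map X x (T (path_rev d))"
  have r: "pathin X (path_rev d)" "path_rev d 0 = y" "path_rev d 1 = x"
    using d by (auto simp: pathin_rev)
  note T1 = T_hom[OF d(1), unfolded d(2,3)] T_loop[OF d(1), unfolded d(2,3)]
  note T2 = T_hom[OF r(1), unfolded r(2,3)] T_loop[OF r(1), unfolded r(2,3)]
  have h1: "?\<Phi> \<in> hom (fundamental_group X x) (fundamental_group X y)"
    by (rule induced_class_map_hom[OF T1 T_concat[OF d(1), unfolded d(2,3)]])
  have h2: "?\<Psi> \<in> hom (fundamental_group X y) (fundamental_group X x)"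
    by (rule induced_class_map_hom[OF T2 T_concat[OF r(1), unfolded r(2,3)]])
  have i1: "?\<Psi> (?\<Phi> P) = P" if "P \<in> carrier (fundamental_group X x)" for P
  proof -
    obtain p where p: "p \<in> loops_at X x" "P = loop_class X x p"
      using \<open>P \<in> _\<close> by (rule fundamental_group_carrierE)
    have "?\<Phi> P = loop_class X y (T d p)"
      unfolding p(2) by (rule induced_class_map_apply[OF T1 p(1)])
    also have "?\<Psi> \<dots> = loop_class X x (T (path_rev d) (T d p))"
      by (rule induced_class_map_apply[OF T2 T1(2)[OF p(1)]])
    also have "\<dots> = P"
      using p T_inv[OF d(1)] T1(2) T2(2) d(2) by (simp add: loop_class_eq_iff)
    finally show ?thesis .
  qed
  have i2: "?\<Phi> (?\<Psi> P) = P" if "P \<in> carrier (fundamental_group X y)" for P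
  proof -
    obtain p where p: "p \<in> loops_at X y" "P = loop_class X y p"
      using \<open>P \<in> _\<close> by (rule fundamental_group_carrierE)
    have "?\<Psi> P = loop_class X x (T (path_rev d) p)"
      unfolding p(2) by (rule induced_class_map_apply[OF T2 p(1)])
    also have "?\<Phi> \<dots> = loop_class X y (T d (T (path_rev d) p))"
      by (rule induced_class_map_apply[OF T1 T2(2)[OF p(1)]])
    also have "\<dots> = P"
      using p T_inv[OF r(1)] T1(2) T2(2) r(2) by (simp add: loop_class_eq_iff)
    finally show ?thesis .
  qed
  have "bij_betw ?\<Phi> (carrier (fundamental_group X x)) (carrier (fundamental_group X y))"
    using h1 h2 by (intro bij_betw_byWitness[where f' = ?\<Psi>]) (auto simp: i1 i2 hom_def)
  with h1 have "?\<Phi> \<in> iso (fundamental_group X x) (fundamental_group X y)"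
    by (simp add: iso_def)
  then show ?thesis by (auto simp: is_iso_def)
qed

section \<open>The fundamental group of a covering space\<close>

lemma connected_space_I01: "connected_space I01"
  by (metis connectedin_iff_connected connectedin_def connected_Icc)

text \<open>
  The homotopy downstairs lifts, starting at the constant \<open>\<gamma> 0\<close>. By uniqueness of lifts its two boundary
  rows are \<open>\<gamma>\<close> and \<open>\<delta>\<close>, and its final column, which lies over a single point, is constant. So the lifted
  homotopy fixes the end points; in particular \<open>\<gamma>\<close> and \<open>\<delta>\<close> have the same end.
\<close>

lemma covering_homotopic_lifts:
  assumes cov: "covering_map E B p" and E: "Hausdorff_space E"
    and \<gamma>: "pathin E \<gamma>" and \<delta>: "pathin E \<delta>" and start: "\<gamma> 0 = \<delta> 0"
    and hom: "path_homotopic B (p \<circ> \<gamma>) (p \<circ> \<delta>)"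
  shows "path_homotopic E \<gamma> \<delta>"
proof -
  obtain h where h: "continuous_map (prod_topology I01 I01) B h"
      "\<And>t. h (0, t) = p (\<gamma> t)" "\<And>t. h (1, t) = p (\<delta> t)"
      "\<And>s. s \<in> {0..1} \<Longrightarrow> h (s, 0) = p (\<gamma> 0)" "\<And>s. s \<in> {0..1} \<Longrightarrow> h (s, 1) = p (\<gamma> 1)"
    using hom by (auto simp: path_homotopic_def homotopic_with_def)
  have inE: "\<gamma> t \<in> topspace E" if "t \<in> {0..1}" for t
    using \<gamma> that by (auto simp: pathin_def continuous_map_def)
  have const: "continuous_map I01 E (\<lambda>s. \<gamma> t)" if "t \<in> {0..1}" for t
    using inE[OF that] by simp
  obtain F where F: "continuous_map (prod_topology I01 I01) E F"
      "\<And>s t. \<lbrakk>s \<in> {0..1}; t \<in> {0..1}\<rbrakk> \<Longrightarrow> p (F (s, t)) = h (s, t)"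
      "\<And>s. s \<in> {0..1} \<Longrightarrow> F (s, 0) = \<gamma> 0"
    using covering_lift_homotopy[OF cov E h(1) const[of 0]] h(4) by auto
  have row: "continuous_map I01 E (\<lambda>t. F (s, t))" if "s \<in> {0..1}" for s
  proof -
    have "continuous_map I01 E (F \<circ> (\<lambda>t. (s, t)))"
      by (rule continuous_map_compose[OF _ F(1)]) (use that in \<open>auto intro!: continuous_intros\<close>)
    then show ?thesis by (simp add: o_def)
  qed
  have col: "continuous_map I01 E (\<lambda>s. F (s, 1))"
  proof -
    have "continuous_map I01 E (F \<circ> (\<lambda>s. (s, 1)))"
      by (rule continuous_map_compose[OF _ F(1)]) (auto intro!: continuous_intros)
    then show ?thesis by (simp add: o_def)
  qed
  have F0: "F (0, t) = \<gamma> t" if "t \<in> {0..1}" for t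
    by (rule covering_lift_unique[OF cov E connected_space_I01 row[of 0] \<gamma>[unfolded pathin_def], of 0])
      (use F h that in auto)
  have F1: "F (1, t) = \<delta> t" if "t \<in> {0..1}" for t
    by (rule covering_lift_unique[OF cov E connected_space_I01 row[of 1] \<delta>[unfolded pathin_def], of 0])
      (use F h that start in auto)
  have Fe: "F (s, 1) = \<gamma> 1" if "s \<in> {0..1}" for s
    by (rule covering_lift_unique[OF cov E connected_space_I01 col const[of 1], of 0])
      (use F h that F0 in auto)
  have "path_homotopic E (\<lambda>t. F (0, t)) (\<lambda>t. F (1, t))"
    unfolding path_homotopic_def homotopic_with_def
    using F Fe by (intro exI[of _ F]) auto
  moreover have "path_homotopic E \<gamma> (\<lambda>t. F (0, t))"
    by (rule path_homotopic_eq[OF \<gamma> F0])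
  moreover have "path_homotopic E (\<lambda>t. F (1, t)) \<delta>"
    by (rule path_homotopic_sym[OF path_homotopic_eq[OF \<delta> F1]])
  ultimately show ?thesis by (blast intro: path_homotopic_trans)
qed

lemma comp_path_concat: "p \<circ> path_concat q r = path_concat (p \<circ> q) (p \<circ> r)"
  by (auto simp: path_concat_def)

lemma loop_in_image:
  assumes "continuous_map E B p" "\<gamma> \<in> loops_at E x"
  shows "p \<circ> \<gamma> \<in> loops_at B (p x)"
  using assms(2) pathin_compose[of E \<gamma> B p] assms(1) by (simp add: loops_at_iff)

text \<open>
  Let \<open>H\<close> be the image of the fundamental group of \<open>E\<close> at \<open>x\<close>. Homotopic loops downstairs have homotopic
  lifts, so \<open>p\<close> induces an injection and \<open>H\<close> is isomorphic to that group, hence also to the one based at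
  \<open>a\<close>. A coset of \<open>H\<close> is determined by the end point of the lift, starting at \<open>x\<close>, of a loop
  representing it; so there are at most as many cosets as points in the fibre. A path from \<open>x\<close> to
  another point of the fibre projects to a loop whose class is not in \<open>H\<close>, so a second point would make \<open>H\<close> proper.
\<close>

lemma covering_fibre_trivial:
  assumes cov: "covering_map E B p" and E: "Hausdorff_space E" "path_connected_space E"
    and x: "x \<in> topspace E" and a: "a \<in> topspace E"
    and fin: "finite {e \<in> topspace E. p e = p x}"
    and no_subgroup: "\<nexists>H. subgroup H (fundamental_group B (p x)) \<and>
       H \<noteq> carrier (fundamental_group B (p x)) \<and>
       finite (rcosets\<^bsub>fundamental_group B (p x)\<^esub> H) \<and>
       fundamental_group B (p x)\<lparr>carrier := H\<rparr> \<cong> fundamental_group E a"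
  shows "{e \<in> topspace E. p e = p x} = {x}"
proof (rule ccontr)
  assume "{e \<in> topspace E. p e = p x} \<noteq> {x}"
  then obtain x' where x': "x' \<in> topspace E" "p x' = p x" "x' \<noteq> x"
    using x by blast
  define y where "y = p x"
  let ?G = "fundamental_group E x" and ?K = "fundamental_group B y"
  let ?\<phi> = "induced_class_map B y ((\<circ>) p)"
  define H where "H = ?\<phi> ` carrier ?G"
  have cont: "continuous_map E B p" using cov by (simp add: covering_map_def)
  then have y: "y \<in> topspace B" using x by (auto simp: y_def continuous_map_def)
  interpret G: group ?G by (rule group_fundamental_group[OF x])
  interpret K: group ?K by (rule group_fundamental_group[OF y])
  have T: "path_homotopic B (p \<circ> \<gamma>) (p \<circ> \<delta>)" if "\<gamma> \<in> loops_at E x" "path_homotopic E \<gamma> \<delta>" for \<gamma> \<delta>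
    using path_homotopic_image[OF that(2) cont] .
  have T_loop: "p \<circ> \<gamma> \<in> loops_at B y" if "\<gamma> \<in> loops_at E x" for \<gamma>
    using loop_in_image[OF cont that] by (simp add: y_def)
  have hom: "?\<phi> \<in> hom ?G ?K"
  proof (rule induced_class_map_hom[OF T T_loop])
    fix \<gamma> \<delta> assume "\<gamma> \<in> loops_at E x" "\<delta> \<in> loops_at E x"
    then have "path_concat (p \<circ> \<gamma>) (p \<circ> \<delta>) \<in> loops_at B y"
      by (intro loops_at_concat T_loop)
    then show "path_homotopic B (p \<circ> path_concat \<gamma> \<delta>) (path_concat (p \<circ> \<gamma>) (p \<circ> \<delta>))"
      by (simp add: comp_path_concat path_homotopic_refl loops_at_iff)
  qed
  have app: "?\<phi> (loop_class E x \<gamma>) = loop_class B y (p \<circ> \<gamma>)" if "\<gamma> \<in> loops_at E x" for \<gamma>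
    by (rule induced_class_map_apply[OF T T_loop that])
  have inH: "loop_class B y (p \<circ> \<gamma>) \<in> H" if "\<gamma> \<in> loops_at E x" for \<gamma>
    unfolding H_def using app[OF that] that by (intro image_eqI[of _ _ "loop_class E x \<gamma>"]) auto
  \<comment> \<open>A class belongs to \<open>H\<close> only if the lift from \<open>x\<close> of a loop representing it closes up.\<close>
  have lift_loop: "\<delta> 1 = x"
    if \<delta>: "pathin E \<delta>" "\<delta> 0 = x" "p (\<delta> 1) = y" and dH: "loop_class B y (p \<circ> \<delta>) \<in> H" for \<delta>
  proof -
    obtain \<gamma> where \<gamma>: "\<gamma> \<in> loops_at E x" "loop_class B y (p \<circ> \<delta>) = loop_class B y (p \<circ> \<gamma>)"
      using dH unfolding H_def by (auto elim!: fundamental_group_carrierE simp: app)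
    have "p \<circ> \<delta> \<in> loops_at B y"
      using \<delta> pathin_compose[OF \<delta>(1) cont] by (simp add: loops_at_iff y_def)
    from loop_class_eq_iff[OF this T_loop[OF \<gamma>(1)]]
    have "path_homotopic B (p \<circ> \<delta>) (p \<circ> \<gamma>)"
      using \<gamma>(2) by simp
    then have "path_homotopic E \<delta> \<gamma>"
      using \<gamma>(1) \<delta> by (intro covering_homotopic_lifts[OF cov E(1)]) (auto simp: loops_at_iff)
    then show ?thesis
      using \<gamma>(1) path_homotopic_imp(4)[of E \<delta> \<gamma>] by (simp add: loops_at_iff)
  qed
  have inj: "inj_on ?\<phi> (carrier ?G)"
  proof (rule inj_onI)
    fix P Q assume "P \<in> carrier ?G" "Q \<in> carrier ?G" and eq: "?\<phi> P = ?\<phi> Q"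
    then obtain \<gamma> \<delta> where \<gamma>: "\<gamma> \<in> loops_at E x" "P = loop_class E x \<gamma>"
      and \<delta>: "\<delta> \<in> loops_at E x" "Q = loop_class E x \<delta>"
      by (meson fundamental_group_carrierE)
    then have "loop_class B y (p \<circ> \<gamma>) = loop_class B y (p \<circ> \<delta>)"
      using eq app[OF \<gamma>(1)] app[OF \<delta>(1)] by simp
    then have "path_homotopic B (p \<circ> \<gamma>) (p \<circ> \<delta>)"
      using loop_class_eq_iff[OF T_loop[OF \<gamma>(1)] T_loop[OF \<delta>(1)]] by simp
    then have "path_homotopic E \<gamma> \<delta>"
      using \<gamma>(1) \<delta>(1) by (intro covering_homotopic_lifts[OF cov E(1)]) (auto simp: loops_at_iff)
    then show "P = Q"
      using \<gamma> \<delta> by (simp add: loop_class_eq_iff)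
  qed
  have sub: "subgroup H ?K"
    unfolding H_def using hom by (intro group_hom.img_is_subgroup) (simp add: group_hom_def group_hom_axioms_def G.group_axioms K.group_axioms)
  have "?\<phi> \<in> iso ?G (?K\<lparr>carrier := H\<rparr>)"
    using hom inj unfolding H_def iso_def bij_betw_def hom_def by auto
  then have "?K\<lparr>carrier := H\<rparr> \<cong> ?G"
    by (intro G.iso_sym) (auto simp: is_iso_def)
  moreover obtain d where "pathin E d" "d 0 = x" "d 1 = a"
    using E(2) x a unfolding path_connected_space_def by blast
  then have "?G \<cong> fundamental_group E a"
    by (rule fundamental_group_base_change)
  ultimately have iso: "?K\<lparr>carrier := H\<rparr> \<cong> fundamental_group E a"
    by (rule iso_trans)
  \<comment> \<open>The projections of the paths \<open>d e\<close> represent all cosets.\<close>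
  obtain d where d: "\<And>e. e \<in> topspace E \<Longrightarrow> pathin E (d e) \<and> d e 0 = x \<and> d e 1 = e"
    using E(2) x unfolding path_connected_space_def by metis
  have proj: "pathin B (p \<circ> \<delta>)" if "pathin E \<delta>" for \<delta>
    using pathin_compose[OF that cont] .
  have proper: "H \<noteq> carrier ?K"
  proof
    assume "H = carrier ?K"
    moreover have "p \<circ> d x' \<in> loops_at B y"
      using d[OF x'(1)] x' proj by (simp add: loops_at_iff y_def)
    ultimately have "loop_class B y (p \<circ> d x') \<in> H" by blast
    moreover have "p (d x' 1) = y"
      using d[OF x'(1)] x'(2) by (simp add: y_def)
    ultimately have "d x' 1 = x"
      using lift_loop[of "d x'"] d[OF x'(1)] by blast
    with d[OF x'(1)] x'(3) show False by simp
  qed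
  have "finite (rcosets\<^bsub>?K\<^esub> H)"
  proof (rule finite_subset)
    show "finite ((\<lambda>e. H #>\<^bsub>?K\<^esub> loop_class B y (p \<circ> d e)) ` {e \<in> topspace E. p e = y})"
      using fin by (simp add: y_def)
    show "rcosets\<^bsub>?K\<^esub> H \<subseteq> (\<lambda>e. H #>\<^bsub>?K\<^esub> loop_class B y (p \<circ> d e)) ` {e \<in> topspace E. p e = y}"
    proof
      fix C assume "C \<in> rcosets\<^bsub>?K\<^esub> H"
      then obtain Q where Q: "Q \<in> carrier ?K" "C = H #>\<^bsub>?K\<^esub> Q"
        unfolding RCOSETS_def by blast
      obtain q where q: "q \<in> loops_at B y" "Q = loop_class B y q"
        using Q(1) by (rule fundamental_group_carrierE)
      obtain \<delta> where \<delta>: "pathin E \<delta>" "\<delta> 0 = x" "\<And>t. t \<in> {0..1} \<Longrightarrow> p (\<delta> t) = q t"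
        using covering_lift_path[OF cov E(1), of q x] q x by (auto simp: loops_at_iff y_def)
      define e where "e = \<delta> 1"
      have e: "e \<in> topspace E" "p e = y"
        using \<delta> q by (auto simp: e_def pathin_def continuous_map_def loops_at_iff)
      define r where "r = p \<circ> d e"
      have r: "r \<in> loops_at B y"
        using d[OF e(1)] e proj by (simp add: r_def loops_at_iff y_def)
      \<comment> \<open>The loop at \<open>x\<close> whose projection carries the representative \<open>r\<close> to \<open>q\<close>.\<close>
      define l where "l = path_concat \<delta> (path_rev (d e))"
      have l: "l \<in> loops_at E x"
        using d[OF e(1)] \<delta> by (simp add: l_def loops_at_iff pathin_concat pathin_rev e_def)
      have r': "pathin B (path_rev r)"
        using r by (intro pathin_rev) (simp add: loops_at_iff)
      have p\<delta>: "(p \<circ> \<delta>) 1 = path_rev r 0"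
        using r e by (simp add: loops_at_iff e_def)
      have "path_homotopic B q (p \<circ> \<delta>)"
        using q(1) \<delta>(3) by (intro path_homotopic_eq) (auto simp: loops_at_iff)
      also have "path_homotopic B \<dots> (path_concat (path_concat (p \<circ> \<delta>) (path_rev r)) r)"
        using path_homotopic_cancel_right[OF r' proj[OF \<delta>(1)] p\<delta>]
        unfolding path_rev_simps by (rule path_homotopic_sym)
      also have "path_concat (p \<circ> \<delta>) (path_rev r) = p \<circ> l"
        unfolding l_def comp_path_concat r_def by (simp add: path_rev_def o_def)
      finally have "path_homotopic B q (path_concat (p \<circ> l) r)" .
      then have "Q = loop_class B y (path_concat (p \<circ> l) r)"
        unfolding q(2) by (subst loop_class_eq_iff[OF q(1) loops_at_concat[OF T_loop[OF l] r]])
      then have "Q = loop_class B y (p \<circ> l) \<otimes>\<^bsub>?K\<^esub> loop_class B y r"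
        using r T_loop[OF l] by (simp add: loop_class_mult)
      then have "Q \<in> H #>\<^bsub>?K\<^esub> loop_class B y r"
        using inH[OF l] by (auto simp: r_coset_def)
      then have "C = H #>\<^bsub>?K\<^esub> loop_class B y r"
        using Q r sub K.repr_independence by (metis loop_class_in_carrier)
      with e show "C \<in> (\<lambda>e. H #>\<^bsub>?K\<^esub> loop_class B y (p \<circ> d e)) ` {e \<in> topspace E. p e = y}"
        by (auto simp: r_def)
    qed
  qed
  with sub proper iso no_subgroup show False
    unfolding y_def by blast
qed

section \<open>Cubes in Euclidean space\<close>

lemma continuous_map_Euclidean_coordinate: "continuous_map (Euclidean_space n) euclideanreal (\<lambda>w. w i)"
  unfolding Euclidean_space_def
  using continuous_map_product_projection[of i UNIV "\<lambda>_. euclideanreal"]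
  by (intro continuous_map_from_subtopology) simp

text \<open>
  In each coordinate the interval is rescaled to \<open>{-1<..<1}\<close> and then mapped to the line by
  \<open>s \<mapsto> s / (1 - \<bar>s\<bar>)\<close>, which has the inverse \<open>s \<mapsto> s / (1 + \<bar>s\<bar>)\<close>.
\<close>

lemma open_box_homeomorphic_Euclidean_space:
  assumes lu: "\<And>i. i < n \<Longrightarrow> l i < u i"
  shows "subtopology (Euclidean_space n) {w. \<forall>i<n. l i < w i \<and> w i < u i} homeomorphic_space Euclidean_space n"
proof -
  let ?S = "subtopology (Euclidean_space n) {w. \<forall>i<n. l i < w i \<and> w i < u i}"
  define m where "m i = (l i + u i) / 2" for i
  define r where "r i = (u i - l i) / 2" for i
  have r: "r i > 0" if "i < n" for i using lu[OF that] by (simp add: r_def)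
  have abs_iff: "l i < t \<and> t < u i \<longleftrightarrow> \<bar>(t - m i) / r i\<bar> < 1" if "i < n" for i t
  proof -
    have "\<bar>(t - m i) / r i\<bar> < 1 \<longleftrightarrow> \<bar>t - m i\<bar> < r i"
      using r[OF that] by (simp add: abs_divide)
    then show ?thesis by (auto simp: m_def r_def abs_less_iff field_simps)
  qed
  define f where "f = (\<lambda>w i. if i < n then ((w i - m i) / r i) / (1 - \<bar>(w i - m i) / r i\<bar>) else 0)"
  define g where "g = (\<lambda>w i. if i < n then m i + r i * (w i / (1 + \<bar>w i\<bar>)) else (0::real))"
  have inv1: "(s / (1 - \<bar>s\<bar>)) / (1 + \<bar>s / (1 - \<bar>s\<bar>)\<bar>) = s" if "\<bar>s\<bar> < 1" for s :: real
  proof -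
    have "1 + \<bar>s / (1 - \<bar>s\<bar>)\<bar> = 1 / (1 - \<bar>s\<bar>)"
      using that by (simp add: abs_divide field_simps)
    with that show ?thesis by simp
  qed
  have inv2: "(s / (1 + \<bar>s\<bar>)) / (1 - \<bar>s / (1 + \<bar>s\<bar>)\<bar>) = s" "\<bar>s / (1 + \<bar>s\<bar>)\<bar> < 1" for s :: real
  proof -
    have "1 - \<bar>s / (1 + \<bar>s\<bar>)\<bar> = 1 / (1 + \<bar>s\<bar>)"
      by (simp add: abs_divide field_simps)
    then show "(s / (1 + \<bar>s\<bar>)) / (1 - \<bar>s / (1 + \<bar>s\<bar>)\<bar>) = s" by simp
    show "\<bar>s / (1 + \<bar>s\<bar>)\<bar> < 1" by (simp add: abs_divide)
  qed
  have coord: "continuous_map ?S euclideanreal (\<lambda>w. w i)" for i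
    using continuous_map_Euclidean_coordinate continuous_map_from_subtopology by blast
  have gr: "(g w i - m i) / r i = w i / (1 + \<bar>w i\<bar>)" if "i < n" for w i
    using r[OF that] that by (simp add: g_def)
  have "homeomorphic_maps ?S (Euclidean_space n) f g"
    unfolding homeomorphic_maps_def
  proof (intro conjI ballI)
    show "continuous_map ?S (Euclidean_space n) f"
      unfolding f_def continuous_map_componentwise_Euclidean_space
    proof (intro allI impI)
      fix i assume i: "i < n"
      have "1 - \<bar>(w i - m i) / r i\<bar> \<noteq> 0" if "w \<in> topspace ?S" for w
        using abs_iff[OF i, of "w i"] that i by (auto simp del: abs_divide)
      then show "continuous_map ?S euclideanreal (\<lambda>w. (w i - m i) / r i / (1 - \<bar>(w i - m i) / r i\<bar>))"
        using r[OF i]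
        by (intro continuous_map_real_divide continuous_map_diff continuous_map_real_abs coord) auto
    qed
    have "continuous_map (Euclidean_space n) (Euclidean_space n) g"
      unfolding g_def continuous_map_componentwise_Euclidean_space
      by (intro allI impI continuous_map_add continuous_map_real_mult continuous_map_real_divide
          continuous_map_real_abs continuous_map_Euclidean_coordinate) (auto simp: add_nonneg_eq_0_iff)
    moreover have "l i < g w i \<and> g w i < u i" if "i < n" for w i
      unfolding abs_iff[OF that] gr[OF that] by (rule inv2)
    ultimately show "continuous_map (Euclidean_space n) ?S g"
      by (auto simp: continuous_map_in_subtopology)
  next
    fix w assume "w \<in> topspace ?S"
    then have w: "\<And>i. i < n \<Longrightarrow> l i < w i \<and> w i < u i" "\<And>i. i \<ge> n \<Longrightarrow> w i = 0"
      by (auto simp: topspace_Euclidean_space)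
    show "g (f w) = w"
    proof
      fix i show "g (f w) i = w i"
      proof (cases "i < n")
        case True
        have "\<bar>(w i - m i) / r i\<bar> < 1" using abs_iff[OF True] w(1)[OF True] by blast
        note inv = inv1[OF this]
        have "f w i = ((w i - m i) / r i) / (1 - \<bar>(w i - m i) / r i\<bar>)"
          using True by (simp only: f_def if_True)
        moreover have "g (f w) i = m i + r i * (f w i / (1 + \<bar>f w i\<bar>))"
          using True by (simp only: g_def if_True)
        ultimately have "g (f w) i = m i + r i * ((w i - m i) / r i)"
          by (simp only: inv)
        with r[OF True] show ?thesis by simp
      qed (simp add: g_def w)
    qed
  next
    fix w assume "w \<in> topspace (Euclidean_space n)"
    then have w: "\<And>i. i \<ge> n \<Longrightarrow> w i = 0" by (auto simp: topspace_Euclidean_space)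
    show "f (g w) = w"
    proof
      fix i show "f (g w) i = w i"
      proof (cases "i < n")
        case True
        then have "f (g w) i = ((g w i - m i) / r i) / (1 - \<bar>(g w i - m i) / r i\<bar>)"
          by (simp only: f_def if_True)
        then show ?thesis unfolding gr[OF True] inv2(1) .
      qed (simp add: f_def w)
    qed
  qed
  then show ?thesis by (rule homeomorphic_maps_imp_homeomorphic_space)
qed

definition cube :: "nat \<Rightarrow> (nat \<Rightarrow> real) \<Rightarrow> real \<Rightarrow> (nat \<Rightarrow> real) set" where
  "cube n z \<epsilon> = {w \<in> topspace (Euclidean_space n). \<forall>i<n. \<bar>w i - z i\<bar> < \<epsilon>}"

lemma openin_cube: "openin (Euclidean_space n) (cube n z \<epsilon>)"
proof -
  have "openin (Euclidean_space n) {w \<in> topspace (Euclidean_space n). w i \<in> ball (z i) \<epsilon>}" for i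
    by (intro openin_continuous_map_preimage[OF continuous_map_Euclidean_coordinate]) simp
  moreover have "cube n z \<epsilon> = topspace (Euclidean_space n) \<inter>
      (\<Inter>i\<in>{..<n}. {w \<in> topspace (Euclidean_space n). w i \<in> ball (z i) \<epsilon>})"
    by (auto simp: cube_def dist_real_def abs_minus_commute)
  moreover have "openin (Euclidean_space n) (topspace (Euclidean_space n) \<inter> (\<Inter>i\<in>S. T i))"
    if "finite S" "\<And>i. openin (Euclidean_space n) (T i)" for S :: "nat set" and T
    using that by (induction S rule: finite_induct) (auto intro: openin_Int simp: Int_left_commute)
  ultimately show ?thesis by simp
qed

lemma cube_subset_open:
  assumes "openin (Euclidean_space n) T" "z \<in> T"
  obtains \<epsilon> where "\<epsilon> > 0" "cube n z \<epsilon> \<subseteq> T"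
proof -
  obtain T' where T': "openin (powertop_real UNIV) T'" "T = T' \<inter> {x. \<forall>i\<ge>n. x i = 0}"
    using assms(1) unfolding Euclidean_space_def openin_subtopology by blast
  have "z \<in> T'" using assms T' by blast
  then obtain X where X: "z \<in> (\<Pi>\<^sub>E i\<in>UNIV. X i)" "\<And>i. open (X i)" "(\<Pi>\<^sub>E i\<in>UNIV. X i) \<subseteq> T'"
    using product_topology_open_contains_basis[OF T'(1)] by force
  have "\<exists>d>0. ball (z i) d \<subseteq> X i" for i
    using X(1,2) open_contains_ball by blast
  then obtain d where d: "\<And>i. d i > 0" "\<And>i. ball (z i) (d i) \<subseteq> X i"
    by metis
  define \<epsilon> where "\<epsilon> = Min (insert 1 (d ` {..<n}))"
  have "\<epsilon> > 0" using d by (simp add: \<epsilon>_def)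
  moreover have "cube n z \<epsilon> \<subseteq> T"
  proof
    fix w assume w: "w \<in> cube n z \<epsilon>"
    have "w i \<in> X i" for i
    proof (cases "i < n")
      case True
      then have "\<bar>w i - z i\<bar> < \<epsilon>" "\<epsilon> \<le> d i" using w by (auto simp: cube_def \<epsilon>_def)
      then show ?thesis using d(2)[of i] by (force simp: dist_real_def)
    next
      case False
      then have "w i = z i" using w assms T' by (auto simp: cube_def topspace_Euclidean_space)
      then show ?thesis using d(1,2)[of i] by (metis centre_in_ball subsetD)
    qed
    then have "w \<in> T'" using X(3) by auto
    then show "w \<in> T" using w T' by (simp add: cube_def topspace_Euclidean_space)
  qed
  ultimately show thesis by (rule that)
qed

lemma cube_homeomorphic_Euclidean_space:
  assumes "\<epsilon> > 0"
  shows "subtopology (Euclidean_space n) (cube n z \<epsilon>) homeomorphic_space Euclidean_space n"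
proof -
  have eq: "topspace (Euclidean_space n) \<inter> {w. \<forall>i<n. z i - \<epsilon> < w i \<and> w i < z i + \<epsilon>} = cube n z \<epsilon>"
    by (auto simp: cube_def abs_less_iff algebra_simps)
  have "subtopology (Euclidean_space n) (cube n z \<epsilon>) =
      subtopology (Euclidean_space n) {w. \<forall>i<n. z i - \<epsilon> < w i \<and> w i < z i + \<epsilon>}"
    unfolding eq[symmetric] by (rule subtopology_restrict)
  then show ?thesis
    using open_box_homeomorphic_Euclidean_space[of n "\<lambda>i. z i - \<epsilon>" "\<lambda>i. z i + \<epsilon>"] assms by simp
qed

text \<open>
  A small half-ball in the half-space is a cube around a boundary point intersected with
  \<open>{w. w 0 \<ge> 0}\<close>. Its inside is again an open box, and its face is a cube of dimension \<open>n - 1\<close>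
  after a shift of the coordinates.
\<close>

lemma cube_inside_homeomorphic_Euclidean_space:
  assumes "\<epsilon> > 0" "z 0 = 0" "n > 0"
  shows "subtopology (Euclidean_space n) (cube n z \<epsilon> \<inter> {w. w 0 > 0}) homeomorphic_space Euclidean_space n"
proof -
  let ?l = "\<lambda>i. if i = 0 then 0 else z i - \<epsilon>" and ?u = "\<lambda>i. z i + \<epsilon>"
  have eq: "topspace (Euclidean_space n) \<inter> {w. \<forall>i<n. ?l i < w i \<and> w i < ?u i} = cube n z \<epsilon> \<inter> {w. w 0 > 0}"
    using assms by (fastforce simp: cube_def abs_less_iff algebra_simps split: if_splits)
  have "subtopology (Euclidean_space n) (cube n z \<epsilon> \<inter> {w. w 0 > 0}) =
      subtopology (Euclidean_space n) {w. \<forall>i<n. ?l i < w i \<and> w i < ?u i}"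
    unfolding eq[symmetric] by (rule subtopology_restrict)
  then show ?thesis
    using open_box_homeomorphic_Euclidean_space[of n ?l ?u] assms by simp
qed

lemma cube_face_homeomorphic_Euclidean_space:
  assumes "\<epsilon> > 0" "z 0 = 0" "n > 0"
  shows "subtopology (Euclidean_space n) (cube n z \<epsilon> \<inter> {w. w 0 = 0}) homeomorphic_space Euclidean_space (n - 1)"
proof -
  let ?f = "\<lambda>w i. if i < n - 1 then w (Suc i) else 0"
  let ?g = "\<lambda>w i. if i < n then (if i = 0 then 0 else w (i - 1)) else (0::real)"
  let ?z = "\<lambda>i. z (Suc i)"
  let ?S = "subtopology (Euclidean_space n) (cube n z \<epsilon> \<inter> {w. w 0 = 0})"
  let ?T = "subtopology (Euclidean_space (n - 1)) (cube (n - 1) ?z \<epsilon>)"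
  have "homeomorphic_maps ?S ?T ?f ?g"
    unfolding homeomorphic_maps_def
  proof (intro conjI ballI)
    have "continuous_map (Euclidean_space n) (Euclidean_space (n - 1)) ?f"
      unfolding continuous_map_componentwise_Euclidean_space by (simp add: continuous_map_Euclidean_coordinate)
    then have "continuous_map ?S (Euclidean_space (n - 1)) ?f"
      by (rule continuous_map_from_subtopology)
    then show "continuous_map ?S ?T ?f"
      by (auto simp: continuous_map_in_subtopology cube_def topspace_Euclidean_space)
    have "continuous_map (Euclidean_space (n - 1)) (Euclidean_space n) ?g"
      unfolding continuous_map_componentwise_Euclidean_space
      by (intro allI impI continuous_map_if) (simp_all add: continuous_map_Euclidean_coordinate)
    then have "continuous_map ?T (Euclidean_space n) ?g"
      by (rule continuous_map_from_subtopology)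
    moreover have "?g w \<in> cube n z \<epsilon> \<inter> {w. w 0 = 0}" if "w \<in> cube (n - 1) ?z \<epsilon>" for w
    proof -
      have "\<bar>?g w i - z i\<bar> < \<epsilon>" if "i < n" for i
        using that assms \<open>w \<in> cube (n - 1) ?z \<epsilon>\<close> by (cases i) (auto simp: cube_def)
      then show ?thesis using assms by (auto simp: cube_def topspace_Euclidean_space)
    qed
    ultimately show "continuous_map ?T ?S ?g"
      by (auto simp: continuous_map_in_subtopology)
  next
    fix w assume "w \<in> topspace ?S"
    then show "?g (?f w) = w"
      by (auto simp: fun_eq_iff cube_def topspace_Euclidean_space)
  next
    fix w assume "w \<in> topspace ?T"
    then show "?f (?g w) = w"
      by (auto simp: fun_eq_iff cube_def topspace_Euclidean_space)
  qed
  then have "?S homeomorphic_space ?T"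
    by (rule homeomorphic_maps_imp_homeomorphic_space)
  also have "?T homeomorphic_space Euclidean_space (n - 1)"
    by (rule cube_homeomorphic_Euclidean_space[OF assms(1)])
  finally show ?thesis .
qed

section \<open>The local structure of a manifold with boundary\<close>

lemma homeomorphic_map_image:
  assumes \<phi>: "homeomorphic_map A (subtopology M W) \<phi>" and S: "S \<subseteq> topspace A"
  shows "subtopology A S homeomorphic_space subtopology M (\<phi> ` S)"
proof -
  have img: "\<phi> ` S \<subseteq> topspace (subtopology M W)"
    using homeomorphic_imp_surjective_map[OF \<phi>] S by blast
  then have "\<phi> ` (topspace A \<inter> S) = topspace (subtopology M W) \<inter> \<phi> ` S"
    using S by blast
  then have "homeomorphic_map (subtopology A S) (subtopology (subtopology M W) (\<phi> ` S)) \<phi>"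
    by (rule homeomorphic_map_subtopologies[OF \<phi>])
  moreover have "W \<inter> \<phi> ` S = \<phi> ` S" using img by auto
  ultimately show ?thesis
    by (simp add: subtopology_subtopology homeomorphic_map_imp_homeomorphic_space)
qed

lemma homeomorphic_map_open_image:
  assumes \<phi>: "homeomorphic_map A (subtopology M W) \<phi>" and W: "openin M W" and S: "openin A S"
  shows "openin M (\<phi> ` S)"
  using homeomorphic_map_openness[OF \<phi> openin_subset[OF S]] S W openin_trans_full by blast

lemma homeomorphic_map_open_preimage:
  assumes \<phi>: "homeomorphic_map A (subtopology M W) \<phi>" and N: "openin M N"
  shows "openin A {w \<in> topspace A. \<phi> w \<in> N}"
proof -
  have "continuous_map A M \<phi>"
    using homeomorphic_imp_continuous_map[OF \<phi>] by (simp add: continuous_map_in_subtopology)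
  then show ?thesis using N by (rule openin_continuous_map_preimage)
qed

definition locally_Euclidean :: "nat \<Rightarrow> 'a topology \<Rightarrow> bool" where
  "locally_Euclidean n M \<longleftrightarrow> (\<forall>N x. openin M N \<longrightarrow> x \<in> N \<longrightarrow>
     (\<exists>V. openin M V \<and> x \<in> V \<and> V \<subseteq> N \<and> subtopology M V homeomorphic_space Euclidean_space n))"

text \<open>
  The class of spaces in which invariance of domain is available: both a manifold with boundary and
  its boundary locally embed into the Euclidean space of their dimension.
\<close>

definition locally_embeds :: "nat \<Rightarrow> 'a topology \<Rightarrow> bool" where
  "locally_embeds n M \<longleftrightarrow> (\<forall>y\<in>topspace M. \<exists>W S. openin M W \<and> y \<in> W \<and>
     subtopology M W homeomorphic_space subtopology (Euclidean_space n) S)"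

lemma locally_Euclidean_imp_locally_embeds:
  "locally_Euclidean n M \<Longrightarrow> locally_embeds n M"
  unfolding locally_Euclidean_def locally_embeds_def by (metis openin_topspace subtopology_UNIV)

text \<open>
  Near each of its points, the copy of \<open>\<real>\<^sup>n\<close> becomes in a chart an injective continuous image of an
  open set of \<open>\<real>\<^sup>n\<close>, which is open by invariance of domain.
\<close>

lemma openin_Euclidean_subspace:
  assumes M: "locally_embeds n M" and U: "U \<subseteq> topspace M"
    and UE: "subtopology M U homeomorphic_space Euclidean_space n"
  shows "openin M U"
proof (subst openin_subopen, intro ballI)
  fix y assume y: "y \<in> U"
  then obtain W S \<psi> where W: "openin M W" "y \<in> W"
    and \<psi>: "homeomorphic_map (subtopology M W) (subtopology (Euclidean_space n) S) \<psi>"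
    using M U unfolding locally_embeds_def homeomorphic_space by blast
  obtain \<phi> where \<phi>: "homeomorphic_map (Euclidean_space n) (subtopology M U) \<phi>"
    using UE unfolding homeomorphic_space[symmetric] homeomorphic_space_sym[of "subtopology M U"]
    by (auto simp: homeomorphic_space)
  let ?O = "{w \<in> topspace (Euclidean_space n). \<phi> w \<in> W}"
  have oO: "openin (Euclidean_space n) ?O"
    by (rule homeomorphic_map_open_preimage[OF \<phi> W(1)])
  have \<phi>_img: "\<phi> ` topspace (Euclidean_space n) = U"
    using homeomorphic_imp_surjective_map[OF \<phi>] U by auto
  then have img: "\<phi> ` ?O = U \<inter> W" by auto
  have \<psi>_cont: "continuous_map (subtopology M W) (Euclidean_space n) \<psi>"
    using homeomorphic_imp_continuous_map[OF \<psi>] by (simp add: continuous_map_in_subtopology)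
  have \<psi>_inj: "inj_on \<psi> W"
    using homeomorphic_imp_injective_map[OF \<psi>] openin_subset[OF W(1)] by (simp add: inf.absorb2)
  have "continuous_map (subtopology (Euclidean_space n) ?O) (subtopology M W) \<phi>"
    using homeomorphic_imp_continuous_map[OF \<phi>]
    by (auto simp: continuous_map_in_subtopology continuous_map_from_subtopology)
  then have "continuous_map (subtopology (Euclidean_space n) ?O) (Euclidean_space n) (\<psi> \<circ> \<phi>)"
    using \<psi>_cont by (rule continuous_map_compose)
  moreover have "inj_on (\<psi> \<circ> \<phi>) ?O"
  proof (rule comp_inj_on)
    show "inj_on \<phi> ?O"
      using homeomorphic_imp_injective_map[OF \<phi>] by (rule inj_on_subset) auto
    show "inj_on \<psi> (\<phi> ` ?O)"
      using \<psi>_inj by (rule inj_on_subset) auto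
  qed
  ultimately have "openin (Euclidean_space n) ((\<psi> \<circ> \<phi>) ` ?O)"
    by (rule invariance_of_domain_Euclidean_space[OF oO])
  then have oI: "openin (Euclidean_space n) (\<psi> ` (U \<inter> W))"
    unfolding image_comp[symmetric] img .
  have "openin (subtopology M W) {x \<in> topspace (subtopology M W). \<psi> x \<in> \<psi> ` (U \<inter> W)}"
    by (rule openin_continuous_map_preimage[OF \<psi>_cont oI])
  also have "{x \<in> topspace (subtopology M W). \<psi> x \<in> \<psi> ` (U \<inter> W)} = U \<inter> W"
    using U \<psi>_inj by (auto simp: inj_on_def)
  finally have "openin M (U \<inter> W)"
    using W(1) openin_trans_full by blast
  then show "\<exists>T. openin M T \<and> y \<in> T \<and> T \<subseteq> U"
    using y W(2) by blast
qed

lemma topological_manifold_locally_embeds: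
  assumes "topological_manifold n M"
  shows "locally_embeds n M"
  unfolding locally_embeds_def
proof
  fix y assume "y \<in> topspace M"
  then obtain U where "openin M U" "y \<in> U"
    "subtopology M U homeomorphic_space Euclidean_space n \<or> subtopology M U homeomorphic_space half_space n"
    using assms unfolding topological_manifold_def by (metis UnionE)
  then show "\<exists>W S. openin M W \<and> y \<in> W \<and> subtopology M W homeomorphic_space subtopology (Euclidean_space n) S"
    unfolding half_space_def by (metis subtopology_UNIV)
qed

lemma Euclidean_chart_small:
  assumes \<phi>: "homeomorphic_map (Euclidean_space n) (subtopology M U) \<phi>" and U: "openin M U"
    and N: "openin M N" "x \<in> N" "x \<in> U"
  obtains V where "openin M V" "x \<in> V" "V \<subseteq> N" "V \<subseteq> U" "subtopology M V homeomorphic_space Euclidean_space n"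
proof -
  have "x \<in> \<phi> ` topspace (Euclidean_space n)"
    using homeomorphic_imp_surjective_map[OF \<phi>] openin_subset[OF U] N(3) by auto
  then obtain z where z: "z \<in> topspace (Euclidean_space n)" "x = \<phi> z" by blast
  then obtain \<epsilon> where \<epsilon>: "\<epsilon> > 0" "cube n z \<epsilon> \<subseteq> {w \<in> topspace (Euclidean_space n). \<phi> w \<in> N}"
    using cube_subset_open[OF homeomorphic_map_open_preimage[OF \<phi> N(1)], of z] N(2) by blast
  let ?V = "\<phi> ` cube n z \<epsilon>"
  have csub: "cube n z \<epsilon> \<subseteq> topspace (Euclidean_space n)" by (auto simp: cube_def)
  have "openin M ?V" by (rule homeomorphic_map_open_image[OF \<phi> U openin_cube])
  moreover have "x \<in> ?V" using z \<epsilon>(1) by (auto simp: cube_def)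
  moreover have "?V \<subseteq> N" using \<epsilon>(2) by auto
  moreover have "?V \<subseteq> U" using homeomorphic_imp_surjective_map[OF \<phi>] csub by auto
  moreover have "subtopology M ?V homeomorphic_space Euclidean_space n"
    using homeomorphic_map_image[OF \<phi> csub] cube_homeomorphic_Euclidean_space[OF \<epsilon>(1)]
      homeomorphic_space_sym homeomorphic_space_trans by blast
  ultimately show thesis by (rule that)
qed

lemma manifold_interior_small:
  assumes "x \<in> manifold_interior n M" "openin M N" "x \<in> N"
  obtains V where "openin M V" "x \<in> V" "V \<subseteq> N" "V \<subseteq> manifold_interior n M"
    "subtopology M V homeomorphic_space Euclidean_space n"
proof -
  obtain U where U: "openin M U" "x \<in> U" "subtopology M U homeomorphic_space Euclidean_space n"
    using assms(1) unfolding manifold_interior_def by blast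
  obtain \<phi> where "homeomorphic_map (Euclidean_space n) (subtopology M U) \<phi>"
    using U(3) homeomorphic_space_sym homeomorphic_space by blast
  then obtain V where V: "openin M V" "x \<in> V" "V \<subseteq> N" "subtopology M V homeomorphic_space Euclidean_space n"
    by (rule Euclidean_chart_small[OF _ U(1) assms(2,3) U(2)]) (rule that, assumption+)
  moreover have "V \<subseteq> manifold_interior n M"
    unfolding manifold_interior_def using V by blast
  ultimately show thesis by (intro that)
qed

lemma openin_manifold_interior: "openin M (manifold_interior n M)"
proof (subst openin_subopen, intro ballI)
  fix x assume "x \<in> manifold_interior n M"
  moreover then have "x \<in> topspace M"
    unfolding manifold_interior_def using openin_subset by blast
  ultimately obtain V where "openin M V" "x \<in> V" "V \<subseteq> manifold_interior n M"
    by (rule manifold_interior_small[OF _ openin_topspace]) (rule that, assumption+)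
  then show "\<exists>T. openin M T \<and> x \<in> T \<and> T \<subseteq> manifold_interior n M" by blast
qed

lemma manifold_interior_subset: "manifold_interior n M \<subseteq> topspace M"
  by (rule openin_subset[OF openin_manifold_interior])

lemma locally_Euclidean_manifold_interior:
  "locally_Euclidean n (subtopology M (manifold_interior n M))"
  unfolding locally_Euclidean_def
proof (intro allI impI)
  let ?I = "manifold_interior n M"
  fix N x assume "openin (subtopology M ?I) N" and x: "x \<in> N"
  then have N: "openin M N" "N \<subseteq> ?I"
    using openin_manifold_interior[of M n] openin_trans_full[of M ?I N] openin_imp_subset[of M ?I N] by blast+
  have xI: "x \<in> ?I" using N(2) x by blast
  obtain V where V: "openin M V" "x \<in> V" "V \<subseteq> N" "V \<subseteq> ?I"
    "subtopology M V homeomorphic_space Euclidean_space n"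
    by (rule manifold_interior_small[OF xI N(1) x])
  then show "\<exists>V. openin (subtopology M ?I) V \<and> x \<in> V \<and> V \<subseteq> N \<and>
      subtopology (subtopology M ?I) V homeomorphic_space Euclidean_space n"
    by (intro exI[of _ V]) (simp add: subtopology_subtopology inf.absorb2 subset_openin_subtopology)
qed

lemma topspace_half_space: "topspace (half_space n) = topspace (Euclidean_space n) \<inter> {x. x 0 \<ge> 0}"
  by (simp add: half_space_def)

text \<open>
  If a point of the wall \<open>w 0 = 0\<close> were interior, a Euclidean neighbourhood of it would correspond to a
  subset of the half-space that is open in \<open>\<real>\<^sup>n\<close> by invariance of domain. But an open set around a
  point of the wall leaves the half-space.
\<close>

lemma half_space_chart_interior:
  assumes \<phi>: "homeomorphic_map (half_space n) (subtopology M U) \<phi>" and U: "openin M U"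
    and n: "n > 0" and w: "w \<in> topspace (half_space n)"
  shows "\<phi> w \<in> manifold_interior n M \<longleftrightarrow> w 0 > 0"
proof
  assume w0: "w 0 > 0"
  have wE: "w \<in> topspace (Euclidean_space n)" using w by (simp add: topspace_half_space)
  have csub: "cube n w (w 0) \<subseteq> topspace (half_space n)"
    using n by (auto simp: cube_def topspace_half_space abs_less_iff)
  have "openin (half_space n) (cube n w (w 0))"
    using csub openin_cube unfolding half_space_def
    by (simp add: subset_openin_subtopology)
  then have "openin M (\<phi> ` cube n w (w 0))"
    by (rule homeomorphic_map_open_image[OF \<phi> U])
  moreover have "\<phi> w \<in> \<phi> ` cube n w (w 0)"
    using w0 wE by (auto simp: cube_def)
  moreover have "subtopology M (\<phi> ` cube n w (w 0)) homeomorphic_space Euclidean_space n"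
  proof -
    have "subtopology (half_space n) (cube n w (w 0)) homeomorphic_space subtopology M (\<phi> ` cube n w (w 0))"
      by (rule homeomorphic_map_image[OF \<phi> csub])
    moreover have "subtopology (half_space n) (cube n w (w 0)) = subtopology (Euclidean_space n) (cube n w (w 0))"
      using csub by (simp add: half_space_def subtopology_subtopology inf.absorb2)
    ultimately show ?thesis
      using cube_homeomorphic_Euclidean_space[OF w0] homeomorphic_space_sym homeomorphic_space_trans by metis
  qed
  ultimately show "\<phi> w \<in> manifold_interior n M"
    unfolding manifold_interior_def by blast
next
  assume int: "\<phi> w \<in> manifold_interior n M"
  have \<phi>U: "\<phi> ` topspace (half_space n) = U"
    using homeomorphic_imp_surjective_map[OF \<phi>] openin_subset[OF U] by auto
  then have wU: "\<phi> w \<in> U" using w by blast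
  obtain V where V: "openin M V" "\<phi> w \<in> V" "V \<subseteq> U" "subtopology M V homeomorphic_space Euclidean_space n"
    by (rule manifold_interior_small[OF int U wU]) (rule that, assumption+)
  let ?P = "{v \<in> topspace (half_space n). \<phi> v \<in> V}"
  have "\<phi> ` ?P = V" using V(3) \<phi>U by blast
  then have "subtopology (half_space n) ?P homeomorphic_space subtopology M V"
    using homeomorphic_map_image[OF \<phi>, of ?P] by auto
  then have "subtopology (half_space n) ?P homeomorphic_space Euclidean_space n"
    using V(4) homeomorphic_space_trans by blast
  moreover have "subtopology (half_space n) ?P = subtopology (Euclidean_space n) ?P"
  proof -
    have "{x. 0 \<le> x 0} \<inter> ?P = ?P" by (auto simp: topspace_half_space)
    then show ?thesis by (simp add: half_space_def subtopology_subtopology)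
  qed
  ultimately have PE: "subtopology (Euclidean_space n) ?P homeomorphic_space Euclidean_space n"
    by simp
  have "locally_embeds n (Euclidean_space n)"
    unfolding locally_embeds_def
    by (metis homeomorphic_space_refl openin_topspace)
  then have "openin (Euclidean_space n) ?P"
    by (rule openin_Euclidean_subspace[OF _ _ PE]) (auto simp: topspace_half_space)
  moreover have "w \<in> ?P" using w V(2) by blast
  ultimately obtain \<epsilon> where \<epsilon>: "\<epsilon> > 0" "cube n w \<epsilon> \<subseteq> ?P"
    by (rule cube_subset_open)
  \<comment> \<open>The point is pushed towards negative values of the first coordinate without leaving the cube.\<close>
  have "w(0 := w 0 - \<epsilon> / 2) \<in> cube n w \<epsilon>"
    using w \<epsilon>(1) n by (auto simp: cube_def topspace_half_space topspace_Euclidean_space)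
  then have "w 0 - \<epsilon> / 2 \<ge> 0"
    using \<epsilon>(2) by (auto simp: topspace_half_space)
  with \<epsilon>(1) show "w 0 > 0" by simp
qed

text \<open>
  A boundary point has no Euclidean chart, so its chart is a half-space. This forces \<open>n > 0\<close>, because
  the half-space of dimension 0 is the Euclidean space.
\<close>

lemma manifold_boundary_chart:
  assumes M: "topological_manifold n M" and y: "y \<in> manifold_boundary n M"
  obtains U \<phi> z where "n > 0" "openin M U" "homeomorphic_map (half_space n) (subtopology M U) \<phi>"
    "z \<in> topspace (half_space n)" "\<phi> z = y" "z 0 = 0"
proof -
  have yM: "y \<in> topspace M" "y \<notin> manifold_interior n M"
    using y by (auto simp: manifold_boundary_def)
  then obtain U where U: "openin M U" "y \<in> U"
    "subtopology M U homeomorphic_space Euclidean_space n \<or> subtopology M U homeomorphic_space half_space n"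
    using M unfolding topological_manifold_def by (metis UnionE)
  have notE: "\<not> subtopology M U homeomorphic_space Euclidean_space n"
    using yM(2) U(1,2) unfolding manifold_interior_def by blast
  then have UH: "half_space n homeomorphic_space subtopology M U"
    using U(3) homeomorphic_space_sym by blast
  have n: "n > 0"
  proof (rule ccontr)
    assume "\<not> n > 0"
    then have "topspace (Euclidean_space n) \<inter> {x. 0 \<le> x 0} = topspace (Euclidean_space n)"
      by (auto simp: topspace_Euclidean_space)
    then have "half_space n = Euclidean_space n"
      unfolding half_space_def by (metis subtopology_restrict subtopology_topspace)
    then have "Euclidean_space n homeomorphic_space subtopology M U" using UH by simp
    with notE show False using homeomorphic_space_sym by blast
  qed
  obtain \<phi> where \<phi>: "homeomorphic_map (half_space n) (subtopology M U) \<phi>"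
    using UH unfolding homeomorphic_space by blast
  have "y \<in> \<phi> ` topspace (half_space n)"
    using homeomorphic_imp_surjective_map[OF \<phi>] U(2) yM(1) by auto
  then obtain z where z: "z \<in> topspace (half_space n)" "\<phi> z = y" by blast
  moreover have "z 0 = 0"
    using half_space_chart_interior[OF \<phi> U(1) n z(1)] z yM(2) by (auto simp: topspace_half_space)
  ultimately show thesis using n U(1) \<phi> by (intro that)
qed

text \<open>
  These neighbourhoods are images of half-balls. The Euclidean interior part yields connectedness and
  the lifting properties near the boundary, and the other part shows that the boundary is itself
  locally Euclidean.
\<close>

lemma manifold_boundary_small:
  assumes M: "topological_manifold n M" and y: "y \<in> manifold_boundary n M" and N: "openin M N" "y \<in> N"
  obtains V where "openin M V" "y \<in> V" "V \<subseteq> N"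
    "subtopology M (V \<inter> manifold_interior n M) homeomorphic_space Euclidean_space n"
    "subtopology M (V \<inter> manifold_boundary n M) homeomorphic_space Euclidean_space (n - 1)"
proof -
  obtain U \<phi> z where n: "n > 0" and U: "openin M U"
    and \<phi>: "homeomorphic_map (half_space n) (subtopology M U) \<phi>"
    and z: "z \<in> topspace (half_space n)" "\<phi> z = y" "z 0 = 0"
    by (rule manifold_boundary_chart[OF M y])
  have "openin (half_space n) {w \<in> topspace (half_space n). \<phi> w \<in> N}"
    by (rule homeomorphic_map_open_preimage[OF \<phi> N(1)])
  then obtain T where T: "openin (Euclidean_space n) T"
    "{w \<in> topspace (half_space n). \<phi> w \<in> N} = T \<inter> {x. x 0 \<ge> 0}"
    unfolding half_space_def openin_subtopology by blast
  have "z \<in> T" using T(2) z N(2) by blast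
  then obtain \<epsilon> where \<epsilon>: "\<epsilon> > 0" "cube n z \<epsilon> \<subseteq> T"
    using cube_subset_open[OF T(1)] by blast
  define C where "C = cube n z \<epsilon> \<inter> {x. x 0 \<ge> 0}"
  have Csub: "C \<subseteq> topspace (half_space n)"
    by (auto simp: C_def cube_def topspace_half_space)
  have "openin (half_space n) C"
    unfolding C_def half_space_def openin_subtopology using openin_cube by blast
  then have "openin M (\<phi> ` C)"
    by (rule homeomorphic_map_open_image[OF \<phi> U])
  moreover have "y \<in> \<phi> ` C"
    using z \<epsilon>(1) by (auto simp: C_def cube_def topspace_half_space)
  moreover have "\<phi> ` C \<subseteq> N"
    using \<epsilon>(2) T(2) by (auto simp: C_def)
  moreover have int: "\<phi> w \<in> manifold_interior n M \<longleftrightarrow> w 0 > 0" if "w \<in> C" for w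
    using half_space_chart_interior[OF \<phi> U n] Csub that by blast
  have CM: "\<phi> ` C \<subseteq> topspace M"
    using \<open>openin M (\<phi> ` C)\<close> openin_subset by blast
  have sub: "subtopology (Euclidean_space n) S homeomorphic_space subtopology M (\<phi> ` S)" if "S \<subseteq> C" for S
  proof -
    have "subtopology (half_space n) S = subtopology (Euclidean_space n) S"
    proof -
      have "{x. 0 \<le> x 0} \<inter> S = S" using that by (auto simp: C_def)
      then show ?thesis by (simp add: half_space_def subtopology_subtopology)
    qed
    then show ?thesis
      using homeomorphic_map_image[OF \<phi>, of S] that Csub by auto
  qed
  have "\<phi> ` C \<inter> manifold_interior n M = \<phi> ` (cube n z \<epsilon> \<inter> {w. w 0 > 0})"
  proof -
    have "cube n z \<epsilon> \<inter> {w. w 0 > 0} = {w \<in> C. w 0 > 0}" by (auto simp: C_def)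
    then show ?thesis using int by auto
  qed
  moreover have "subtopology M (\<phi> ` (cube n z \<epsilon> \<inter> {w. w 0 > 0})) homeomorphic_space Euclidean_space n"
  proof (rule homeomorphic_space_trans)
    show "subtopology M (\<phi> ` (cube n z \<epsilon> \<inter> {w. w 0 > 0})) homeomorphic_space
        subtopology (Euclidean_space n) (cube n z \<epsilon> \<inter> {w. w 0 > 0})"
      by (rule homeomorphic_space_sym[THEN iffD1, OF sub]) (auto simp: C_def)
    show "subtopology (Euclidean_space n) (cube n z \<epsilon> \<inter> {w. w 0 > 0}) homeomorphic_space Euclidean_space n"
      using \<epsilon>(1) z(3) n by (rule cube_inside_homeomorphic_Euclidean_space)
  qed
  moreover have "\<phi> ` C \<inter> manifold_boundary n M = \<phi> ` (cube n z \<epsilon> \<inter> {w. w 0 = 0})"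
  proof -
    have "cube n z \<epsilon> \<inter> {w. w 0 = 0} = {w \<in> C. \<not> w 0 > 0}" by (auto simp: C_def)
    then show ?thesis using int CM unfolding manifold_boundary_def by auto
  qed
  moreover have "subtopology M (\<phi> ` (cube n z \<epsilon> \<inter> {w. w 0 = 0})) homeomorphic_space Euclidean_space (n - 1)"
  proof (rule homeomorphic_space_trans)
    show "subtopology M (\<phi> ` (cube n z \<epsilon> \<inter> {w. w 0 = 0})) homeomorphic_space
        subtopology (Euclidean_space n) (cube n z \<epsilon> \<inter> {w. w 0 = 0})"
      by (rule homeomorphic_space_sym[THEN iffD1, OF sub]) (auto simp: C_def)
    show "subtopology (Euclidean_space n) (cube n z \<epsilon> \<inter> {w. w 0 = 0}) homeomorphic_space Euclidean_space (n - 1)"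
      using \<epsilon>(1) z(3) n by (rule cube_face_homeomorphic_Euclidean_space)
  qed
  ultimately show thesis using that[of "\<phi> ` C"] by simp
qed

lemma locally_Euclidean_manifold_boundary:
  assumes M: "topological_manifold n M"
  shows "locally_Euclidean (n - 1) (subtopology M (manifold_boundary n M))"
  unfolding locally_Euclidean_def
proof (intro allI impI)
  let ?B = "manifold_boundary n M"
  fix N x assume "openin (subtopology M ?B) N" and x: "x \<in> N"
  then obtain N' where N': "openin M N'" "N = N' \<inter> ?B"
    unfolding openin_subtopology by blast
  then have xB: "x \<in> ?B" "x \<in> N'" using x by auto
  obtain V where V: "openin M V" "x \<in> V" "V \<subseteq> N'"
    "subtopology M (V \<inter> ?B) homeomorphic_space Euclidean_space (n - 1)"
    by (rule manifold_boundary_small[OF M xB(1) N'(1) xB(2)]) (rule that, assumption+)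
  have "openin (subtopology M ?B) (V \<inter> ?B)"
    using V(1) by (rule openin_subtopology_Int)
  then show "\<exists>V. openin (subtopology M ?B) V \<and> x \<in> V \<and> V \<subseteq> N \<and>
      subtopology (subtopology M ?B) V homeomorphic_space Euclidean_space (n - 1)"
    using V xB N' by (intro exI[of _ "V \<inter> ?B"]) (auto simp: subtopology_subtopology Int_left_commute Int_commute)
qed

lemma homeomorphic_Euclidean_space_connectedin:
  assumes "subtopology M S homeomorphic_space Euclidean_space n" "S \<subseteq> topspace M"
  shows "connectedin M S" "S \<noteq> {}"
proof -
  have "connected_space (subtopology M S)"
    using assms(1) connected_Euclidean_space homeomorphic_connected_space by blast
  with assms(2) show "connectedin M S" by (simp add: connectedin_def)
  have "subtopology M S \<noteq> trivial_topology"
    using homeomorphic_empty_space[OF assms(1)] nontrivial_Euclidean_space[of n] by simp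
  then show "S \<noteq> {}" by auto
qed

text \<open>
  The neighbourhoods constructed above for boundary points contain interior points, so the interior
  is dense.
\<close>

lemma manifold_boundary_closure_interior:
  assumes M: "topological_manifold n M" and N: "openin M N" "N \<noteq> {}"
  shows "N \<inter> manifold_interior n M \<noteq> {}"
proof (cases "N \<inter> manifold_boundary n M = {}")
  case True
  then show ?thesis using N openin_subset[OF N(1)] by (auto simp: manifold_boundary_def)
next
  case False
  then obtain y where y: "y \<in> N" "y \<in> manifold_boundary n M" by blast
  obtain V where V: "V \<subseteq> N" "subtopology M (V \<inter> manifold_interior n M) homeomorphic_space Euclidean_space n"
    by (rule manifold_boundary_small[OF M y(2) N(1) y(1)]) (rule that, assumption+)
  have "V \<inter> manifold_interior n M \<subseteq> topspace M"
    using manifold_interior_subset[of n M] by blast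
  from homeomorphic_Euclidean_space_connectedin(2)[OF V(2) this] V(1) show ?thesis by blast
qed

text \<open>
  If the interior split into two open pieces, their closures would cover the connected space \<open>M\<close> and
  hence have a common point. But every point has a neighbourhood whose interior part is connected and
  so cannot meet both pieces.
\<close>

lemma connectedin_manifold_interior:
  assumes M: "topological_manifold n M" and conn: "connected_space M"
  shows "connectedin M (manifold_interior n M)"
proof (rule ccontr)
  let ?I = "manifold_interior n M"
  assume "\<not> connectedin M ?I"
  then obtain P Q where PQ: "openin M P" "openin M Q" "?I \<subseteq> P \<union> Q" "P \<inter> Q \<inter> ?I = {}" "P \<inter> ?I \<noteq> {}" "Q \<inter> ?I \<noteq> {}"
    using manifold_interior_subset[of n M] unfolding connectedin by blast
  let ?P = "P \<inter> ?I" and ?Q = "Q \<inter> ?I"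
  have oPQ: "openin M ?P" "openin M ?Q" using PQ openin_manifold_interior[of M n] by blast+
  have "topspace M \<subseteq> M closure_of ?P \<union> M closure_of ?Q"
  proof
    fix y assume y: "y \<in> topspace M"
    show "y \<in> M closure_of ?P \<union> M closure_of ?Q"
    proof (rule ccontr)
      assume "\<not> ?thesis"
      then have "y \<notin> M closure_of (?P \<union> ?Q)" by simp
      then obtain N where N: "openin M N" "y \<in> N" "N \<inter> (?P \<union> ?Q) = {}"
        using y unfolding in_closure_of by blast
      then have "N \<inter> ?I = {}" using PQ(3) by blast
      then show False using manifold_boundary_closure_interior[OF M N(1)] N(2) by blast
    qed
  qed
  moreover have "?P \<subseteq> M closure_of ?P" "?Q \<subseteq> M closure_of ?Q"
    using closure_of_subset[OF openin_subset[OF oPQ(1)]] closure_of_subset[OF openin_subset[OF oPQ(2)]] by auto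
  then have "(M closure_of ?P) \<noteq> {}" "(M closure_of ?Q) \<noteq> {}"
    using PQ(5,6) by auto
  ultimately have "(M closure_of ?P) \<inter> (M closure_of ?Q) \<noteq> {}"
    using conn closedin_closure_of[of M ?P] closedin_closure_of[of M ?Q]
    unfolding connected_space_closedin by metis
  then obtain y where y: "y \<in> M closure_of ?P" "y \<in> M closure_of ?Q" by blast
  have yM: "y \<in> topspace M" using y(1) by (simp add: in_closure_of)
  have "\<exists>V. openin M V \<and> y \<in> V \<and> connectedin M (V \<inter> ?I)"
  proof (cases "y \<in> ?I")
    case True
    then obtain V where V: "openin M V" "y \<in> V" "V \<subseteq> ?I" "subtopology M V homeomorphic_space Euclidean_space n"
      by (rule manifold_interior_small[OF _ openin_topspace yM]) (rule that, assumption+)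
    then have "connectedin M V"
      using homeomorphic_Euclidean_space_connectedin(1) openin_subset by blast
    with V show ?thesis by (metis inf.absorb1)
  next
    case False
    then have "y \<in> manifold_boundary n M" using yM by (simp add: manifold_boundary_def)
    then obtain V where V: "openin M V" "y \<in> V" "subtopology M (V \<inter> ?I) homeomorphic_space Euclidean_space n"
      by (rule manifold_boundary_small[OF M _ openin_topspace yM]) (rule that, assumption+)
    then have "connectedin M (V \<inter> ?I)"
      using homeomorphic_Euclidean_space_connectedin(1) manifold_interior_subset[of n M] by blast
    with V show ?thesis by blast
  qed
  then obtain V where V: "openin M V" "y \<in> V" "connectedin M (V \<inter> ?I)" by blast
  have "V \<inter> ?P \<noteq> {}" "V \<inter> ?Q \<noteq> {}"
    using y V(1,2) unfolding in_closure_of by blast+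
  then show False
    using V(3) PQ(1-4) unfolding connectedin by blast
qed

section \<open>Counting the points of a fibre\<close>

lemma local_homeomorphism_restrict:
  assumes lh: "local_homeomorphism E B p" and U: "openin E U" and VB: "p ` U \<subseteq> V"
  shows "local_homeomorphism (subtopology E U) (subtopology B V) p"
  unfolding local_homeomorphism_def
proof
  fix e assume "e \<in> topspace (subtopology E U)"
  then have eU: "e \<in> U" by simp
  obtain W where W: "openin E W" "e \<in> W" "W \<subseteq> U" "openin B (p ` W)"
    "homeomorphic_map (subtopology E W) (subtopology B (p ` W)) p"
    by (rule local_homeomorphism_small[OF lh U eU])
  have pV: "p ` W \<subseteq> V" using W(3) VB by blast
  have "openin (subtopology E U) W" "openin (subtopology B V) (p ` W)"
    using W(1,3,4) pV by (simp_all add: subset_openin_subtopology)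
  moreover have "homeomorphic_map (subtopology (subtopology E U) W) (subtopology (subtopology B V) (p ` W)) p"
    using W(3,5) pV by (simp add: subtopology_subtopology inf.absorb2)
  ultimately show "\<exists>W. openin (subtopology E U) W \<and> e \<in> W \<and> openin (subtopology B V) (p ` W) \<and>
      homeomorphic_map (subtopology (subtopology E U) W) (subtopology (subtopology B V) (p ` W)) p"
    using W(2) by blast
qed

text \<open>
  The points with exactly one preimage form an open set, because \<open>p\<close> is closed and locally injective,
  and so do the points with several preimages, because \<open>p\<close> is open. By connectedness the first set
  is everything.
\<close>

lemma local_homeomorphism_inj_from_one_fibre:
  assumes lh: "local_homeomorphism E B p" and pr: "proper_map E B p"
    and E: "Hausdorff_space E" and B: "connected_space B" and onto: "p ` topspace E = topspace B"
    and v: "v \<in> topspace B" "\<exists>!e. e \<in> topspace E \<and> p e = v"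
  shows "inj_on p (topspace E)"
proof -
  let ?S = "{w \<in> topspace B. \<exists>!e. e \<in> topspace E \<and> p e = w}"
  have op: "open_map E B p" by (rule local_homeomorphism_imp_open_map[OF lh])
  have "openin B ?S"
  proof (subst openin_subopen, intro ballI)
    fix w assume w: "w \<in> ?S"
    then obtain e where e: "e \<in> topspace E" "p e = w" "\<And>e'. e' \<in> topspace E \<Longrightarrow> p e' = w \<Longrightarrow> e' = e"
      by blast
    obtain U where U: "openin E U" "e \<in> U" "openin B (p ` U)"
      "homeomorphic_map (subtopology E U) (subtopology B (p ` U)) p"
      using lh e(1) unfolding local_homeomorphism_def by blast
    have UE: "U \<subseteq> topspace E" using U(1) by (rule openin_subset)
    have inj: "inj_on p U"
      using homeomorphic_imp_injective_map[OF U(4)] UE by (simp add: inf.absorb2)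
    let ?T = "p ` U - p ` (topspace E - U)"
    have "closedin B (p ` (topspace E - U))"
      using pr openin_closedin_eq[of E U] U(1) closedin_topspace[of E]
      by (auto simp: proper_map_def closed_map_def intro: closedin_diff)
    then have "openin B ?T" using U(3) by blast
    moreover have "w \<in> ?T" using e U(2) by blast
    moreover have "?T \<subseteq> ?S"
    proof
      fix w' assume w': "w' \<in> ?T"
      then obtain u where u: "u \<in> U" "p u = w'" by blast
      have "u' = u" if "u' \<in> topspace E" "p u' = w'" for u'
      proof -
        have "u' \<in> U" using that w' by blast
        then show ?thesis using inj u that by (auto simp: inj_on_def)
      qed
      moreover have "w' \<in> topspace B" using w' openin_subset[OF U(3)] by blast
      ultimately show "w' \<in> ?S" using u UE by blast
    qed
    ultimately show "\<exists>T. openin B T \<and> w \<in> T \<and> T \<subseteq> ?S" by blast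
  qed
  moreover have "openin B (topspace B - ?S)"
  proof (subst openin_subopen, intro ballI)
    fix w assume w: "w \<in> topspace B - ?S"
    then have "w \<in> p ` topspace E" unfolding onto by simp
    then obtain e where e1: "e \<in> topspace E" "p e = w" by (elim imageE) simp
    moreover have "\<not> (\<exists>!e. e \<in> topspace E \<and> p e = w)" using w by simp
    ultimately obtain e' where "e' \<in> topspace E" "p e' = w" "e \<noteq> e'" by metis
    note e = e1(1) this(1) e1(2) this(2,3)
    obtain N N' where N: "openin E N" "openin E N'" "e \<in> N" "e' \<in> N'" "disjnt N N'"
      using E e unfolding Hausdorff_space_def by metis
    have "openin B (p ` N \<inter> p ` N')"
      using op N(1,2) by (simp add: open_map_def openin_Int)
    moreover have "w \<in> p ` N \<inter> p ` N'"
      using imageI[OF N(3), of p] imageI[OF N(4), of p] e(3,4) by simp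
    moreover have "p ` N \<inter> p ` N' \<subseteq> topspace B - ?S"
    proof
      fix w' assume "w' \<in> p ` N \<inter> p ` N'"
      then have "w' \<in> p ` N" "w' \<in> p ` N'" by simp_all
      then obtain u u' where u: "u \<in> N" "u' \<in> N'" "p u = w'" "p u' = w'" by (metis imageE)
      then have "u \<noteq> u'" using N(5) by (auto simp: disjnt_iff)
      moreover have uE: "u \<in> topspace E" "u' \<in> topspace E"
        using u(1,2) openin_subset[OF N(1)] openin_subset[OF N(2)] by auto
      ultimately have "w' \<notin> ?S" using u(3,4) by auto
      moreover have "w' \<in> topspace B" using uE(1) u(3) onto by blast
      ultimately show "w' \<in> topspace B - ?S" by blast
    qed
    ultimately show "\<exists>T. openin B T \<and> w \<in> T \<and> T \<subseteq> topspace B - ?S" by blast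
  qed
  then have "closedin B ?S" by (simp add: closedin_def)
  ultimately have "?S = {} \<or> ?S = topspace B"
    using B unfolding connected_space_clopen_in by blast
  then have S: "?S = topspace B" using v by blast
  show ?thesis
  proof (rule inj_onI)
    fix e e' assume e: "e \<in> topspace E" "e' \<in> topspace E" "p e = p e'"
    have "p e \<in> ?S" unfolding S using e(1) onto by blast
    then have "\<exists>!d. d \<in> topspace E \<and> p d = p e" by simp
    then show "e = e'" using e by metis
  qed
qed

text \<open>
  The straight contraction of \<open>\<real>\<^sup>n\<close> to the point below \<open>e\<close>, run backwards, is lifted with constant
  initial value \<open>e\<close>; its final stage is a section. A contraction that keeps the centre fixed is needed to
  make the section pass through \<open>e\<close> itself: the lift of the constant path is constant.
\<close>

lemma covering_section_over_Euclidean: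
  assumes cov: "covering_map E B p" and E: "Hausdorff_space E"
    and V: "V \<subseteq> topspace B" "subtopology B V homeomorphic_space Euclidean_space n"
    and e: "e \<in> topspace E" "p e \<in> V"
  obtains s where "continuous_map (subtopology B V) E s" "\<And>v. v \<in> V \<Longrightarrow> p (s v) = v" "s (p e) = e"
proof -
  let ?V = "subtopology B V"
  have tV: "topspace ?V = V" using V(1) by auto
  obtain \<psi> \<theta> where hm: "homeomorphic_maps ?V (Euclidean_space n) \<psi> \<theta>"
    using V(2) unfolding homeomorphic_space_def by blast
  then have \<psi>: "continuous_map ?V (Euclidean_space n) \<psi>" and \<theta>: "continuous_map (Euclidean_space n) ?V \<theta>"
    and inv: "\<And>v. v \<in> V \<Longrightarrow> \<theta> (\<psi> v) = v"
    unfolding homeomorphic_maps_def tV by blast+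
  define c where "c = \<psi> (p e)"
  have \<psi>E: "\<psi> v \<in> topspace (Euclidean_space n)" if "v \<in> V" for v
    using \<psi> that unfolding continuous_map_def tV by blast
  define k where "k = (\<lambda>z i. (1 - snd z) * c i + snd z * \<psi> (fst z) i)"
  have coord: "continuous_map (prod_topology ?V I01) euclideanreal (\<lambda>z. \<psi> (fst z) i)" for i
  proof -
    have "continuous_map (prod_topology ?V I01) (Euclidean_space n) (\<psi> \<circ> fst)"
      by (rule continuous_map_compose[OF continuous_map_fst \<psi>])
    from continuous_map_compose[OF this continuous_map_Euclidean_coordinate[of n i]]
    show ?thesis by (simp add: o_def)
  qed
  have time: "continuous_map (prod_topology ?V I01) euclideanreal snd"
    using continuous_map_snd[of ?V I01] by (simp add: continuous_map_in_subtopology)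
  have "continuous_map (prod_topology ?V I01) (Euclidean_space n) k"
    unfolding Euclidean_space_def continuous_map_in_subtopology continuous_map_componentwise_UNIV k_def
  proof (intro conjI allI)
    show "continuous_map (prod_topology ?V I01) euclideanreal (\<lambda>z. (1 - snd z) * c i + snd z * \<psi> (fst z) i)" for i
      by (intro continuous_map_add continuous_map_real_mult continuous_map_diff coord time) auto
    show "(\<lambda>z i. (1 - snd z) * c i + snd z * \<psi> (fst z) i) \<in> topspace (prod_topology ?V I01) \<rightarrow> {x. \<forall>i\<ge>n. x i = 0}"
      using \<psi>E \<psi>E[OF e(2)] by (auto simp: c_def topspace_Euclidean_space)
  qed
  from continuous_map_compose[OF this \<theta>]
  have h: "continuous_map (prod_topology ?V I01) B (\<theta> \<circ> k)"
    by (simp add: continuous_map_in_subtopology)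
  have "continuous_map ?V E (\<lambda>v. e)" using e(1) by simp
  moreover have "p e = (\<theta> \<circ> k) (v, 0)" for v
    using inv[OF e(2)] by (simp add: k_def c_def)
  ultimately obtain F where F: "continuous_map (prod_topology ?V I01) E F"
    "\<And>v t. \<lbrakk>v \<in> topspace ?V; t \<in> {0..1}\<rbrakk> \<Longrightarrow> p (F (v, t)) = (\<theta> \<circ> k) (v, t)"
    "\<And>v. v \<in> topspace ?V \<Longrightarrow> F (v, 0) = e"
    by (rule covering_lift_homotopy[OF cov E h]) (rule that, assumption+)
  have row: "continuous_map I01 E (\<lambda>t. F (v, t))" if "v \<in> V" for v
  proof -
    have "continuous_map I01 (prod_topology ?V I01) (\<lambda>t. (v, t))"
      using that tV by (intro continuous_map_pairedI) auto
    from continuous_map_compose[OF this F(1)] show ?thesis by (simp add: o_def)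
  qed
  have "continuous_map ?V (prod_topology ?V I01) (\<lambda>v. (v, 1))"
    by (intro continuous_map_pairedI) auto
  from continuous_map_compose[OF this F(1)]
  have "continuous_map ?V E (\<lambda>v. F (v, 1))" by (simp add: o_def)
  moreover have "p (F (v, 1)) = v" if "v \<in> V" for v
    using F(2)[of v 1] that V(1) inv[OF that] by (auto simp: k_def)
  moreover have "F (p e, 1) = e"
  proof (rule covering_lift_unique[OF cov E connected_space_I01 row[OF e(2)], where h="\<lambda>t. e" and b=0])
    fix t assume t: "t \<in> topspace I01"
    have "k (p e, t) = c" by (auto simp: k_def c_def algebra_simps)
    then show "p (F (p e, t)) = p e"
      using F(2)[of "p e" t] t V(1) e(2) inv[OF e(2)] by (auto simp: c_def)
  qed (use F(3)[of "p e"] e V(1) in auto)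
  ultimately show thesis by (rule that)
qed

lemma top_immersion_into_subspace:
  assumes "top_immersion A B f" "f ` topspace A \<subseteq> S"
  shows "top_immersion A (subtopology B S) f"
  unfolding top_immersion_def
proof (intro conjI ballI)
  show "continuous_map A (subtopology B S) f"
    using assms by (auto simp: top_immersion_def continuous_map_in_subtopology)
  fix a assume "a \<in> topspace A"
  then obtain U where U: "openin A U" "a \<in> U" "homeomorphic_map (subtopology A U) (subtopology B (f ` U)) f"
    using assms(1) unfolding top_immersion_def by blast
  have "f ` U \<subseteq> S" using assms(2) openin_subset[OF U(1)] by blast
  then have "subtopology (subtopology B S) (f ` U) = subtopology B (f ` U)"
    by (simp add: subtopology_subtopology inf.absorb2)
  with U show "\<exists>U. openin A U \<and> a \<in> U \<and> homeomorphic_map (subtopology A U) (subtopology (subtopology B S) (f ` U)) f"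
    by metis
qed

text \<open>
  An immersion maps a small Euclidean piece around \<open>a\<close> homeomorphically onto a copy of \<open>\<real>\<^sup>n\<close>, which is
  open by invariance of domain.
\<close>

lemma immersion_chart:
  assumes imm: "top_immersion A B f" and A: "locally_Euclidean n A" and B: "locally_embeds n B"
    and a: "a \<in> topspace A"
  obtains V where "openin A V" "a \<in> V" "openin B (f ` V)"
    "homeomorphic_map (subtopology A V) (subtopology B (f ` V)) f"
    "subtopology B (f ` V) homeomorphic_space Euclidean_space n"
proof -
  obtain U where U: "openin A U" "a \<in> U" "homeomorphic_map (subtopology A U) (subtopology B (f ` U)) f"
    using imm a unfolding top_immersion_def by blast
  obtain V where V: "openin A V" "a \<in> V" "V \<subseteq> U" "subtopology A V homeomorphic_space Euclidean_space n"
    using A U(1,2) unfolding locally_Euclidean_def by blast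
  have VA: "V \<subseteq> topspace (subtopology A U)"
    using V(3) openin_subset[OF U(1)] by auto
  have fV: "f ` V \<subseteq> topspace B"
    using imm openin_subset[OF V(1)] unfolding top_immersion_def continuous_map_def by blast
  have AV: "subtopology (subtopology A U) V = subtopology A V"
    using V(3) by (simp add: subtopology_subtopology inf.absorb2)
  have BV: "subtopology (subtopology B (f ` U)) (f ` V) = subtopology B (f ` V)"
    using V(3) by (simp add: subtopology_subtopology inf.absorb2 image_mono)
  have "homeomorphic_map (subtopology (subtopology A U) V) (subtopology (subtopology B (f ` U)) (f ` V)) f"
    by (rule homeomorphic_map_subtopologies[OF U(3)]) (use VA fV V(3) in auto)
  then have hom: "homeomorphic_map (subtopology A V) (subtopology B (f ` V)) f"
    unfolding AV BV .
  then have "subtopology A V homeomorphic_space subtopology B (f ` V)"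
    by (rule homeomorphic_map_imp_homeomorphic_space)
  then have BE: "subtopology B (f ` V) homeomorphic_space Euclidean_space n"
    using V(4) homeomorphic_space_sym homeomorphic_space_trans by blast
  have "openin B (f ` V)"
    by (rule openin_Euclidean_subspace[OF B fV BE])
  with V(1,2) show thesis using hom BE by (rule that)
qed

lemma immersion_imp_local_homeomorphism:
  assumes imm: "top_immersion A B f" and A: "locally_Euclidean n A" and B: "locally_embeds n B"
  shows "local_homeomorphism A B f"
  unfolding local_homeomorphism_def
proof
  fix a assume a: "a \<in> topspace A"
  obtain V where "openin A V" "a \<in> V" "openin B (f ` V)"
    "homeomorphic_map (subtopology A V) (subtopology B (f ` V)) f"
    by (rule immersion_chart[OF imm A B a]) (rule that, assumption+)
  then show "\<exists>U. openin A U \<and> a \<in> U \<and> openin B (f ` U) \<and>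
        homeomorphic_map (subtopology A U) (subtopology B (f ` U)) f" by blast
qed

lemma locally_Euclidean_imp_locally_path_connected:
  assumes M: "locally_Euclidean n M"
  shows "locally_path_connected_space M"
  unfolding locally_path_connected_space_def neighbourhood_base_of_def neighbourhood_base_at_def
proof (intro ballI allI impI)
  fix x W assume W: "openin M W \<and> x \<in> W"
  then obtain V where V: "openin M V" "x \<in> V" "V \<subseteq> W" "subtopology M V homeomorphic_space Euclidean_space n"
    using M unfolding locally_Euclidean_def by blast
  have "path_connected_space (subtopology M V)"
    using homeomorphic_path_connected_space[OF V(4)] path_connected_Euclidean_space by blast
  then have "path_connectedin M V"
    using openin_subset[OF V(1)] by (simp add: path_connectedin_def)
  with V show "\<exists>U V. openin M U \<and> path_connectedin M V \<and> x \<in> U \<and> U \<subseteq> V \<and> V \<subseteq> W" by blast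
qed

section \<open>Maps that are immersions on the interior and on the boundary\<close>

locale boundary_immersion =
  fixes n :: nat and X :: "'a topology" and Y :: "'b topology" and f :: "'a \<Rightarrow> 'b"
  assumes X: "topological_manifold n X" "connected_space X" "compact_space X"
    and Y: "topological_manifold n Y" "connected_space Y"
    and cont: "continuous_map X Y f"
    and boundary: "f ` manifold_boundary n X \<subseteq> manifold_boundary n Y"
    and imm_boundary: "top_immersion (subtopology X (manifold_boundary n X)) Y f"
    and imm_interior: "top_immersion (subtopology X (topspace X - manifold_boundary n X)) Y f"
    and nonempty: "manifold_boundary n X \<noteq> {}"
begin

abbreviation "intX \<equiv> manifold_interior n X"
abbreviation "intY \<equiv> manifold_interior n Y"
abbreviation "bdX \<equiv> manifold_boundary n X"
abbreviation "bdY \<equiv> manifold_boundary n Y"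
abbreviation "subX \<equiv> subtopology X"
abbreviation "subY \<equiv> subtopology Y"

lemma Hausdorff: "Hausdorff_space X" "Hausdorff_space Y"
  using X(1) Y(1) by (simp_all add: topological_manifold_def)

lemma decomposition:
  "topspace X - bdX = intX" "bdX \<subseteq> topspace X" "bdY \<subseteq> topspace Y" "intX \<subseteq> topspace X" "intY \<subseteq> topspace Y"
  "bdX \<inter> intX = {}" "bdY \<inter> intY = {}"
  using manifold_interior_subset[of n X] manifold_interior_subset[of n Y] by (auto simp: manifold_boundary_def)

lemma topspaces: "topspace (subX intX) = intX" "topspace (subY intY) = intY"
    "topspace (subX bdX) = bdX" "topspace (subY bdY) = bdY"
  using decomposition by auto

lemma image_interior: "x \<in> intX \<Longrightarrow> f x \<in> intY"
proof -
  assume x: "x \<in> intX"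
  have imm: "top_immersion (subX intX) Y f"
    using imm_interior unfolding decomposition(1) .
  have xi: "x \<in> topspace (subX intX)" using x unfolding topspaces .
  obtain V where V: "x \<in> V" "openin Y (f ` V)" "subY (f ` V) homeomorphic_space Euclidean_space n"
    by (rule immersion_chart[OF imm locally_Euclidean_manifold_interior
      topological_manifold_locally_embeds[OF Y(1)] xi]) (rule that, assumption+)
  then show "f x \<in> intY" unfolding manifold_interior_def by blast
qed

lemma vimages:
  assumes "x \<in> topspace X"
  shows "f x \<in> intY \<longleftrightarrow> x \<in> intX" "f x \<in> bdY \<longleftrightarrow> x \<in> bdX"
proof -
  from assms consider "x \<in> intX" "f x \<in> intY" | "x \<in> bdX" "f x \<in> bdY"
    using decomposition(1) image_interior boundary by blast
  then show "f x \<in> intY \<longleftrightarrow> x \<in> intX" "f x \<in> bdY \<longleftrightarrow> x \<in> bdX"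
    using decomposition(6,7) by (cases; blast)+
qed

lemma interior_local_homeomorphism: "local_homeomorphism (subX intX) (subY intY) f"
proof -
  have "top_immersion (subX intX) Y f"
    using imm_interior unfolding decomposition(1) .
  from immersion_imp_local_homeomorphism[OF this locally_Euclidean_manifold_interior
      topological_manifold_locally_embeds[OF Y(1)]]
  have "local_homeomorphism (subX intX) Y f" .
  moreover have "openin (subX intX) intX" using openin_topspace[of "subX intX"] unfolding topspaces .
  moreover have "f ` intX \<subseteq> intY" using image_interior by blast
  ultimately have "local_homeomorphism (subtopology (subX intX) intX) (subY intY) f"
    by (rule local_homeomorphism_restrict)
  then show ?thesis by (simp add: subtopology_subtopology)
qed

lemma boundary_local_homeomorphism: "local_homeomorphism (subX bdX) (subY bdY) f"
proof -
  have "top_immersion (subX bdX) (subY bdY) f"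
    by (rule top_immersion_into_subspace[OF imm_boundary]) (use boundary in \<open>simp only: topspaces\<close>)
  then show ?thesis
    by (rule immersion_imp_local_homeomorphism[OF _ locally_Euclidean_manifold_boundary[OF X(1)]
      locally_Euclidean_imp_locally_embeds[OF locally_Euclidean_manifold_boundary[OF Y(1)]]])
qed

lemma proper: "proper_map X Y f"
  by (rule continuous_imp_proper_map[OF X(3) Hausdorff_imp_kc_space[OF Hausdorff(2)] cont])

lemma closed: "closed_map X Y f"
  using proper by (simp add: proper_map_def)

lemma proper_interior: "proper_map (subX intX) (subY intY) f"
  by (rule proper_map_restriction[OF proper]) (use vimages decomposition in blast)

lemma proper_boundary: "proper_map (subX bdX) (subY bdY) f"
  by (rule proper_map_restriction[OF proper]) (use vimages decomposition in blast)

lemma interior_covering: "covering_map (subX intX) (subY intY) f"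
  by (rule proper_local_homeomorphism_imp_covering_map[OF interior_local_homeomorphism proper_interior])

lemma connected_interior: "connected_space (subY intY)"
  using connectedin_manifold_interior[OF Y] by (simp add: connectedin_def)

text \<open>
  The image of the interior is open because \<open>f\<close> is a local homeomorphism there, and closed because
  \<open>f\<close> is proper; and the interior of \<open>Y\<close> is connected.
\<close>

lemma interior_onto: "f ` intX = intY"
proof -
  have "openin (subY intY) (f ` topspace (subX intX))"
    using local_homeomorphism_imp_open_map[OF interior_local_homeomorphism] openin_topspace
    unfolding open_map_def by blast
  moreover have "closedin (subY intY) (f ` topspace (subX intX))"
    using proper_imp_closed_map[OF proper_interior] closedin_topspace
    unfolding closed_map_def by blast
  moreover have "intX \<noteq> {}"
    using manifold_boundary_closure_interior[OF X(1) openin_topspace] nonempty decomposition(2) by blast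
  ultimately show ?thesis
    using connected_interior unfolding connected_space_clopen_in topspaces by blast
qed

lemma onto: "f ` topspace X = topspace Y"
proof
  show "f ` topspace X \<subseteq> topspace Y" using cont by (auto simp: continuous_map_def)
  show "topspace Y \<subseteq> f ` topspace X"
  proof (rule ccontr)
    assume "\<not> ?thesis"
    moreover have "closedin Y (f ` topspace X)"
      using closed closedin_topspace unfolding closed_map_def by blast
    ultimately have "openin Y (topspace Y - f ` topspace X)" "topspace Y - f ` topspace X \<noteq> {}"
      by (auto simp: openin_diff)
    from manifold_boundary_closure_interior[OF Y(1) this]
    show False unfolding interior_onto[symmetric] using decomposition(4) by blast
  qed
qed

lemma boundary_onto: "f ` bdX = bdY"
proof
  show "bdY \<subseteq> f ` bdX"
  proof
    fix y assume y: "y \<in> bdY"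
    then have "y \<in> f ` topspace X" unfolding onto using decomposition(3) by blast
    then obtain x where "x \<in> topspace X" "y = f x" by (elim imageE)
    with y vimages(2) show "y \<in> f ` bdX" by blast
  qed
qed (rule boundary)

text \<open>
  Near the boundary point \<open>y\<close> the interior of \<open>Y\<close> is a copy \<open>V \<inter> intY\<close> of \<open>\<real>\<^sup>n\<close>, so a section of
  \<open>f\<close> over it passes through every point above it. The map \<open>f\<close> is closed, hence the closure of the image of each section
  contains a point of the fibre over \<open>y\<close>, and this can only be \<open>x0\<close>. But the interior near \<open>x0\<close> is
  connected, and a connected set over \<open>V \<inter> intY\<close> that meets the image of a section is contained in it.
  So all sections coincide near \<open>x0\<close>, hence everywhere. The points of \<open>V \<inter> intY\<close> therefore have one
  preimage each, and one such point suffices.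
\<close>

lemma interior_inj:
  assumes y: "y \<in> bdY" and fibre: "{x \<in> topspace X. f x = y} = {x0}"
  shows "inj_on f intX"
proof -
  have x0: "x0 \<in> topspace X" "f x0 = y" using fibre by auto
  then have x0b: "x0 \<in> bdX" using y vimages(2) by blast
  have yY: "y \<in> topspace Y" using y decomposition(3) by blast
  obtain V where V: "openin Y V" "y \<in> V" "subY (V \<inter> intY) homeomorphic_space Euclidean_space n"
    by (rule manifold_boundary_small[OF Y(1) y openin_topspace yY]) (rule that, assumption+)
  have "openin X {x \<in> topspace X. f x \<in> V}"
    by (rule openin_continuous_map_preimage[OF cont V(1)])
  moreover have "x0 \<in> {x \<in> topspace X. f x \<in> V}" using x0 V(2) by blast
  ultimately obtain D where D: "openin X D" "x0 \<in> D" "D \<subseteq> {x \<in> topspace X. f x \<in> V}"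
    "subX (D \<inter> intX) homeomorphic_space Euclidean_space n"
    by (rule manifold_boundary_small[OF X(1) x0b]) (rule that, assumption+)
  have V_sub: "V \<inter> intY \<subseteq> topspace (subY intY)" "V \<inter> intY \<subseteq> topspace Y" using decomposition(5) by auto
  have VE: "subtopology (subY intY) (V \<inter> intY) homeomorphic_space Euclidean_space n"
    using V(3) by (simp add: subtopology_subtopology Int_commute Int_left_commute)
  have D_conn: "connected_space (subtopology (subX intX) (D \<inter> intX))"
    using D(4) homeomorphic_connected_space connected_Euclidean_space
    by (fastforce simp: subtopology_subtopology Int_commute Int_left_commute)
  have V_conn: "connected_space (subtopology (subY intY) (V \<inter> intY))"
    using homeomorphic_connected_space[OF VE] connected_Euclidean_space by blast
  have H: "Hausdorff_space (subX intX)" by (rule Hausdorff_space_subtopology[OF Hausdorff(1)])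
  have cont_int: "continuous_map (subX intX) (subY intY) f"
    using interior_covering by (simp add: covering_map_def)
  have V_ne: "V \<inter> intY \<noteq> {}"
    using homeomorphic_Euclidean_space_connectedin(2)[OF V(3) V_sub(2)] .
  have y_cl: "y \<in> Y closure_of (V \<inter> intY)"
    unfolding in_closure_of
  proof (intro conjI allI impI yY)
    fix T assume T: "y \<in> T \<and> openin Y T"
    then have "openin Y (T \<inter> V)" "T \<inter> V \<noteq> {}" using V(1,2) by blast+
    from manifold_boundary_closure_interior[OF Y(1) this]
    show "\<exists>z. z \<in> V \<inter> intY \<and> z \<in> T" by blast
  qed
  \<comment> \<open>Through every point \<open>e\<close> over \<open>V \<inter> intY\<close> there is a section whose image contains the interior near \<open>x0\<close>.\<close>
  have sec: "\<exists>s. continuous_map (subtopology (subY intY) (V \<inter> intY)) (subX intX) s \<and>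
      (\<forall>v\<in>V \<inter> intY. f (s v) = v) \<and> s (f e) = e \<and> (\<forall>d\<in>D \<inter> intX. s (f d) = d)"
    if e: "e \<in> intX" "f e \<in> V" for e
  proof -
    have e': "e \<in> topspace (subX intX)" "f e \<in> V \<inter> intY"
      using e image_interior topspaces by auto
    obtain s where s: "continuous_map (subtopology (subY intY) (V \<inter> intY)) (subX intX) s"
      "\<And>v. v \<in> V \<inter> intY \<Longrightarrow> f (s v) = v" "s (f e) = e"
      by (rule covering_section_over_Euclidean[OF interior_covering H V_sub(1) VE e']) blast
    have s_int: "s v \<in> intX" if "v \<in> V \<inter> intY" for v
      using continuous_map_image_subset_topspace[OF s(1)] that V_sub(1) topspaces by auto
    have "V \<inter> intY \<subseteq> f ` (X closure_of (s ` (V \<inter> intY)))"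
    proof
      fix v assume v: "v \<in> V \<inter> intY"
      have "s ` (V \<inter> intY) \<subseteq> topspace X" using s_int decomposition(4) by blast
      then have "s v \<in> X closure_of (s ` (V \<inter> intY))"
        using closure_of_subset[of "s ` (V \<inter> intY)" X] v by blast
      then show "v \<in> f ` (X closure_of (s ` (V \<inter> intY)))"
        using s(2)[OF v] by (metis imageI)
    qed
    moreover have "closedin Y (f ` (X closure_of (s ` (V \<inter> intY))))"
      using closed closedin_closure_of unfolding closed_map_def by blast
    ultimately have "Y closure_of (V \<inter> intY) \<subseteq> f ` (X closure_of (s ` (V \<inter> intY)))"
      by (rule closure_of_minimal)
    then obtain x where x: "x \<in> X closure_of (s ` (V \<inter> intY))" "f x = y"
      using y_cl by blast
    then have "x \<in> {x \<in> topspace X. f x = y}" by (simp add: in_closure_of)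
    then have "x = x0" unfolding fibre by simp
    then obtain d where d: "d \<in> D" "d \<in> s ` (V \<inter> intY)"
      using x(1) D(1,2) unfolding in_closure_of by blast
    then obtain v where v: "v \<in> V \<inter> intY" "d = s v" by blast
    have dI: "d \<in> intX" using s_int v by blast
    have "s (f c) = c" if c: "c \<in> D \<inter> intX" for c
    proof (rule covering_lift_unique[OF interior_covering H D_conn, where g="\<lambda>x. s (f x)" and h="\<lambda>x. x" and b=d])
      have fD: "f x \<in> V \<inter> intY" if "x \<in> D \<inter> intX" for x
        using that D(3) image_interior by blast
      have "continuous_map (subtopology (subX intX) (D \<inter> intX)) (subtopology (subY intY) (V \<inter> intY)) f"
        unfolding continuous_map_in_subtopology[of _ _ "V \<inter> intY"]
        using fD continuous_map_from_subtopology[OF cont_int] by auto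
      from continuous_map_compose[OF this s(1)]
      show "continuous_map (subtopology (subX intX) (D \<inter> intX)) (subX intX) (\<lambda>x. s (f x))"
        by (simp add: o_def)
      show "continuous_map (subtopology (subX intX) (D \<inter> intX)) (subX intX) (\<lambda>x. x)"
        using continuous_map_from_subtopology[OF continuous_map_id, of "subX intX"] by (simp add: id_def)
      show "f (s (f x)) = f x" if "x \<in> topspace (subtopology (subX intX) (D \<inter> intX))" for x
        using that fD s(2) by simp
      show "d \<in> topspace (subtopology (subX intX) (D \<inter> intX))" "c \<in> topspace (subtopology (subX intX) (D \<inter> intX))"
        using d(1) dI c decomposition(4) by auto
      show "s (f d) = d" using v s(2)[OF v(1)] by simp
    qed
    with s show ?thesis by blast
  qed
  have D_ne: "D \<inter> intX \<noteq> {}"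
    using manifold_boundary_closure_interior[OF X(1) D(1)] D(2) by blast
  then obtain d where d: "d \<in> D \<inter> intX" by blast
  have fd: "f d \<in> V \<inter> intY" using d D(3) image_interior by blast
  have fibre_unique: "p = q" if pq: "p \<in> intX" "q \<in> intX" "f p = f q" "f p \<in> V" for p q
  proof -
    obtain s where s: "continuous_map (subtopology (subY intY) (V \<inter> intY)) (subX intX) s"
      "\<forall>v\<in>V \<inter> intY. f (s v) = v" "s (f p) = p" "\<forall>d\<in>D \<inter> intX. s (f d) = d"
      using sec[OF pq(1,4)] by blast
    obtain t where t: "continuous_map (subtopology (subY intY) (V \<inter> intY)) (subX intX) t"
      "\<forall>v\<in>V \<inter> intY. f (t v) = v" "t (f q) = q" "\<forall>d\<in>D \<inter> intX. t (f d) = d"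
      using sec[of q] pq by auto
    have "s (f p) = t (f p)"
    proof (rule covering_lift_unique[OF interior_covering H V_conn s(1) t(1), where b="f d"])
      show "f (s v) = f (t v)" if "v \<in> topspace (subtopology (subY intY) (V \<inter> intY))" for v
        using that s(2) t(2) by simp
      show "f d \<in> topspace (subtopology (subY intY) (V \<inter> intY))" using fd V_sub(2) by auto
      show "s (f d) = t (f d)" using s(4) t(4) d by simp
      show "f p \<in> topspace (subtopology (subY intY) (V \<inter> intY))"
        using pq(1,4) image_interior V_sub(2) by auto
    qed
    also have "t (f p) = q" unfolding pq(3) by (rule t(3))
    finally show "p = q" unfolding s(3) .
  qed
  have "inj_on f (topspace (subX intX))"
  proof (rule local_homeomorphism_inj_from_one_fibre[OF interior_local_homeomorphism proper_interior H connected_interior])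
    show "f ` topspace (subX intX) = topspace (subY intY)"
      unfolding topspaces by (rule interior_onto)
    show "f d \<in> topspace (subY intY)" using fd unfolding topspaces by blast
    show "\<exists>!e. e \<in> topspace (subX intX) \<and> f e = f d"
      unfolding topspaces
    proof (rule ex1I)
      show "d \<in> intX \<and> f d = f d" using d by simp
      show "e = d" if "e \<in> intX \<and> f e = f d" for e
        using fibre_unique[of e d] that d fd by simp
    qed
  qed
  then show ?thesis unfolding topspaces .
qed

text \<open>
  Suppose that \<open>x1\<close> and \<open>x2\<close> lie over the same boundary point \<open>y\<close>. Points close to \<open>y\<close> have all their
  preimages in the union of two disjoint open sets, one around \<open>x1\<close> and one around the rest of the
  finite fibre. The preimage of a small \<open>V \<inter> intY\<close> is connected, since \<open>f\<close> restricts to a homeomorphism of the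
  interiors, yet it has points near \<open>x1\<close> and near \<open>x2\<close>.
\<close>

lemma boundary_inj:
  assumes inj: "inj_on f intX"
  shows "inj_on f bdX"
proof (rule inj_onI, rule ccontr)
  fix x1 x2 assume x: "x1 \<in> bdX" "x2 \<in> bdX" "f x1 = f x2" "x1 \<noteq> x2"
  define y where "y = f x1"
  have y: "y \<in> bdY" using x(1) boundary by (auto simp: y_def)
  let ?F = "{x \<in> topspace X. f x = y}"
  have F: "?F = {x \<in> topspace (subX bdX). f x = y}"
    using y vimages(2) decomposition(2) unfolding topspaces by blast
  have "finite ?F"
    unfolding F by (rule proper_local_homeomorphism_finite_fibre[OF boundary_local_homeomorphism proper_boundary])
      (use y in \<open>simp only: topspaces\<close>)
  then have "compactin X {x1}" "compactin X (?F - {x1})"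
    using x(1) decomposition(2) by (auto intro!: finite_imp_compactin)
  moreover have "disjnt {x1} (?F - {x1})" by (simp add: disjnt_def)
  ultimately obtain N1 N2 where N: "openin X N1" "openin X N2" "{x1} \<subseteq> N1" "?F - {x1} \<subseteq> N2" "disjnt N1 N2"
    by (rule Hausdorff_space_compact_separation[OF Hausdorff(1)])
  have yY: "y \<in> topspace Y" using y decomposition(3) by blast
  have "openin X (N1 \<union> N2)" "?F \<subseteq> N1 \<union> N2" using N by blast+
  then have "\<exists>W. openin Y W \<and> y \<in> W \<and> {x \<in> topspace X. f x \<in> W} \<subseteq> N1 \<union> N2"
    using conjunct2[OF closed[unfolded closed_map_fibre_neighbourhood], THEN spec, THEN spec, of "N1 \<union> N2" y] yY
    by simp
  then obtain W where W: "openin Y W" "y \<in> W" "{x \<in> topspace X. f x \<in> W} \<subseteq> N1 \<union> N2"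
    by (elim exE conjE) (rule that)
  obtain V where V: "openin Y V" "y \<in> V" "V \<subseteq> W" "subY (V \<inter> intY) homeomorphic_space Euclidean_space n"
    by (rule manifold_boundary_small[OF Y(1) y W(1,2)]) (rule that, assumption+)
  have hom: "homeomorphic_map (subX intX) (subY intY) f"
  proof (rule bijective_open_imp_homeomorphic_map)
    show "continuous_map (subX intX) (subY intY) f"
      by (rule local_homeomorphism_continuous_map[OF interior_local_homeomorphism])
    show "open_map (subX intX) (subY intY) f"
      by (rule local_homeomorphism_imp_open_map[OF interior_local_homeomorphism])
  qed (simp_all only: topspaces interior_onto inj)
  let ?P = "{x \<in> intX. f x \<in> V}"
  have "f ` ?P = V \<inter> intY"
    unfolding interior_onto[symmetric] by auto
  moreover have "connectedin (subY intY) (V \<inter> intY)"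
    using homeomorphic_Euclidean_space_connectedin(1)[OF V(4)] decomposition(5)
    by (simp add: connectedin_subtopology inf.coboundedI2)
  ultimately have "connectedin (subX intX) ?P"
    using homeomorphic_map_connectedness[OF hom, of ?P] unfolding topspaces by auto
  then have P: "connectedin X ?P" by (simp add: connectedin_subtopology)
  have near: "N \<inter> ?P \<noteq> {}" if "openin X N" "x \<in> N" "f x = y" for N x
  proof -
    have "openin X (N \<inter> {x \<in> topspace X. f x \<in> V})"
      by (intro openin_Int that(1) openin_continuous_map_preimage[OF cont V(1)])
    moreover have "N \<inter> {x \<in> topspace X. f x \<in> V} \<noteq> {}"
      using that V(2) openin_subset[OF that(1)] by blast
    ultimately have "N \<inter> {x \<in> topspace X. f x \<in> V} \<inter> intX \<noteq> {}"
      by (rule manifold_boundary_closure_interior[OF X(1)])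
    then show ?thesis by blast
  qed
  have "x2 \<in> N2" using N(4) x decomposition(2) by (auto simp: y_def)
  then have "N1 \<inter> ?P \<noteq> {}" "N2 \<inter> ?P \<noteq> {}"
    using near[OF N(1), of x1] near[OF N(2), of x2] N(3) x(3) by (auto simp: y_def)
  moreover have "?P \<subseteq> N1 \<union> N2" using W(3) V(3) decomposition(4) by blast
  moreover have "N1 \<inter> N2 \<inter> ?P = {}" using N(5) by (auto simp: disjnt_def)
  ultimately show False
    using P N(1,2) unfolding connectedin by blast
qed

lemma homeomorphic_from_one_fibre:
  assumes y: "y \<in> bdY" and fibre: "{x \<in> topspace X. f x = y} = {x0}"
  shows "homeomorphic_map X Y f"
proof -
  have int: "inj_on f intX" by (rule interior_inj[OF assms])
  have bd: "inj_on f bdX" by (rule boundary_inj[OF int])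
  have "inj_on f (topspace X)"
  proof (rule inj_onI)
    fix x x' assume x: "x \<in> topspace X" "x' \<in> topspace X" "f x = f x'"
    show "x = x'"
    proof (cases "x \<in> intX")
      case True
      then have "x' \<in> intX" using vimages(1)[OF x(1)] vimages(1)[OF x(2)] x(3) by simp
      with True int x(3) show ?thesis by (auto simp: inj_on_def)
    next
      case False
      then have "x \<in> bdX" "x' \<in> bdX"
        using vimages(1)[OF x(1)] vimages(1)[OF x(2)] x by (auto simp: manifold_boundary_def)
      with bd x(3) show ?thesis by (auto simp: inj_on_def)
    qed
  qed
  then show ?thesis
    using cont closed onto by (intro bijective_closed_imp_homeomorphic_map)
qed

text \<open>
  The boundaries are locally connected, so their components are open; and \<open>f\<close> is open and closed
  between the boundaries. The image of a component is thus a nonempty connected clopen set, that is,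
  a component.
\<close>

lemma boundary_component:
  assumes "C \<in> connected_components_of (subX bdX)"
  shows "f ` C \<in> connected_components_of (subY bdY)" "openin (subX bdX) C" "path_connected_space (subX C)"
proof -
  have lpc: "locally_path_connected_space (subX bdX)"
    by (rule locally_Euclidean_imp_locally_path_connected[OF locally_Euclidean_manifold_boundary[OF X(1)]])
  show oC: "openin (subX bdX) C"
    by (rule openin_connected_components_of_locally_connected_space[OF
        locally_path_connected_imp_locally_connected_space[OF lpc] assms])
  have C: "C \<subseteq> bdX" using connected_components_of_subset[OF assms] topspaces by simp
  have Cc: "connectedin (subX bdX) C" by (rule connectedin_connected_components_of[OF assms])
  have "subtopology (subX bdX) C = subX C" using C by (simp add: subtopology_subtopology inf.absorb2)
  then have "locally_path_connected_space (subX C)" "connected_space (subX C)"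
    using locally_path_connected_space_open_subset[OF lpc oC] Cc by (simp_all add: connectedin_def)
  then show "path_connected_space (subX C)" using path_connected_eq_connected_space by blast
  have fC: "openin (subY bdY) (f ` C)"
    using local_homeomorphism_imp_open_map[OF boundary_local_homeomorphism] oC
    unfolding open_map_def by blast
  have fC': "closedin (subY bdY) (f ` C)"
    using proper_imp_closed_map[OF proper_boundary] closedin_connected_components_of[OF assms]
    unfolding closed_map_def by blast
  have "continuous_map (subX bdX) (subY bdY) f"
    by (rule local_homeomorphism_continuous_map[OF boundary_local_homeomorphism])
  then have fCc: "connectedin (subY bdY) (f ` C)"
    using connectedin_continuous_map_image Cc by blast
  have ne: "f ` C \<noteq> {}" using nonempty_connected_components_of[OF assms] by blast
  then obtain y where y: "y \<in> f ` C" by blast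
  then have "y \<in> topspace (subY bdY)" using openin_subset[OF fC] by blast
  then obtain D where D: "D \<in> connected_components_of (subY bdY)" "y \<in> D"
    using Union_connected_components_of[of "subY bdY"] by (metis UnionE)
  have sub: "f ` C \<subseteq> D"
    by (rule connected_components_of_maximal[OF D(1) fCc]) (use y D(2) in \<open>auto simp: disjnt_def\<close>)
  have "connected_space (subtopology (subY bdY) D)"
    using connectedin_connected_components_of[OF D(1)] by (simp add: connectedin_def)
  moreover have "openin (subtopology (subY bdY) D) (f ` C)"
    using fC sub by (simp add: subset_openin_subtopology)
  moreover have "closedin (subtopology (subY bdY) D) (f ` C)"
    using fC' sub by (simp add: closedin_subset_topspace)
  ultimately have "f ` C = topspace (subtopology (subY bdY) D)"
    using ne unfolding connected_space_clopen_in by blast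
  also have "\<dots> = D" using connected_components_of_subset[OF D(1)] by auto
  finally show "f ` C \<in> connected_components_of (subY bdY)" using D(1) by simp
qed

text \<open>
  Since \<open>f\<close> maps the boundary onto the boundary, it induces a surjection between the sets of
  components. These have the same finite cardinality, so no two components have the same image.
\<close>

lemma vimage_boundary_component:
  assumes fin: "finite (connected_components_of (subX bdX))"
    and card: "card (connected_components_of (subX bdX)) = card (connected_components_of (subY bdY))"
    and C: "C \<in> connected_components_of (subX bdX)" and x: "x \<in> bdX" "f x \<in> f ` C"
  shows "x \<in> C"
proof -
  let ?KX = "connected_components_of (subX bdX)" and ?KY = "connected_components_of (subY bdY)"
  have comp: "\<exists>D\<in>?KX. z \<in> D" if "z \<in> bdX" for z
    using that Union_connected_components_of[of "subX bdX"] unfolding topspaces by blast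
  have "(`) f ` ?KX = ?KY"
  proof
    show "(`) f ` ?KX \<subseteq> ?KY" using boundary_component(1) by blast
    show "?KY \<subseteq> (`) f ` ?KX"
    proof
      fix D assume D: "D \<in> ?KY"
      then obtain y where y: "y \<in> D" using nonempty_connected_components_of by blast
      then have "y \<in> f ` bdX"
        using connected_components_of_subset[OF D] unfolding boundary_onto topspaces by blast
      then obtain z where z: "z \<in> bdX" "y = f z" by (elim imageE)
      obtain E where E: "E \<in> ?KX" "z \<in> E" using comp[OF z(1)] by blast
      have "f ` E = D"
        using connected_components_of_overlap[OF boundary_component(1)[OF E(1)] D] E(2) y z(2) by blast
      then show "D \<in> (`) f ` ?KX" using E(1) by blast
    qed
  qed
  then have inj: "inj_on ((`) f) ?KX"
    using card by (intro eq_card_imp_inj_on[OF fin]) simp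
  obtain D where D: "D \<in> ?KX" "x \<in> D" using comp[OF x(1)] by blast
  have "f ` D = f ` C"
    using connected_components_of_overlap[OF boundary_component(1)[OF D(1)] boundary_component(1)[OF C]] D(2) x(2) by blast
  then have "D = C" using inj_onD[OF inj _ D(1) C] by blast
  with D(2) show ?thesis by simp
qed

lemma boundary_component_covering:
  assumes "C \<in> connected_components_of (subX bdX)"
  shows "covering_map (subX C) (subY (f ` C)) f" "finite {x \<in> topspace (subX C). f x = y}"
proof -
  have C: "C \<subseteq> bdX" using connected_components_of_subset[OF assms] topspaces by simp
  have fC: "f ` C \<subseteq> bdY" using C boundary by blast
  have lh: "local_homeomorphism (subX C) (subY (f ` C)) f"
  proof -
    have "local_homeomorphism (subtopology (subX bdX) C) (subtopology (subY bdY) (f ` C)) f"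
      by (rule local_homeomorphism_restrict[OF boundary_local_homeomorphism boundary_component(2)[OF assms]]) simp
    then show ?thesis using C fC by (simp add: subtopology_subtopology inf.absorb2)
  qed
  have "closedin (subX bdX) C" by (rule closedin_connected_components_of[OF assms])
  moreover have "compact_space (subX bdX)"
  proof -
    have "closedin X bdX"
      unfolding manifold_boundary_def using openin_manifold_interior by (rule openin_closedin_eq[THEN iffD1, THEN conjunct2])
    then show ?thesis using X(3) closedin_compact_space compact_space_subtopology by blast
  qed
  ultimately have "compactin (subX bdX) C"
    by (simp add: closedin_compact_space)
  then have "compact_space (subX C)"
    by (simp add: compactin_subtopology compact_space_subtopology)
  then have pr: "proper_map (subX C) (subY (f ` C)) f"
    by (rule continuous_imp_proper_map[OF _ Hausdorff_imp_kc_space[OF Hausdorff_space_subtopology[OF Hausdorff(2)]]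
        local_homeomorphism_continuous_map[OF lh]])
  show "covering_map (subX C) (subY (f ` C)) f"
    by (rule proper_local_homeomorphism_imp_covering_map[OF lh pr])
  show "finite {x \<in> topspace (subX C). f x = y}"
  proof (cases "y \<in> topspace (subY (f ` C))")
    case True
    then show ?thesis by (rule proper_local_homeomorphism_finite_fibre[OF lh pr])
  next
    case False
    then have "{x \<in> topspace (subX C). f x = y} = {}"
      using fC decomposition(3) by auto
    then show ?thesis by (simp only: finite.emptyI)
  qed
qed

end

section \<open>Boundary components without small covering subgroups\<close>

theorem theorem1p6:
  fixes X :: "'a topology" and Y :: "'b topology" and f :: "'a \<Rightarrow> 'b" and n k j :: nat
    and A :: "nat \<Rightarrow> 'a set" and B :: "nat \<Rightarrow> 'b set" and a :: 'a and b :: 'b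
  assumes "topological_manifold n X" and "connected_space X" and "compact_space X"
    and "topological_manifold n Y" and "connected_space Y"
    and "continuous_map X Y f"
    and "f ` manifold_boundary n X \<subseteq> manifold_boundary n Y"
    and "top_immersion (subtopology X (manifold_boundary n X)) Y f"
    and "top_immersion (subtopology X (topspace X - manifold_boundary n X)) Y f"
    and "manifold_boundary n X \<noteq> {}" and "manifold_boundary n Y \<noteq> {}"
    and "bij_betw A {1..k} (connected_components_of (subtopology X (manifold_boundary n X)))"
    and "bij_betw B {1..k} (connected_components_of (subtopology Y (manifold_boundary n Y)))"
    and "j \<in> {1..k}" and "f ` A j \<subseteq> B j"
    and "a \<in> A j" and "b \<in> B j"
    and "\<not> (\<exists>H. subgroup H (fundamental_group (subtopology Y (B j)) b) \<and>
               H \<noteq> carrier (fundamental_group (subtopology Y (B j)) b) \<and>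
               finite (rcosets\<^bsub>fundamental_group (subtopology Y (B j)) b\<^esub> H) \<and>
               fundamental_group (subtopology Y (B j)) b\<lparr>carrier := H\<rparr> \<cong>
                 fundamental_group (subtopology X (A j)) a)"
  shows "homeomorphic_map X Y f"
proof -
  interpret boundary_immersion n X Y f
    by standard (use assms in auto)
  let ?KX = "connected_components_of (subX bdX)" and ?KY = "connected_components_of (subY bdY)"
  have Aj: "A j \<in> ?KX" and Bj: "B j \<in> ?KY"
    using assms(12,13,14) by (auto simp: bij_betw_def)
  have fin: "finite ?KX"
    using bij_betw_finite[OF assms(12)] by simp
  have card: "card ?KX = card ?KY"
    using bij_betw_same_card[OF assms(12)] bij_betw_same_card[OF assms(13)] by simp
  have fA: "f ` A j = B j"
    using connected_components_of_overlap[OF boundary_component(1)[OF Aj] Bj] assms(15,16) by blast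
  have A_sub: "A j \<subseteq> bdX" "A j \<subseteq> topspace X"
    using connected_components_of_subset[OF Aj] decomposition(2) unfolding topspaces by blast+
  have "b \<in> f ` A j" using assms(17) unfolding fA .
  then obtain x where x: "x \<in> A j" "f x = b" by (elim imageE) simp
  have tA: "topspace (subX (A j)) = A j" using A_sub(2) by auto
  have cov: "covering_map (subX (A j)) (subY (B j)) f"
    using boundary_component_covering(1)[OF Aj] unfolding fA .
  \<comment> \<open>A covering with more than one sheet would exhibit a subgroup of the excluded kind.\<close>
  have "{e \<in> topspace (subX (A j)). f e = f x} = {x}"
  proof (rule covering_fibre_trivial[OF cov Hausdorff_space_subtopology[OF Hausdorff(1)] boundary_component(3)[OF Aj]])
    show "x \<in> topspace (subX (A j))" "a \<in> topspace (subX (A j))"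
      unfolding tA using x(1) assms(16) by blast+
    show "finite {e \<in> topspace (subX (A j)). f e = f x}"
      by (rule boundary_component_covering(2)[OF Aj])
  qed (unfold x(2), rule assms(18))
  then have single: "{e \<in> A j. f e = b} = {x}" unfolding tA x(2) .
  have bY: "b \<in> bdY" using x A_sub(1) boundary by blast
  have "{e \<in> topspace X. f e = b} = {x}"
  proof -
    have "e \<in> A j" if "e \<in> topspace X" "f e = b" for e
    proof (rule vimage_boundary_component[OF fin card Aj])
      show "e \<in> bdX" using vimages(2)[OF that(1)] that(2) bY by simp
      show "f e \<in> f ` A j" using \<open>b \<in> f ` A j\<close> that(2) by simp
    qed
    then have "{e \<in> topspace X. f e = b} = {e \<in> A j. f e = b}" using A_sub(2) by blast
    then show ?thesis using single by simp
  qed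
  then show ?thesis by (rule homeomorphic_from_one_fibre[OF bY])
qed

end
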